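(* There exists a nonadaptive, directional derivative $L^2$ monotonicity tester for $M$-Lipschitz functions $f:[0,1]^d\to\mathbb{R}$ with query complexity $\widetilde O(\sqrt{d}\,M^2/\epsilon^2)$ and one-sided error.
   Context: A function $f$ is $M$-Lipschitz if $|f(x)-f(y)|\le M|x-y|$ (Euclidean norm) for all $x,y$. For $x,y\in\mathbb{R}^d$, $x\preceq y$ means $x_i\le y_i$ for all $i$; $g$ is monotone if $g(x)\le g(y)$ whenever $x\preceq y$. $\mathsf{dist}^{\mathsf{mono}}_2(f)=\inf\{\|f-g\|_{L^2([0,1]^d)}: g\in L^2([0,1]^d)\text{ monotone}\}$ (Lebesgue measure). Given $d\in\mathbb{N}$, $M,\epsilon>0$, an $L^2$ monotonicity tester for $M$-Lipschitz functions with query complexity $m(d,M,\epsilon)$ is a randomized algorithm that, for every $M$-Lipschitz input $f:[0,1]^d\to\mathbb{R}$, makes $m(d,M,\epsilon)$ oracle queries to $f$, accepts with probability at least $2/3$ if $f$ is monotone, and rejects with probability at least $2/3$ if $\mathsf{dist}^{\mathsf{mono}}_2(f)\ge\epsilon$. Allowed queries: value queries (given $x$, return $f(x)$) and directional derivative queries (given $x\in[0,1]^d$ and $v\in\mathbb{R}^d$, return $v\cdot\nabla f(x)$, or $\bot$ if $f$ is not differentiable at $x$). Nonadaptive means all queries are chosen before seeing any answer; one-sided error means monotone functions are accepted with probability $1$. $\widetilde O$ hides polylogarithmic factors. *)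

theory Defs
  imports "HOL-Analysis.Analysis" "HOL-Probability.Probability"
begin

text \<open>
  The dimension is quantified inside the statement (all constants are uniform in it), so it cannot
  be a type. Points of \<open>d\<close>-dimensional Euclidean space are the extensional functions on \<open>{..<d}\<close>.
  On such functions the pointwise order of \<^typ>\<open>nat \<Rightarrow> real\<close> is the coordinatewise order, hence
  \<open>mono_on (cube d) f\<close> is monotonicity of \<open>f\<close> on the unit cube. The norm and metric, by contrast,
  have to be defined here: the library's metric on \<^typ>\<open>nat \<Rightarrow> real\<close> is not the Euclidean one.

  A function on the unit cube is a total function of which only the values on \<open>cube d\<close> are used.
\<close>

definition euclid :: "nat \<Rightarrow> (nat \<Rightarrow> real) set" where
  "euclid d = {..<d} \<rightarrow>\<^sub>E UNIV"

definition cube :: "nat \<Rightarrow> (nat \<Rightarrow> real) set" where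
  "cube d = {..<d} \<rightarrow>\<^sub>E {0..1}"

definition edist :: "nat \<Rightarrow> (nat \<Rightarrow> real) \<Rightarrow> (nat \<Rightarrow> real) \<Rightarrow> real" where
  "edist d x y = L2_set (\<lambda>i. x i - y i) {..<d}"

definition lipschitz_cube :: "nat \<Rightarrow> real \<Rightarrow> ((nat \<Rightarrow> real) \<Rightarrow> real) \<Rightarrow> bool" where
  "lipschitz_cube d M f \<longleftrightarrow> (\<forall>x\<in>cube d. \<forall>y\<in>cube d. \<bar>f x - f y\<bar> \<le> M * edist d x y)"

text \<open>The completion turns the Borel product measure into Lebesgue measure; its space is \<open>cube d\<close>.\<close>

definition cube_measure :: "nat \<Rightarrow> (nat \<Rightarrow> real) measure" where
  "cube_measure d = completion (\<Pi>\<^sub>M i\<in>{..<d}. restrict_space lborel {0..1})"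

definition L2_cube :: "nat \<Rightarrow> ((nat \<Rightarrow> real) \<Rightarrow> real) set" where
  "L2_cube d = {g \<in> borel_measurable (cube_measure d). integrable (cube_measure d) (\<lambda>x. (g x)\<^sup>2)}"

definition L2_norm_cube :: "nat \<Rightarrow> ((nat \<Rightarrow> real) \<Rightarrow> real) \<Rightarrow> real" where
  "L2_norm_cube d h = sqrt (LINT x|cube_measure d. (h x)\<^sup>2)"

definition dist_mono :: "nat \<Rightarrow> ((nat \<Rightarrow> real) \<Rightarrow> real) \<Rightarrow> real" where
  "dist_mono d f = Inf {L2_norm_cube d (\<lambda>x. f x - g x) | g. g \<in> L2_cube d \<and> mono_on (cube d) g}"

text \<open>
  Differentiability is relative to the domain, the closed cube. A gradient is unique also at
  boundary points, since the cube has inward directions along every coordinate axis.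
\<close>

definition has_gradient ::
  "nat \<Rightarrow> ((nat \<Rightarrow> real) \<Rightarrow> real) \<Rightarrow> (nat \<Rightarrow> real) \<Rightarrow> (nat \<Rightarrow> real) \<Rightarrow> bool" where
  "has_gradient d f x g \<longleftrightarrow> g \<in> euclid d \<and>
     (\<forall>e>0. \<exists>\<delta>>0. \<forall>y\<in>cube d. edist d y x < \<delta> \<longrightarrow>
        \<bar>f y - f x - (\<Sum>i<d. g i * (y i - x i))\<bar> \<le> e * edist d y x)"

definition gradient :: "nat \<Rightarrow> ((nat \<Rightarrow> real) \<Rightarrow> real) \<Rightarrow> (nat \<Rightarrow> real) \<Rightarrow> nat \<Rightarrow> real" where
  "gradient d f x = (THE g. has_gradient d f x g)"

datatype query =
    Value "nat \<Rightarrow> real"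
  | Directional_Derivative "nat \<Rightarrow> real" "nat \<Rightarrow> real"

fun legal_query :: "nat \<Rightarrow> query \<Rightarrow> bool" where
  "legal_query d (Value x) \<longleftrightarrow> x \<in> cube d"
| "legal_query d (Directional_Derivative x v) \<longleftrightarrow> x \<in> cube d \<and> v \<in> euclid d"

text \<open>The answer \<^const>\<open>None\<close> stands for \<open>\<bottom>\<close>, i.e. \<open>f\<close> is not differentiable at the point queried.\<close>

fun answer :: "nat \<Rightarrow> ((nat \<Rightarrow> real) \<Rightarrow> real) \<Rightarrow> query \<Rightarrow> real option" where
  "answer d f (Value x) = Some (f x)"
| "answer d f (Directional_Derivative x v) =
     (if \<exists>g. has_gradient d f x g then Some (\<Sum>i<d. v i * gradient d f x i) else None)"

text \<open>
  A randomized query algorithm draws a seed from \<open>seeds\<close>; given the seed and the answers received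
  so far, \<open>next_query\<close> is the query asked next, and \<open>accepts\<close> is the verdict given the seed and the
  complete list of answers.
\<close>

record 'w algorithm =
  seeds :: "'w measure"
  next_query :: "'w \<Rightarrow> real option list \<Rightarrow> query"
  accepts :: "'w \<Rightarrow> real option list \<Rightarrow> bool"

primrec answers ::
  "'w algorithm \<Rightarrow> nat \<Rightarrow> ((nat \<Rightarrow> real) \<Rightarrow> real) \<Rightarrow> 'w \<Rightarrow> nat \<Rightarrow> real option list" where
  "answers T d f \<omega> 0 = []"
| "answers T d f \<omega> (Suc k) =
     answers T d f \<omega> k @ [answer d f (next_query T \<omega> (answers T d f \<omega> k))]"

definition accept_event :: "'w algorithm \<Rightarrow> nat \<Rightarrow> ((nat \<Rightarrow> real) \<Rightarrow> real) \<Rightarrow> nat \<Rightarrow> 'w set" where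
  "accept_event T d f m = {\<omega> \<in> space (seeds T). accepts T \<omega> (answers T d f \<omega> m)}"

definition reject_event :: "'w algorithm \<Rightarrow> nat \<Rightarrow> ((nat \<Rightarrow> real) \<Rightarrow> real) \<Rightarrow> nat \<Rightarrow> 'w set" where
  "reject_event T d f m = space (seeds T) - accept_event T d f m"

text \<open>
  \<open>m\<close> is the number of queries. Measurability of the acceptance event is required for every
  admissible input, so that the acceptance probability is always defined.
\<close>

definition L2_monotonicity_tester :: "nat \<Rightarrow> real \<Rightarrow> real \<Rightarrow> nat \<Rightarrow> 'w algorithm \<Rightarrow> bool" where
  "L2_monotonicity_tester d M \<epsilon> m T \<longleftrightarrow>
     prob_space (seeds T) \<and>
     (\<forall>\<omega>\<in>space (seeds T). \<forall>h. length h < m \<longrightarrow> legal_query d (next_query T \<omega> h)) \<and>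
     (\<forall>f. lipschitz_cube d M f \<longrightarrow>
        accept_event T d f m \<in> sets (seeds T) \<and>
        (mono_on (cube d) f \<longrightarrow> measure (seeds T) (accept_event T d f m) \<ge> 2 / 3) \<and>
        (dist_mono d f \<ge> \<epsilon> \<longrightarrow> measure (seeds T) (reject_event T d f m) \<ge> 2 / 3))"

definition nonadaptive :: "nat \<Rightarrow> 'w algorithm \<Rightarrow> bool" where
  "nonadaptive m T \<longleftrightarrow>
     (\<forall>\<omega>\<in>space (seeds T). \<forall>h h'. length h = length h' \<and> length h < m \<longrightarrow>
        next_query T \<omega> h = next_query T \<omega> h')"

definition one_sided_error :: "nat \<Rightarrow> real \<Rightarrow> nat \<Rightarrow> 'w algorithm \<Rightarrow> bool" where
  "one_sided_error d M m T \<longleftrightarrow>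
     (\<forall>f. lipschitz_cube d M f \<and> mono_on (cube d) f \<longrightarrow>
        measure (seeds T) (accept_event T d f m) = 1)"

text \<open>
  \<open>q \<in> soft_O A F\<close>: on the parameter domain \<open>A\<close>, \<open>q\<close> is at most \<open>F\<close> up to a constant and a power
  of \<open>log F\<close>. The shift by 2 keeps the logarithm bounded away from 0.
\<close>

definition soft_O :: "'p set \<Rightarrow> ('p \<Rightarrow> real) \<Rightarrow> ('p \<Rightarrow> real) set" where
  "soft_O A F = {q. \<exists>C k. \<forall>p\<in>A. \<bar>q p\<bar> \<le> C * \<bar>F p\<bar> * ln (2 + \<bar>F p\<bar>) ^ k}"

end

(* A function on a grid is made monotone by sorting it in one direction after the other. Sorting is a
   fixed sequence of compare-exchange steps, so it does not increase the directed energy in the other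
   directions. Let G be the result for F. As G has at most the norm of F, |F - G|^2 <= 2 <F, F - G>.
   Summation by parts along each direction bounds the inner product by the directed energy of F, with
   a constant that does not depend on d. This is the directed Poincare inequality, and it holds at
   every scale of the grid.

   Rather than differentiate f, the tester compares two values of f. At a random dyadic scale H a
   Lipschitz function is nearly affine near most points: the second differences are the increments
   of an energy that is monotone in the scale and bounded. Since the number of scales does not enter
   the query complexity, the exceptional set can be made as small as desired, whatever its
   dependence on d. At a nearly affine point with gradient g, the tester compares f(x) with
   f(x + H 1_S) for a random set S that contains each coordinate with probability about
   2^-a / sqrt d. The Lipschitz condition on the direction of all positive g_i bounds their sum by
   M sqrt d, so if g_i <= - M 2^-a for some i in S, then i outweighs them with probability at least
   1/2. Summing over the levels a recovers the square norm of the negative part of g, up to the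
   factor M^2 sqrt d. *)

theory Submission
  imports Defs
begin

section \<open>Directed Poincare inequality on a grid\<close>

text \<open>The parameters of the sampler differ in cost. The number \<open>K\<close> of scales must
  exceed a bound that is exponential in \<open>d\<close>, and the grid size is a multiple of
  \<open>2 ^ K\<close>, but both affect only the distribution of a compared pair. The number
  \<open>A + 1\<close> of levels multiplies the number of queries, so slopes below
  \<open>M / 2 ^ A\<close> are cut off, with \<open>A\<close> logarithmic in
  \<open>d * M^2 / \<epsilon>^2\<close>.

  The obstacle to the complexity bound is that \<open>soft_O\<close> allows only logarithms of
  \<open>F = sqrt d * M^2 / \<epsilon>^2\<close>, and \<open>F\<close> may be small although
  \<open>d\<close> is large; as \<open>F\<close> tends to 0, no query may be asked at all. The way
  out is a bound on the distance itself. By the Lipschitz condition, at most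
  \<open>4 * 4 ^ a\<close> slopes at a nearly affine point are below \<open>- M / 2 ^ a\<close>, so
  the square norm of the negative part is of order \<open>M^2 * (A + 1)\<close>, without a factor
  \<open>d\<close>. If \<open>\<epsilon>^2\<close> exceeds this, no function is \<epsilon>-far and
  no query is asked. Otherwise \<open>F\<close> is bounded below by a power of \<open>d\<close> up
  to a constant, so that \<open>log d\<close> is of order \<open>log (2 + F)\<close>.\<close>

definition cex :: "nat \<Rightarrow> (nat \<Rightarrow> real) \<Rightarrow> nat \<Rightarrow> real" where
  "cex t a = a(t := min (a t) (a (Suc t)), Suc t := max (a t) (a (Suc t)))"

text \<open>Each clause survives composition, so only a single compare-exchange step has to be
  checked. The one-sided contraction is the versatile one: it gives monotonicity of \<open>S\<close>
  when its right side is 0, the decay of directed energy when \<open>a\<close> and \<open>b\<close>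
  are neighbouring lines, and the decay of the norm when one of them is 0. The clause on prefix sums
  says that mass moves only to larger indices.\<close>

definition rearrangement :: "nat \<Rightarrow> ((nat \<Rightarrow> real) \<Rightarrow> nat \<Rightarrow> real) \<Rightarrow> bool" where
  "rearrangement n S \<longleftrightarrow>
     (\<forall>a b. (\<Sum>k<n. (max 0 (S a k - S b k))\<^sup>2) \<le> (\<Sum>k<n. (max 0 (a k - b k))\<^sup>2)) \<and>
     (\<forall>a. \<forall>k\<le>n. (\<Sum>l<k. S a l) \<le> (\<Sum>l<k. a l)) \<and>
     (\<forall>a. (\<Sum>l<n. S a l) = (\<Sum>l<n. a l)) \<and>
     (\<forall>a. mono_on {..<n} a \<longrightarrow> (\<forall>k<n. S a k = a k))"

lemma rearrangement_order:
  assumes "rearrangement n S" "\<And>k. k < n \<Longrightarrow> a k \<le> b k" "k < n"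
  shows "S a k \<le> S b k"
proof -
  have "(\<Sum>k<n. (max 0 (S a k - S b k))\<^sup>2) \<le> (\<Sum>k<n. (max 0 (a k - b k))\<^sup>2)"
    using assms(1) unfolding rearrangement_def by blast
  also have "\<dots> = 0" using assms(2) by (intro sum.neutral) (simp add: max_absorb1)
  finally have "(\<Sum>k<n. (max 0 (S a k - S b k))\<^sup>2) = 0"
    by (smt (verit) sum_nonneg zero_le_power2)
  then have "(max 0 (S a k - S b k))\<^sup>2 = 0"
    using assms(3) by (subst (asm) sum_nonneg_eq_0_iff) auto
  then show ?thesis by (auto simp: max_def split: if_splits)
qed

lemma sum_two_le:
  fixes \<phi> \<psi> :: "nat \<Rightarrow> real"
  assumes "\<And>k. k \<noteq> t \<Longrightarrow> k \<noteq> Suc t \<Longrightarrow> \<phi> k = \<psi> k" "\<phi> t + \<phi> (Suc t) \<le> \<psi> t + \<psi> (Suc t)"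
    and "Suc t < n"
  shows "sum \<phi> {..<n} \<le> sum \<psi> {..<n}"
proof -
  have split: "sum h {..<n} = (h t + h (Suc t)) + sum h ({..<n} - {t, Suc t})" for h :: "nat \<Rightarrow> real"
    using assms(3) sum.subset_diff[of "{t, Suc t}" "{..<n}" h] by (auto simp: algebra_simps)
  have "sum \<phi> ({..<n} - {t, Suc t}) = sum \<psi> ({..<n} - {t, Suc t})"
    using assms(1) by (intro sum.cong) auto
  then show ?thesis using assms(2) by (simp add: split[of \<phi>] split[of \<psi>])
qed

text \<open>If the two pairs are ordered alike, both sides have the same terms. Otherwise, say
  \<open>a \<le> b\<close> and \<open>d \<le> c\<close>, the differences \<open>a - c\<close>,
  \<open>b - d\<close> have the same sum as \<open>a - d\<close>, \<open>b - c\<close> but lie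
  further apart, and the square of the positive part is convex.\<close>

lemma cex_contraction:
  fixes a b c d :: real
  shows "(max 0 (min a b - min c d))\<^sup>2 + (max 0 (max a b - max c d))\<^sup>2
           \<le> (max 0 (a - c))\<^sup>2 + (max 0 (b - d))\<^sup>2"
proof -
  have main: "(max 0 (a - d))\<^sup>2 + (max 0 (b - c))\<^sup>2 \<le> (max 0 (a - c))\<^sup>2 + (max 0 (b - d))\<^sup>2"
    if "a \<le> b" "d \<le> c" for a b c d :: real
  proof -
    define p q u v where "p = max 0 (a - d)" "q = max 0 (b - c)" "u = max 0 (a - c)" "v = max 0 (b - d)"
    have *: "p + q \<le> u + v" "u \<le> p" "p \<le> v" "u \<le> q" "q \<le> v" "0 \<le> u"
      using that unfolding p_q_u_v_def by (auto simp: max_def)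
    have "p\<^sup>2 + q\<^sup>2 \<le> u\<^sup>2 + v\<^sup>2"
    proof (cases "p \<le> q")
      case True
      have "(p - u) * (p + u) \<le> (v - q) * (v + q)" using * True by (intro mult_mono) auto
      then show ?thesis by (simp add: algebra_simps power2_eq_square)
    next
      case False
      have "(q - u) * (q + u) \<le> (v - p) * (v + p)" using * False by (intro mult_mono) auto
      then show ?thesis by (simp add: algebra_simps power2_eq_square)
    qed
    then show ?thesis unfolding p_q_u_v_def by simp
  qed
  consider "a \<le> b" "c \<le> d" | "a \<le> b" "d \<le> c" | "b \<le> a" "c \<le> d" | "b \<le> a" "d \<le> c" by linarith
  then show ?thesis
  proof cases
    case 2
    then show ?thesis using main[of a b d c] by (simp add: min_absorb1 min_absorb2 max_absorb1 max_absorb2)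
  next
    case 3
    then show ?thesis using main[of b a c d] by (simp add: min_absorb1 min_absorb2 max_absorb1 max_absorb2)
  qed (simp_all add: min_absorb1 min_absorb2 max_absorb1 max_absorb2)
qed

lemma rearrangement_cex:
  assumes "Suc t < n"
  shows "rearrangement n (cex t)"
  unfolding rearrangement_def
proof (intro conjI allI impI)
  fix a b :: "nat \<Rightarrow> real"
  show "(\<Sum>k<n. (max 0 (cex t a k - cex t b k))\<^sup>2) \<le> (\<Sum>k<n. (max 0 (a k - b k))\<^sup>2)"
    by (rule sum_two_le[OF _ _ assms]) (auto simp: cex_def cex_contraction)
next
  fix a :: "nat \<Rightarrow> real" and k assume "k \<le> n"
  \<comment> \<open>Only the prefix that ends between \<open>t\<close> and \<open>Suc t\<close>
    changes its sum: it receives the minimum of the two values.\<close>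
  consider "k \<le> t" | "k = Suc t" | "Suc t < k" by linarith
  then show "(\<Sum>l<k. cex t a l) \<le> (\<Sum>l<k. a l)"
  proof cases
    case 1
    then show ?thesis by (intro sum_mono) (auto simp: cex_def)
  next
    case 2
    have "(\<Sum>l<t. cex t a l) = (\<Sum>l<t. a l)" by (intro sum.cong) (auto simp: cex_def)
    then show ?thesis using 2 by (simp add: cex_def)
  next
    case 3
    then show ?thesis by (intro sum_two_le[of t]) (auto simp: cex_def)
  qed
next
  fix a :: "nat \<Rightarrow> real"
  show "(\<Sum>l<n. cex t a l) = (\<Sum>l<n. a l)"
    by (intro antisym sum_two_le[of t] assms) (auto simp: cex_def)
next
  fix a :: "nat \<Rightarrow> real" and k assume "mono_on {..<n} a" "k < n"
  then have "a t \<le> a (Suc t)" using assms by (auto simp: mono_on_def)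
  then show "cex t a k = a k" by (auto simp: cex_def)
qed

lemma rearrangement_comp:
  assumes "rearrangement n S" "rearrangement n T"
  shows "rearrangement n (S \<circ> T)"
  unfolding rearrangement_def o_apply
proof (intro conjI allI impI)
  fix a b :: "nat \<Rightarrow> real"
  show "(\<Sum>k<n. (max 0 (S (T a) k - S (T b) k))\<^sup>2) \<le> (\<Sum>k<n. (max 0 (a k - b k))\<^sup>2)"
    using assms unfolding rearrangement_def by (meson order_trans)
next
  fix a :: "nat \<Rightarrow> real" and k assume "k \<le> n"
  then show "(\<Sum>l<k. S (T a) l) \<le> (\<Sum>l<k. a l)"
    using assms unfolding rearrangement_def by (meson order_trans)
next
  fix a :: "nat \<Rightarrow> real" show "(\<Sum>l<n. S (T a) l) = (\<Sum>l<n. a l)"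
    using assms unfolding rearrangement_def by metis
next
  fix a :: "nat \<Rightarrow> real" and k assume *: "mono_on {..<n} a" "k < n"
  have T: "T a k = a k" if "k < n" for k
    using assms(2) * that unfolding rearrangement_def by blast
  have "S (T a) k = S a k"
    by (intro antisym rearrangement_order[OF assms(1) _ *(2)]) (auto simp: T)
  also have "\<dots> = a k" using assms(1) * unfolding rearrangement_def by blast
  finally show "S (T a) k = a k" .
qed

lemma rearrangement_id: "rearrangement n id"
  by (auto simp: rearrangement_def)

section \<open>Bubble sort as a composition of compare-exchange steps\<close>

primrec bubble_pass :: "nat \<Rightarrow> (nat \<Rightarrow> real) \<Rightarrow> nat \<Rightarrow> real" where
  "bubble_pass 0 = id"
| "bubble_pass (Suc m) = cex m \<circ> bubble_pass m"

primrec bubble_sort :: "nat \<Rightarrow> (nat \<Rightarrow> real) \<Rightarrow> nat \<Rightarrow> real" where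
  "bubble_sort 0 = id"
| "bubble_sort (Suc m) = bubble_sort m \<circ> bubble_pass m"

lemma rearrangement_bubble_pass: "m < n \<Longrightarrow> rearrangement n (bubble_pass m)"
  by (induction m) (auto intro: rearrangement_id rearrangement_comp rearrangement_cex)

lemma rearrangement_bubble_sort: "m \<le> n \<Longrightarrow> rearrangement n (bubble_sort m)"
  by (induction m)
    (simp_all add: rearrangement_id rearrangement_comp rearrangement_bubble_pass Suc_le_eq)

lemma bubble_pass_beyond: "m < k \<Longrightarrow> bubble_pass m a k = a k"
  by (induction m) (auto simp: cex_def)

lemma bubble_pass_max: "k \<le> m \<Longrightarrow> bubble_pass m a k \<le> bubble_pass m a m"
proof (induction m arbitrary: k)
  case (Suc m)
  show ?case
    using Suc.IH[of k] Suc.prems by (cases "k \<le> m") (auto simp: cex_def le_Suc_eq)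
qed auto

lemma bubble_pass_le: "(\<And>k. k \<le> m \<Longrightarrow> a k \<le> c) \<Longrightarrow> k \<le> m \<Longrightarrow> bubble_pass m a k \<le> c"
proof (induction m arbitrary: k)
  case (Suc m)
  have "bubble_pass m a l \<le> c" if "l \<le> Suc m" for l
    using Suc that by (cases "l \<le> m") (auto simp: bubble_pass_beyond)
  from this[of k] this[of m] this[of "Suc m"] show ?case
    using Suc.prems(2) by (auto simp: cex_def)
qed auto

lemma bubble_sort_beyond: "m \<le> k \<Longrightarrow> bubble_sort m a k = a k"
  by (induction m arbitrary: a) (auto simp: bubble_pass_beyond)

lemma bubble_sort_le: "(\<And>k. k < m \<Longrightarrow> a k \<le> c) \<Longrightarrow> k < m \<Longrightarrow> bubble_sort m a k \<le> c"
proof (induction m arbitrary: a k)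
  case (Suc m)
  have *: "bubble_pass m a l \<le> c" if "l \<le> m" for l
    using that by (intro bubble_pass_le) (auto intro!: Suc.prems)
  show ?case
    using Suc.prems(2) Suc.IH[of "bubble_pass m a" k] * by (cases "k < m") (auto simp: bubble_sort_beyond less_Suc_eq)
qed auto

text \<open>The first pass moves the maximum to the last position. The remaining passes do not touch
  that position and create no value above it.\<close>

lemma bubble_sort_mono: "mono_on {..<m} (bubble_sort m a)"
proof (induction m arbitrary: a)
  case (Suc m)
  let ?b = "bubble_pass m a"
  have "bubble_sort m ?b k \<le> bubble_sort m ?b l" if "k \<le> l" "l \<le> m" for k l
  proof (cases "l < m")
    case True
    then show ?thesis using Suc.IH[of ?b] that by (auto simp: mono_on_def)
  next
    case False
    with that have "l = m" by simp
    then show ?thesis using that bubble_sort_le[of m ?b "?b m" k] bubble_pass_max[of _ m a]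
      by (cases "k = m") (auto simp: bubble_sort_beyond)
  qed
  then show ?case by (auto simp: mono_on_def)
qed (auto simp: mono_on_def)

section \<open>Negative variation along a line\<close>

definition total_decrease :: "nat \<Rightarrow> (nat \<Rightarrow> real) \<Rightarrow> real" where
  "total_decrease n a = (\<Sum>k | Suc k < n. max 0 (a k - a (Suc k)))"

lemma finite_Suc_less [simp]: "finite {k. Suc k < n}"
  by (rule finite_subset[of _ "{..<n}"]) auto

lemma total_decrease_nonneg: "0 \<le> total_decrease n a"
  by (auto simp: total_decrease_def intro!: sum_nonneg)

lemma decrease_le_total:
  assumes "k \<le> l" "l < n"
  shows "a k - a l \<le> total_decrease n a"
proof -
  have "a k - a l = (\<Sum>i\<in>{k..<l}. a i - a (Suc i))"
    using assms(1) by (induction l rule: dec_induct) auto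
  also have "\<dots> \<le> (\<Sum>i\<in>{k..<l}. max 0 (a i - a (Suc i)))" by (intro sum_mono) auto
  also have "\<dots> \<le> total_decrease n a"
    unfolding total_decrease_def using assms by (intro sum_mono2) auto
  finally show ?thesis .
qed

text \<open>Compare \<open>a\<close> with its running minimum \<open>w\<close>, which is monotone and hence fixed by \<open>S\<close>.\<close>

lemma rearrangement_displacement:
  assumes S: "rearrangement n S" and k: "k < n"
  shows "\<bar>a k - S a k\<bar> \<le> total_decrease n a"
proof -
  define w where "w k = Min (a ` {k..<n})" for k
  let ?D = "total_decrease n a"
  have w_le: "w i \<le> a i" if "i < n" for i
    using that unfolding w_def by (intro Min_le) auto
  have w_ge: "a i - ?D \<le> w i" if "i < n" for i
    using that decrease_le_total[of i _ n a] unfolding w_def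
    by (subst Min_ge_iff) (auto simp: algebra_simps)
  have mono: "mono_on {..<n} w"
    by (auto simp: mono_on_def w_def intro!: Min_antimono)
  then have mono': "mono_on {..<n} (\<lambda>i. w i + ?D)" by (auto simp: mono_on_def)
  have fixed: "S v k = v k" if "mono_on {..<n} v" for v
    using S k that unfolding rearrangement_def by blast
  have "S w k \<le> S a k" by (intro rearrangement_order[OF S _ k] w_le)
  moreover have "S a k \<le> S (\<lambda>i. w i + ?D) k"
    using w_ge by (intro rearrangement_order[OF S _ k]) (auto simp: algebra_simps)
  ultimately show ?thesis using fixed[OF mono] fixed[OF mono'] w_le[OF k] w_ge[OF k] by auto
qed

lemma summation_by_parts:
  fixes b c :: "nat \<Rightarrow> real"
  assumes "(\<Sum>l<n. c l) = 0"
  shows "(\<Sum>k<n. b k * c k) = (\<Sum>k | Suc k < n. (b k - b (Suc k)) * (\<Sum>l\<le>k. c l))"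
proof (cases n)
  case (Suc m)
  have "(\<Sum>k\<le>m. b k * c k) = b m * (\<Sum>l\<le>m. c l) + (\<Sum>k<m. (b k - b (Suc k)) * (\<Sum>l\<le>k. c l))" for m
  proof (induction m)
    case (Suc m)
    then show ?case by (simp add: algebra_simps)
  qed auto
  moreover have "{k. Suc k < n} = {..<m}" using Suc by auto
  moreover have "{..<n} = {..m}" using Suc by auto
  ultimately show ?thesis using assms by simp
qed auto

text \<open>After summation by parts the weights are the prefix sums of \<open>a - S a\<close>. They
  are nonnegative because mass moves only to larger indices, so only the decreases of
  \<open>b\<close> contribute positively, and the displacement bound limits each prefix sum to
  \<open>n\<close> times the negative variation of \<open>a\<close>.\<close>

lemma rearrangement_inner:
  assumes S: "rearrangement n S"
  shows "(\<Sum>k<n. b k * (a k - S a k)) \<le> n * (total_decrease n a * total_decrease n b)"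
proof -
  let ?\<Phi> = "\<lambda>k. \<Sum>l\<le>k. a l - S a l"
  have \<Phi>: "0 \<le> ?\<Phi> k \<and> ?\<Phi> k \<le> n * total_decrease n a" if "Suc k < n" for k
  proof
    have "(\<Sum>l<Suc k. S a l) \<le> (\<Sum>l<Suc k. a l)"
      using S that unfolding rearrangement_def by (meson less_imp_le)
    then show "0 \<le> ?\<Phi> k" by (simp add: sum_subtractf lessThan_Suc_atMost)
    have "?\<Phi> k \<le> of_nat (card {..k}) * total_decrease n a"
      using rearrangement_displacement[OF S, of _ a] that
      by (intro sum_bounded_above) (force simp: abs_le_iff)
    also have "\<dots> \<le> n * total_decrease n a"
      using that by (intro mult_right_mono total_decrease_nonneg) auto
    finally show "?\<Phi> k \<le> n * total_decrease n a" .
  qed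
  have "(\<Sum>l<n. a l - S a l) = 0" using S by (simp add: rearrangement_def sum_subtractf)
  then have "(\<Sum>k<n. b k * (a k - S a k)) = (\<Sum>k | Suc k < n. (b k - b (Suc k)) * ?\<Phi> k)"
    by (rule summation_by_parts)
  also have "\<dots> \<le> (\<Sum>k | Suc k < n. max 0 (b k - b (Suc k)) * (n * total_decrease n a))"
  proof (intro sum_mono)
    fix k assume "k \<in> {k. Suc k < n}"
    then have "0 \<le> ?\<Phi> k" "?\<Phi> k \<le> n * total_decrease n a" using \<Phi>[of k] by auto
    then show "(b k - b (Suc k)) * ?\<Phi> k \<le> max 0 (b k - b (Suc k)) * (n * total_decrease n a)"
      by (meson max.cobounded1 max.cobounded2 mult_left_mono mult_right_mono order_trans)
  qed
  also have "\<dots> = total_decrease n b * (n * total_decrease n a)"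
    unfolding total_decrease_def[of n b] sum_distrib_right ..
  also have "\<dots> = n * (total_decrease n a * total_decrease n b)" by simp
  finally show ?thesis .
qed

lemma total_decrease_square:
  "(total_decrease n a)\<^sup>2 \<le> n * (\<Sum>k | Suc k < n. (max 0 (a k - a (Suc k)))\<^sup>2)"
proof -
  have "(total_decrease n a)\<^sup>2 \<le> (\<Sum>k | Suc k < n. 1\<^sup>2) * (\<Sum>k | Suc k < n. (max 0 (a k - a (Suc k)))\<^sup>2)"
    using Cauchy_Schwarz_ineq_sum[of "\<lambda>_. 1" "\<lambda>k. max 0 (a k - a (Suc k))" "{k. Suc k < n}"]
    by (simp add: total_decrease_def)
  also have "\<dots> \<le> n * (\<Sum>k | Suc k < n. (max 0 (a k - a (Suc k)))\<^sup>2)"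
  proof (intro mult_right_mono sum_nonneg)
    have "card {k. Suc k < n} \<le> card {..<n}" by (intro card_mono) auto
    then show "(\<Sum>k | Suc k < n. (1::real)\<^sup>2) \<le> n" by simp
  qed auto
  finally show ?thesis .
qed

section \<open>Sorting a grid function in one direction\<close>

definition grid :: "nat \<Rightarrow> nat \<Rightarrow> (nat \<Rightarrow> nat) set" where
  "grid d n = {..<d} \<rightarrow>\<^sub>E {..<n}"

lemma finite_grid [simp]: "finite (grid d n)"
  by (auto simp: grid_def intro: finite_PiE)

lemma card_grid [simp]: "card (grid d n) = n ^ d"
  by (simp add: grid_def card_PiE)

lemma grid_upd: "x \<in> grid d n \<Longrightarrow> i < d \<Longrightarrow> k < n \<Longrightarrow> x(i := k) \<in> grid d n"
  by (auto simp: grid_def PiE_iff extensional_def)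

lemma gridD: "x \<in> grid d n \<Longrightarrow> i < d \<Longrightarrow> x i < n"
  by (auto simp: grid_def PiE_iff)

text \<open>Exchanging the value \<open>k\<close> with the coordinate \<open>x i\<close> is an
  involution on the pairs of a grid point and a value.\<close>

lemma sum_lines:
  fixes \<phi> :: "(nat \<Rightarrow> nat) \<Rightarrow> real"
  assumes "i < d"
  shows "(\<Sum>x\<in>grid d n. \<Sum>k<n. \<phi> (x(i := k))) = n * (\<Sum>x\<in>grid d n. \<phi> x)"
proof -
  let ?flip = "\<lambda>(x, k). (x(i := k), x i)"
  have "(\<Sum>x\<in>grid d n. \<Sum>k<n. \<phi> (x(i := k))) = (\<Sum>(x, k)\<in>grid d n \<times> {..<n}. \<phi> (x(i := k)))"
    by (rule sum.cartesian_product)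
  also have "\<dots> = (\<Sum>(x, k)\<in>grid d n \<times> {..<n}. \<phi> x)"
    by (rule sum.reindex_bij_witness[of _ ?flip ?flip])
      (auto intro: grid_upd gridD assms)
  also have "\<dots> = (\<Sum>x\<in>grid d n. \<Sum>k<n. \<phi> x)" by (rule sum.cartesian_product[symmetric])
  also have "\<dots> = n * (\<Sum>x\<in>grid d n. \<phi> x)" by (simp add: sum_distrib_left)
  finally show ?thesis .
qed

lemma sum_le_by_lines:
  fixes \<phi> \<psi> :: "(nat \<Rightarrow> nat) \<Rightarrow> real"
  assumes "i < d" "0 < n"
    and "\<And>x. x \<in> grid d n \<Longrightarrow> (\<Sum>k<n. \<phi> (x(i := k))) \<le> (\<Sum>k<n. \<psi> (x(i := k)))"
  shows "sum \<phi> (grid d n) \<le> sum \<psi> (grid d n)"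
proof -
  have "n * sum \<phi> (grid d n) \<le> n * sum \<psi> (grid d n)"
    unfolding sum_lines[OF assms(1), symmetric] by (intro sum_mono assms(3))
  then show ?thesis using assms(2) by simp
qed

definition grid_energy :: "nat \<Rightarrow> nat \<Rightarrow> ((nat \<Rightarrow> nat) \<Rightarrow> real) \<Rightarrow> nat \<Rightarrow> real" where
  "grid_energy d n u i =
     (\<Sum>x\<in>grid d n. if Suc (x i) < n then (max 0 (u x - u (x(i := Suc (x i)))))\<^sup>2 else 0)"

definition sort_dir :: "nat \<Rightarrow> nat \<Rightarrow> ((nat \<Rightarrow> nat) \<Rightarrow> real) \<Rightarrow> (nat \<Rightarrow> nat) \<Rightarrow> real" where
  "sort_dir n i u x = bubble_sort n (\<lambda>k. u (x(i := k))) (x i)"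

lemma grid_energy_nonneg: "0 \<le> grid_energy d n u i"
  by (auto simp: grid_energy_def intro!: sum_nonneg)

text \<open>The line in direction \<open>i\<close> through \<open>x\<close> and the line through its
  neighbour in direction \<open>j\<close> are sorted by the same operator, so the contraction clause
  applies to this pair. The boundary test on the coordinate \<open>j\<close> is constant along the
  line.\<close>

lemma grid_energy_sort_dir_other:
  assumes "i < d" "j \<noteq> i" "0 < n"
  shows "grid_energy d n (sort_dir n i u) j \<le> grid_energy d n u j"
  unfolding grid_energy_def
proof (rule sum_le_by_lines[OF assms(1,3)])
  fix x assume "x \<in> grid d n"
  let ?a = "\<lambda>k. u (x(i := k))" and ?b = "\<lambda>k. u ((x(j := Suc (x j)))(i := k))"
  have "(\<Sum>k<n. (max 0 (bubble_sort n ?a k - bubble_sort n ?b k))\<^sup>2) \<le> (\<Sum>k<n. (max 0 (?a k - ?b k))\<^sup>2)"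
    using rearrangement_bubble_sort[of n n] unfolding rearrangement_def by blast
  then show "(\<Sum>k<n. if Suc ((x(i := k)) j) < n
        then (max 0 (sort_dir n i u (x(i := k)) - sort_dir n i u ((x(i := k))(j := Suc ((x(i := k)) j)))))\<^sup>2 else 0)
      \<le> (\<Sum>k<n. if Suc ((x(i := k)) j) < n
        then (max 0 (u (x(i := k)) - u ((x(i := k))(j := Suc ((x(i := k)) j)))))\<^sup>2 else 0)"
    using assms(2)
    by (cases "Suc (x j) < n") (simp_all add: sort_dir_def fun_upd_twist[of i j] cong: if_cong)
qed

lemma sort_dir_mono:
  assumes "x i \<le> k" "k < n"
  shows "sort_dir n i u x \<le> sort_dir n i u (x(i := k))"
  using bubble_sort_mono[of n "\<lambda>k. u (x(i := k))"] assms
  by (auto simp: sort_dir_def mono_on_def)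

lemma grid_energy_sort_dir_same: "grid_energy d n (sort_dir n i u) i = 0"
  unfolding grid_energy_def by (intro sum.neutral) (auto simp: max_def sort_dir_mono intro!: antisym)

text \<open>A square is the sum of the squares of the positive and the negative part. Both are
  one-sided differences to the zero sequence, which sorting fixes.\<close>

lemma sum_sort_dir_square:
  assumes "i < d" "0 < n"
  shows "(\<Sum>x\<in>grid d n. (sort_dir n i u x)\<^sup>2) \<le> (\<Sum>x\<in>grid d n. (u x)\<^sup>2)"
proof (rule sum_le_by_lines[OF assms])
  fix x assume "x \<in> grid d n"
  let ?S = "bubble_sort n" and ?a = "\<lambda>k. u (x(i := k))"
  have S: "rearrangement n ?S" by (simp add: rearrangement_bubble_sort)
  have zero: "?S (\<lambda>_. 0) k = 0" if "k < n" for k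
    using S that unfolding rearrangement_def by (auto simp: mono_on_def)
  have sq: "r\<^sup>2 = (max 0 r)\<^sup>2 + (max 0 (0 - r))\<^sup>2" for r :: real by (auto simp: max_def)
  have "(\<Sum>k<n. (?S ?a k)\<^sup>2)
      = (\<Sum>k<n. (max 0 (?S ?a k - ?S (\<lambda>_. 0) k))\<^sup>2) + (\<Sum>k<n. (max 0 (?S (\<lambda>_. 0) k - ?S ?a k))\<^sup>2)"
    unfolding sum.distrib[symmetric] by (intro sum.cong refl) (simp add: zero sq[symmetric] del: diff_0)
  also have "\<dots> \<le> (\<Sum>k<n. (max 0 (?a k - 0))\<^sup>2) + (\<Sum>k<n. (max 0 (0 - ?a k))\<^sup>2)"
    using S unfolding rearrangement_def by (intro add_mono) blast+
  also have "\<dots> = (\<Sum>k<n. (?a k)\<^sup>2)"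
    unfolding sum.distrib[symmetric] by (intro sum.cong refl) (simp add: sq[symmetric] del: diff_0)
  finally show "(\<Sum>k<n. (sort_dir n i u (x(i := k)))\<^sup>2) \<le> (\<Sum>k<n. (u (x(i := k)))\<^sup>2)"
    by (simp add: sort_dir_def)
qed

lemma sum_total_decrease_square:
  assumes "i < d" "0 < n"
  shows "(\<Sum>x\<in>grid d n. (total_decrease n (\<lambda>k. u (x(i := k))))\<^sup>2) \<le> (real n)\<^sup>2 * grid_energy d n u i"
proof -
  have "(\<Sum>x\<in>grid d n. (total_decrease n (\<lambda>k. u (x(i := k))))\<^sup>2)
      \<le> (\<Sum>x\<in>grid d n. n * (\<Sum>k | Suc k < n. (max 0 (u (x(i := k)) - u (x(i := Suc k))))\<^sup>2))"
    by (intro sum_mono total_decrease_square)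
  also have "\<dots> = n * (\<Sum>x\<in>grid d n. \<Sum>k | Suc k < n. (max 0 (u (x(i := k)) - u (x(i := Suc k))))\<^sup>2)"
    by (simp add: sum_distrib_left)
  also have "\<dots> = n * (\<Sum>x\<in>grid d n. \<Sum>k<n. if Suc k < n then (max 0 (u (x(i := k)) - u (x(i := Suc k))))\<^sup>2 else 0)"
    by (intro arg_cong[where f = "\<lambda>r. real n * r"] sum.cong sum.mono_neutral_cong_left) auto
  also have "\<dots> = (real n)\<^sup>2 * grid_energy d n u i"
    using sum_lines[OF assms(1), of "\<lambda>x. if Suc (x i) < n then (max 0 (u x - u (x(i := Suc (x i)))))\<^sup>2 else 0" n]
    by (simp add: grid_energy_def power2_eq_square cong: if_cong)
  finally show ?thesis .
qed

lemma sort_dir_inner: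
  assumes "i < d" "0 < n"
  shows "(\<Sum>x\<in>grid d n. F x * (u x - sort_dir n i u x))
           \<le> (real n)\<^sup>2 * (grid_energy d n u i + grid_energy d n F i) / 2"
proof -
  have S: "rearrangement n (bubble_sort n)" by (simp add: rearrangement_bubble_sort)
  let ?D = "\<lambda>u x. total_decrease n (\<lambda>k. u (x(i := k)))"
  have "n * (\<Sum>x\<in>grid d n. F x * (u x - sort_dir n i u x))
      = (\<Sum>x\<in>grid d n. \<Sum>k<n. F (x(i := k)) * (u (x(i := k)) - bubble_sort n (\<lambda>k. u (x(i := k))) k))"
    unfolding sum_lines[OF assms(1), symmetric] by (simp add: sort_dir_def)
  also have "\<dots> \<le> (\<Sum>x\<in>grid d n. n * (?D u x * ?D F x))"
    by (intro sum_mono rearrangement_inner S)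
  also have "\<dots> \<le> (\<Sum>x\<in>grid d n. n * (((?D u x)\<^sup>2 + (?D F x)\<^sup>2) / 2))"
  proof (intro sum_mono mult_left_mono)
    fix x show "?D u x * ?D F x \<le> ((?D u x)\<^sup>2 + (?D F x)\<^sup>2) / 2"
      using sum_squares_bound[of "?D u x" "?D F x"] by simp
  qed auto
  also have "\<dots> = n * ((\<Sum>x\<in>grid d n. (?D u x)\<^sup>2) + (\<Sum>x\<in>grid d n. (?D F x)\<^sup>2)) / 2"
    by (simp add: sum_distrib_left sum.distrib[symmetric] sum_divide_distrib)
  also have "\<dots> \<le> n * ((real n)\<^sup>2 * grid_energy d n u i + (real n)\<^sup>2 * grid_energy d n F i) / 2"
    using sum_total_decrease_square[OF assms, of u] sum_total_decrease_square[OF assms, of F]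
    by (intro divide_right_mono mult_left_mono add_mono) auto
  finally have "n * (\<Sum>x\<in>grid d n. F x * (u x - sort_dir n i u x))
      \<le> n * ((real n)\<^sup>2 * (grid_energy d n u i + grid_energy d n F i) / 2)"
    by (simp add: algebra_simps)
  then show ?thesis using assms(2) by simp
qed

lemma grid_mono:
  assumes G: "\<And>x i. x \<in> grid d n \<Longrightarrow> i < d \<Longrightarrow> Suc (x i) < n \<Longrightarrow> G x \<le> G (x(i := Suc (x i)))"
    and xy: "x \<in> grid d n" "y \<in> grid d n" "\<And>i. i < d \<Longrightarrow> x i \<le> y i"
  shows "G x \<le> (G y :: real)"
proof -
  have line: "G x \<le> G (x(i := k))" if "x \<in> grid d n" "i < d" "x i \<le> k" "k < n" for x i k
    using that(3,4)
  proof (induction k rule: dec_induct)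
    case (step k)
    then show ?case
      using G[of "x(i := k)" i] that(1,2) grid_upd[of x d n i k] by (auto simp del: fun_upd_apply simp: fun_upd_same)
  qed (simp add: that)
  define z where "z m i = (if i < m then y i else x i)" for m i
  have zg: "z m \<in> grid d n" if "m \<le> d" for m
    using xy that by (auto simp: z_def grid_def PiE_iff extensional_def)
  have "G x \<le> G (z m)" if "m \<le> d" for m
    using that
  proof (induction m)
    case 0
    have "z 0 = x" by (auto simp: z_def)
    then show ?case by simp
  next
    case (Suc m)
    have "z (Suc m) = (z m)(m := y m)" by (auto simp: z_def fun_eq_iff less_Suc_eq)
    moreover have "z m m \<le> y m" using xy(3)[of m] Suc.prems by (simp add: z_def)
    ultimately have "G (z m) \<le> G (z (Suc m))"
      using line[OF zg[of m], of m "y m"] Suc.prems gridD[OF xy(2), of m] by simp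
    then show ?case using Suc by simp
  qed
  moreover have "z d = y" using xy by (auto simp: z_def grid_def PiE_iff extensional_def fun_eq_iff)
  ultimately show ?thesis by blast
qed

theorem grid_directed_poincare:
  assumes "0 < n"
  shows "\<exists>G. (\<forall>x\<in>grid d n. \<forall>y\<in>grid d n. (\<forall>i<d. x i \<le> y i) \<longrightarrow> G x \<le> G y) \<and>
    (\<Sum>x\<in>grid d n. (F x - G x)\<^sup>2) \<le> 2 * (real n)\<^sup>2 * (\<Sum>i<d. grid_energy d n F i)"
proof -
  define u where "u = rec_nat F (sort_dir n)"
  have u: "u 0 = F" "u (Suc i) = sort_dir n i (u i)" for i by (auto simp: u_def)
  \<comment> \<open>A direction that has been sorted has energy 0 and keeps it, since sorting
    another direction cannot increase it.\<close>
  have energy: "grid_energy d n (u i) j \<le> (if j < i then 0 else grid_energy d n F j)" if "i \<le> d" for i j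
    using that
  proof (induction i)
    case 0
    then show ?case by (simp add: u)
  next
    case (Suc i)
    show ?case
    proof (cases "j = i")
      case True
      then show ?thesis by (simp add: u grid_energy_sort_dir_same)
    next
      case False
      then have "grid_energy d n (u (Suc i)) j \<le> grid_energy d n (u i) j"
        using Suc.prems assms by (simp add: u grid_energy_sort_dir_other)
      also have "\<dots> \<le> (if j < i then 0 else grid_energy d n F j)" using Suc by simp
      finally show ?thesis using False by (simp split: if_splits)
    qed
  qed
  have zero: "grid_energy d n (u d) i = 0" if "i < d" for i
    using energy[of d i] that grid_energy_nonneg[of d n "u d" i] by simp
  have edge: "u d x \<le> u d (x(i := Suc (x i)))"
    if "x \<in> grid d n" "i < d" "Suc (x i) < n" for x i
    using that zero[OF that(2)] unfolding grid_energy_def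
    by (subst (asm) sum_nonneg_eq_0_iff) (auto simp: max_def split: if_splits dest!: bspec)
  have "(\<Sum>x\<in>grid d n. F x * (F x - u m x)) \<le> (\<Sum>i<m. (real n)\<^sup>2 * grid_energy d n F i)" if "m \<le> d" for m
    using that
  proof (induction m)
    case 0
    then show ?case by (simp add: u)
  next
    case (Suc m)
    have "(\<Sum>x\<in>grid d n. F x * (u m x - u (Suc m) x))
        \<le> (real n)\<^sup>2 * (grid_energy d n (u m) m + grid_energy d n F m) / 2"
      unfolding u using Suc.prems assms by (intro sort_dir_inner) auto
    \<comment> \<open>Direction \<open>m\<close> has not been sorted yet, so its energy in the
      partially sorted function is still controlled by that in \<open>F\<close>. Each direction is
      thus charged once, which keeps the constant free of \<open>d\<close>.\<close>
    also have "\<dots> \<le> (real n)\<^sup>2 * (grid_energy d n F m + grid_energy d n F m) / 2"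
      using energy[of m m] Suc.prems by (intro divide_right_mono mult_left_mono add_mono) auto
    finally have "(\<Sum>x\<in>grid d n. F x * (u m x - u (Suc m) x)) \<le> (real n)\<^sup>2 * grid_energy d n F m" by simp
    moreover have "(\<Sum>x\<in>grid d n. F x * (F x - u (Suc m) x))
        = (\<Sum>x\<in>grid d n. F x * (F x - u m x)) + (\<Sum>x\<in>grid d n. F x * (u m x - u (Suc m) x))"
      by (simp add: sum.distrib[symmetric] algebra_simps)
    ultimately show ?case using Suc by simp
  qed
  then have inner: "(\<Sum>x\<in>grid d n. F x * (F x - u d x)) \<le> (real n)\<^sup>2 * (\<Sum>i<d. grid_energy d n F i)"
    by (simp add: sum_distrib_left)
  have norm: "(\<Sum>x\<in>grid d n. (u m x)\<^sup>2) \<le> (\<Sum>x\<in>grid d n. (F x)\<^sup>2)" if "m \<le> d" for m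
    using that
  proof (induction m)
    case (Suc m)
    then show ?case using sum_sort_dir_square[of m d n "u m"] assms by (simp add: u)
  qed (simp add: u)
  have "(\<Sum>x\<in>grid d n. (F x - u d x)\<^sup>2)
      = 2 * (\<Sum>x\<in>grid d n. F x * (F x - u d x)) + (\<Sum>x\<in>grid d n. (u d x)\<^sup>2) - (\<Sum>x\<in>grid d n. (F x)\<^sup>2)"
    by (simp add: sum_distrib_left sum.distrib[symmetric] sum_subtractf[symmetric] power2_eq_square algebra_simps)
  also have "\<dots> \<le> 2 * (real n)\<^sup>2 * (\<Sum>i<d. grid_energy d n F i)" using inner norm[of d] by simp
  finally show ?thesis using grid_mono[of d n "u d"] edge by blast
qed

section \<open>Directed Poincare inequality on the cube\<close>

text \<open>The cap assigns \<open>t = 1\<close> to the last cell, which is therefore closed on the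
  right.\<close>

definition cell_index :: "nat \<Rightarrow> real \<Rightarrow> nat" where
  "cell_index n t = min (n - 1) (nat \<lfloor>real n * t\<rfloor>)"

definition cell :: "nat \<Rightarrow> nat \<Rightarrow> (nat \<Rightarrow> real) \<Rightarrow> nat \<Rightarrow> nat" where
  "cell d n x = (\<lambda>i\<in>{..<d}. cell_index n (x i))"

lemma cell_grid: "0 < n \<Longrightarrow> cell d n x \<in> grid d n"
  by (auto simp: cell_def grid_def cell_index_def)

lemma cell_index_bounds:
  assumes "0 < n" "0 \<le> t" "t \<le> 1"
  shows "real (cell_index n t) \<le> n * t" "n * t \<le> real (cell_index n t) + 1"
proof -
  have "0 \<le> real n * t" using assms by simp
  then have *: "real (nat \<lfloor>real n * t\<rfloor>) \<le> n * t" "n * t < real (nat \<lfloor>real n * t\<rfloor>) + 1" by linarith+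
  have "n * t \<le> n" using assms by (simp add: mult_left_le)
  then show "real (cell_index n t) \<le> n * t" "n * t \<le> real (cell_index n t) + 1"
    using * assms(1) by (auto simp: cell_index_def min_def of_nat_diff)
qed

lemma cell_index_mono: "s \<le> t \<Longrightarrow> cell_index n s \<le> cell_index n t"
  unfolding cell_index_def by (intro min.mono nat_mono floor_mono mult_left_mono) auto

abbreviation unit_interval :: "real measure" where
  "unit_interval \<equiv> restrict_space lborel {0..1}"

abbreviation borel_cube :: "nat \<Rightarrow> (nat \<Rightarrow> real) measure" where
  "borel_cube d \<equiv> \<Pi>\<^sub>M i\<in>{..<d}. unit_interval"

lemma prob_space_unit_interval: "prob_space unit_interval"
  by (intro prob_spaceI) (simp add: emeasure_restrict_space space_restrict_space)

lemma prob_space_borel_cube: "prob_space (borel_cube d)"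
  by (intro prob_space_PiM prob_space_unit_interval)

lemma space_borel_cube: "space (borel_cube d) = cube d"
  by (simp add: space_PiM cube_def space_restrict_space)

lemma cell_index_sets: "{t \<in> {0..1}. cell_index n t = k} \<in> sets unit_interval"
proof -
  have "cell_index n \<in> measurable borel (count_space UNIV)"
    unfolding cell_index_def by measurable
  then have "cell_index n -` {k} \<inter> space borel \<in> sets borel"
    by (rule measurable_sets) simp
  then show ?thesis
    by (subst sets_restrict_space_iff) (auto simp: vimage_def Collect_conj_eq)
qed

lemma emeasure_cell_index:
  assumes "k < n"
  shows "emeasure unit_interval {t \<in> {0..1}. cell_index n t = k} = ennreal (1 / n)"
proof -
  have n: "0 < real n" using assms by simp
  have len: "(real k + 1) / n - k / n = 1 / n" using n by (simp add: field_simps)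
  have le: "real k / n \<le> (real k + 1) / n" using n by (simp add: divide_right_mono)
  have "emeasure unit_interval {t \<in> {0..1}. cell_index n t = k} = emeasure lborel {t \<in> {0..1}. cell_index n t = k}"
    by (subst emeasure_restrict_space) auto
  also have "\<dots> = ennreal (1 / n)"
  \<comment> \<open>The last cell is a closed interval, all others are half-open.\<close>
  proof (cases "Suc k = n")
    case True
    have "{t \<in> {0..1}. cell_index n t = k} = {k / n .. (real k + 1) / n}"
    proof -
      have e1: "(real k + 1) / n = 1" using True n by (simp add: field_simps flip: True)
      have e2: "cell_index n t = k \<longleftrightarrow> k / n \<le> t" if "0 \<le> t" "t \<le> 1" for t
      proof -
        have "0 \<le> \<lfloor>real n * t\<rfloor>" using that by simp
        then have "cell_index n t = k \<longleftrightarrow> int k \<le> \<lfloor>real n * t\<rfloor>"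
          using True unfolding cell_index_def by linarith
        also have "\<dots> \<longleftrightarrow> k / n \<le> t" using n by (simp add: le_floor_iff field_simps)
        finally show ?thesis .
      qed
      have e3: "0 \<le> real k / n" by simp
      show ?thesis unfolding e1
      proof (intro set_eqI iffI)
        fix t assume "t \<in> {k / n..1}"
        moreover from this have "0 \<le> t" by (auto intro: order_trans[OF e3])
        ultimately show "t \<in> {t \<in> {0..1}. cell_index n t = k}" using e2[of t] by auto
      qed (use e2 in auto)
    qed
    then show ?thesis using len le by simp
  next
    case False
    have "{t \<in> {0..1}. cell_index n t = k} = {k / n ..< (real k + 1) / n}"
    proof -
      have e1: "(real k + 1) / n \<le> 1" using False assms n by (simp add: field_simps)
      have e2: "cell_index n t = k \<longleftrightarrow> k / n \<le> t \<and> t < (real k + 1) / n" if "0 \<le> t" "t \<le> 1" for t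
      proof -
        have "cell_index n t = k \<longleftrightarrow> \<lfloor>real n * t\<rfloor> = int k"
          using False assms that by (auto simp: cell_index_def min_def)
        also have "\<dots> \<longleftrightarrow> k / n \<le> t \<and> t < (real k + 1) / n" using n by (simp add: floor_eq_iff field_simps)
        finally show ?thesis .
      qed
      have e3: "0 \<le> real k / n" by simp
      show ?thesis
      proof (intro set_eqI iffI)
        fix t assume "t \<in> {k / n..<(real k + 1) / n}"
        moreover from this have "0 \<le> t" by (auto intro: order_trans[OF e3])
        moreover from calculation e1 have "t \<le> 1" by auto
        ultimately show "t \<in> {t \<in> {0..1}. cell_index n t = k}" using e2[of t] by auto
      qed (use e2 in auto)
    qed
    then show ?thesis using len le by simp
  qed
  finally show ?thesis .
qed

lemma cell_vimage: "{x \<in> cube d. cell d n x = k} =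
    (if k \<in> extensional {..<d} then PiE {..<d} (\<lambda>i. {t \<in> {0..1}. cell_index n t = k i}) else {})"
  by (auto simp: cube_def cell_def PiE_iff extensional_def fun_eq_iff restrict_def)

lemma sets_cell: "{x \<in> cube d. cell d n x = k} \<in> sets (borel_cube d)"
  unfolding cell_vimage by (simp add: sets_PiM_I_finite cell_index_sets del: atLeastAtMost_iff)

lemma measure_cell:
  assumes "k \<in> grid d n"
  shows "measure (borel_cube d) {x \<in> cube d. cell d n x = k} = 1 / real n ^ d"
proof -
  interpret product_sigma_finite "\<lambda>_ :: nat. unit_interval"
    by (intro product_sigma_finite.intro prob_space_imp_sigma_finite prob_space_unit_interval)
  have "emeasure (borel_cube d) {x \<in> cube d. cell d n x = k}
      = (\<Prod>i<d. emeasure unit_interval {t \<in> {0..1}. cell_index n t = k i})"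
    using assms unfolding cell_vimage
    by (subst emeasure_PiM[symmetric]) (simp_all add: grid_def PiE_iff cell_index_sets del: atLeastAtMost_iff)
  also have "\<dots> = (\<Prod>i<d. ennreal (1 / n))"
    using assms by (intro prod.cong refl emeasure_cell_index) (auto dest: gridD)
  also have "\<dots> = ennreal (1 / real n ^ d)" by (simp add: ennreal_power power_one_over)
  finally show ?thesis by (simp add: measure_def)
qed

lemma step_function:
  fixes \<phi> :: "(nat \<Rightarrow> nat) \<Rightarrow> real"
  assumes "0 < n"
  shows "integrable (cube_measure d) (\<lambda>x. \<phi> (cell d n x))"
    and "(LINT x|cube_measure d. \<phi> (cell d n x)) = (\<Sum>k\<in>grid d n. \<phi> k) / real n ^ d"
proof -
  interpret prob_space "borel_cube d" by (rule prob_space_borel_cube)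
  let ?s = "\<lambda>x. \<Sum>k\<in>grid d n. \<phi> k * indicator {x \<in> cube d. cell d n x = k} x"
  have eq: "\<phi> (cell d n x) = ?s x" if "x \<in> cube d" for x
  proof -
    have "?s x = (\<Sum>k\<in>grid d n. if k = cell d n x then \<phi> k else 0)"
      using that by (intro sum.cong) (auto simp: indicator_def)
    then show ?thesis using cell_grid[OF assms] by simp
  qed
  have int: "integrable (borel_cube d) ?s"
    by (intro Bochner_Integration.integrable_sum integrable_mult_right integrable_real_indicator sets_cell)
      (simp add: emeasure_eq_measure)
  have int': "integrable (borel_cube d) (\<lambda>x. \<phi> (cell d n x))"
    using int by (subst Bochner_Integration.integrable_cong[OF refl eq]) (simp_all add: space_borel_cube)
  then show "integrable (cube_measure d) (\<lambda>x. \<phi> (cell d n x))"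
    unfolding cube_measure_def by (simp add: integrable_completion)
  have "(LINT x|cube_measure d. \<phi> (cell d n x)) = (LINT x|borel_cube d. \<phi> (cell d n x))"
    unfolding cube_measure_def using int' by (intro integral_completion) auto
  also have "\<dots> = (LINT x|borel_cube d. ?s x)"
    by (intro Bochner_Integration.integral_cong) (auto simp: space_borel_cube eq)
  also have "\<dots> = (\<Sum>k\<in>grid d n. \<phi> k * measure (borel_cube d) {x \<in> cube d. cell d n x = k})"
    by (subst Bochner_Integration.integral_sum)
      (auto intro!: integrable_mult_right integrable_real_indicator sets_cell sum.cong
        simp: emeasure_eq_measure sets_cell Int_absorb1 sets.sets_into_space)
  also have "\<dots> = (\<Sum>k\<in>grid d n. \<phi> k / real n ^ d)"
    by (intro sum.cong refl) (simp add: measure_cell)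
  also have "\<dots> = (\<Sum>k\<in>grid d n. \<phi> k) / real n ^ d" by (rule sum_divide_distrib[symmetric])
  finally show "(LINT x|cube_measure d. \<phi> (cell d n x)) = (\<Sum>k\<in>grid d n. \<phi> k) / real n ^ d" .
qed

lemma space_cube_measure: "space (cube_measure d) = cube d"
  by (simp add: cube_measure_def space_borel_cube)

lemma edist_le:
  assumes "\<And>i. i < d \<Longrightarrow> \<bar>x i - y i\<bar> \<le> r" "0 \<le> r"
  shows "edist d x y \<le> r * sqrt d"
proof -
  have "(\<Sum>i<d. (x i - y i)\<^sup>2) \<le> (\<Sum>i<d. r\<^sup>2)"
    using assms(1) by (intro sum_mono) (simp add: abs_le_square_iff[symmetric] assms(2))
  then have "edist d x y \<le> sqrt (d * r\<^sup>2)" unfolding edist_def L2_set_def by simp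
  also have "\<dots> = r * sqrt d" using assms(2) by (simp add: real_sqrt_mult)
  finally show ?thesis .
qed

lemma dist_mono_le:
  assumes "g \<in> L2_cube d" "mono_on (cube d) g"
  shows "0 \<le> dist_mono d f" "dist_mono d f \<le> L2_norm_cube d (\<lambda>x. f x - g x)"
proof -
  let ?D = "{L2_norm_cube d (\<lambda>x. f x - g x) | g. g \<in> L2_cube d \<and> mono_on (cube d) g}"
  have mem: "L2_norm_cube d (\<lambda>x. f x - g x) \<in> ?D" using assms by blast
  have nonneg: "0 \<le> r" if "r \<in> ?D" for r using that by (auto simp: L2_norm_cube_def)
  show "0 \<le> dist_mono d f"
    unfolding dist_mono_def using mem nonneg by (intro cInf_greatest) blast+
  show "dist_mono d f \<le> L2_norm_cube d (\<lambda>x. f x - g x)"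
    unfolding dist_mono_def using mem nonneg by (intro cInf_lower bdd_belowI[of _ 0])
qed

text \<open>The function that is constant on each cell with value \<open>G\<close> is a monotone
  competitor. Within a cell, \<open>f\<close> differs from its value at the sample point by at most
  \<open>M * sqrt d / n\<close>, which gives the last term. The sample points may lie anywhere in
  the closed cells, so that every translate of a coarse grid can serve.\<close>

lemma dist_mono_le_grid:
  assumes f: "lipschitz_cube d M f" and n: "0 < n" and M: "0 \<le> M"
    and G: "\<And>x y. x \<in> grid d n \<Longrightarrow> y \<in> grid d n \<Longrightarrow> (\<And>i. i < d \<Longrightarrow> x i \<le> y i) \<Longrightarrow> G x \<le> G y"
    and p: "\<And>k. k \<in> grid d n \<Longrightarrow> p k \<in> cube d"
      "\<And>k i. k \<in> grid d n \<Longrightarrow> i < d \<Longrightarrow> real (k i) \<le> n * p k i \<and> n * p k i \<le> real (k i) + 1"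
  shows "(dist_mono d f)\<^sup>2 \<le> 2 * (\<Sum>k\<in>grid d n. (f (p k) - G k)\<^sup>2) / real n ^ d + 2 * M\<^sup>2 * d / (real n)\<^sup>2"
proof -
  define g where "g x = G (cell d n x)" for x
  define \<phi> where "\<phi> k = 2 * (f (p k) - G k)\<^sup>2 + 2 * M\<^sup>2 * d / (real n)\<^sup>2" for k
  have "g \<in> L2_cube d"
    using step_function(1)[OF n, of d "\<lambda>k. G k"] step_function(1)[OF n, of d "\<lambda>k. (G k)\<^sup>2"]
    by (auto simp: L2_cube_def g_def[abs_def] dest: borel_measurable_integrable)
  moreover have "cell d n x i \<le> cell d n y i" if "x \<le> y" "i < d" for x y i
    using that by (auto simp: cell_def le_fun_def intro!: cell_index_mono)
  then have "mono_on (cube d) g"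
    unfolding mono_on_def g_def by (auto intro!: G cell_grid n)
  ultimately have dist: "0 \<le> dist_mono d f" "dist_mono d f \<le> L2_norm_cube d (\<lambda>x. f x - g x)"
    by (rule dist_mono_le)+
  have pointwise: "(f x - g x)\<^sup>2 \<le> \<phi> (cell d n x)" if x: "x \<in> cube d" for x
  proof -
    let ?k = "cell d n x"
    have k: "?k \<in> grid d n" by (rule cell_grid[OF n])
    have "\<bar>x i - p ?k i\<bar> \<le> 1 / n" if i: "i < d" for i
    proof -
      have "0 \<le> x i" "x i \<le> 1" using x i by (auto simp: cube_def PiE_iff)
      then have "real (?k i) \<le> n * x i \<and> n * x i \<le> real (?k i) + 1"
        using cell_index_bounds[OF n, of "x i"] i by (simp add: cell_def)
      then have "\<bar>n * x i - n * p ?k i\<bar> \<le> 1" using p(2)[OF k i] by linarith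
      then have "n * \<bar>x i - p ?k i\<bar> \<le> 1" by (simp flip: right_diff_distrib add: abs_mult)
      then show ?thesis using n by (simp add: field_simps)
    qed
    then have "edist d x (p ?k) \<le> 1 / n * sqrt d" by (intro edist_le) auto
    moreover have "\<bar>f x - f (p ?k)\<bar> \<le> M * edist d x (p ?k)"
      using f x p(1)[OF k] by (auto simp: lipschitz_cube_def)
    ultimately have "\<bar>f x - f (p ?k)\<bar> \<le> M * (1 / n * sqrt d)"
      using M by (meson mult_left_mono order_trans)
    then have "(f x - f (p ?k))\<^sup>2 \<le> (M * (1 / n * sqrt d))\<^sup>2"
      using M by (subst abs_le_square_iff[symmetric]) simp
    also have "\<dots> = M\<^sup>2 * d / (real n)\<^sup>2" by (simp add: power_mult_distrib power_divide)
    finally have *: "(f x - f (p ?k))\<^sup>2 \<le> M\<^sup>2 * d / (real n)\<^sup>2" .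
    have "(f x - g x)\<^sup>2 \<le> 2 * (f (p ?k) - G ?k)\<^sup>2 + 2 * (f x - f (p ?k))\<^sup>2"
      using sum_squares_bound[of "f x - f (p ?k)" "f (p ?k) - G ?k"]
      by (simp add: g_def power2_eq_square algebra_simps)
    then show ?thesis using * by (simp add: \<phi>_def)
  qed
  have "(dist_mono d f)\<^sup>2 \<le> (L2_norm_cube d (\<lambda>x. f x - g x))\<^sup>2"
    using dist by (intro power_mono)
  also have "\<dots> = (LINT x|cube_measure d. (f x - g x)\<^sup>2)"
    unfolding L2_norm_cube_def by (intro real_sqrt_pow2 integral_nonneg_AE) auto
  \<comment> \<open>Only the nonnegative step function on the right has to be integrable: without
    integrability the left side would be 0.\<close>
  also have "\<dots> \<le> (LINT x|cube_measure d. \<phi> (cell d n x))"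
    using pointwise by (intro integral_mono' step_function(1) n) (auto simp: space_cube_measure \<phi>_def)
  also have "\<dots> = (\<Sum>k\<in>grid d n. \<phi> k) / real n ^ d" by (rule step_function(2)[OF n])
  also have "\<dots> = 2 * (\<Sum>k\<in>grid d n. (f (p k) - G k)\<^sup>2) / real n ^ d + 2 * M\<^sup>2 * d / (real n)\<^sup>2"
    using n by (simp add: \<phi>_def sum.distrib sum_distrib_left add_divide_distrib)
  finally show ?thesis .
qed

section \<open>Coarse grids inside a fine grid\<close>

definition grid_point :: "nat \<Rightarrow> nat \<Rightarrow> (nat \<Rightarrow> nat) \<Rightarrow> nat \<Rightarrow> real" where
  "grid_point d N x = (\<lambda>i\<in>{..<d}. real (x i) / real N)"

lemma grid_point_cube: "(\<And>i. i < d \<Longrightarrow> x i < N) \<Longrightarrow> grid_point d N x \<in> cube d"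
  by (auto simp: grid_point_def cube_def PiE_iff divide_le_eq_1 intro: less_imp_le)

definition subgrid_point :: "nat \<Rightarrow> nat \<Rightarrow> (nat \<Rightarrow> nat) \<Rightarrow> (nat \<Rightarrow> nat) \<Rightarrow> nat \<Rightarrow> nat" where
  "subgrid_point d H o' k = (\<lambda>i\<in>{..<d}. H * k i + o' i)"

lemma subgrid_less:
  fixes H k l n :: nat
  assumes "k < n" "l < H"
  shows "H * k + l < n * H"
proof -
  have "H * k + l < H * Suc k" using assms by simp
  also have "\<dots> \<le> H * n" using assms by (intro mult_le_mono2) simp
  finally show ?thesis by (simp add: mult.commute)
qed

lemma subgrid_point_grid:
  assumes "o' \<in> grid d H" "k \<in> grid d n"
  shows "subgrid_point d H o' k \<in> grid d (n * H)"
  unfolding subgrid_point_def grid_def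
  using gridD[OF assms(1)] gridD[OF assms(2)] by (intro restrict_PiE_iff[THEN iffD2] ballI) (simp add: subgrid_less)

text \<open>Division by \<open>H\<close> with remainder in every coordinate: the remainders form the
  offset \<open>o'\<close> of a translate, the quotients the position in a coarse grid with
  \<open>n\<close> points per side.\<close>

lemma sum_subgrids:
  fixes \<phi> :: "(nat \<Rightarrow> nat) \<Rightarrow> real"
  assumes "0 < H"
  shows "(\<Sum>o'\<in>grid d H. \<Sum>k\<in>grid d n. \<phi> (subgrid_point d H o' k)) = (\<Sum>x\<in>grid d (n * H). \<phi> x)"
proof -
  have "(\<Sum>o'\<in>grid d H. \<Sum>k\<in>grid d n. \<phi> (subgrid_point d H o' k))
      = (\<Sum>(o', k)\<in>grid d H \<times> grid d n. \<phi> (subgrid_point d H o' k))"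
    by (rule sum.cartesian_product)
  also have "\<dots> = (\<Sum>x\<in>grid d (n * H). \<phi> x)"
  proof (rule sum.reindex_bij_witness[of _ "\<lambda>x. (\<lambda>i\<in>{..<d}. x i mod H, \<lambda>i\<in>{..<d}. x i div H)"
        "\<lambda>(o', k). subgrid_point d H o' k"], goal_cases)
    case (1 a)
    obtain o' k where a: "a = (o', k)" "o' \<in> grid d H" "k \<in> grid d n" using 1 by auto
    have *: "(\<lambda>i\<in>{..<d}. subgrid_point d H o' k i mod H) = o'"
      "(\<lambda>i\<in>{..<d}. subgrid_point d H o' k i div H) = k"
      using a gridD[OF a(2)] assms
      by (intro ext; auto simp: subgrid_point_def grid_def PiE_iff extensional_def restrict_def)+
    show ?case unfolding a(1) by (simp only: * prod.case)
  next
    case (2 a)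
    then show ?case by (auto intro: subgrid_point_grid)
  next
    case (3 x)
    then have "x i = undefined" if "\<not> i < d" for i
      using that by (auto simp: grid_def PiE_iff extensional_def)
    then show ?case by (intro ext) (simp add: subgrid_point_def restrict_def)
  next
    case (4 x)
    then have "x i < n * H" if "i < d" for i using that by (rule gridD)
    then show ?case using assms by (auto simp: grid_def less_mult_imp_div_less)
  qed auto
  finally show ?thesis .
qed

definition slope_energy :: "nat \<Rightarrow> nat \<Rightarrow> nat \<Rightarrow> ((nat \<Rightarrow> real) \<Rightarrow> real) \<Rightarrow> nat \<Rightarrow> (nat \<Rightarrow> nat) \<Rightarrow> real" where
  "slope_energy d N H f i x =
     (if x i + H < N
      then (max 0 (f (grid_point d N x) - f (grid_point d N (x(i := x i + H)))))\<^sup>2 else 0)"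

text \<open>The grid inequality is applied to each of the \<open>H ^ d\<close> translates of the
  coarse grid, and the results are added. The lower bound on \<open>n\<close> keeps the
  discretization error below \<open>\<epsilon>^2 / 2\<close>; halving twice more, for the square of
  a sum and for the constant of the grid inequality, leaves \<open>\<epsilon>^2 / 8\<close>.\<close>

lemma directed_poincare:
  assumes f: "lipschitz_cube d M f" and M: "0 < M" and \<epsilon>: "0 < \<epsilon>" "\<epsilon> \<le> dist_mono d f"
    and n: "0 < n" "4 * real d * M\<^sup>2 \<le> (real n)\<^sup>2 * \<epsilon>\<^sup>2" and H: "0 < H"
  shows "\<epsilon>\<^sup>2 / 8 * real (n * H) ^ d
           \<le> (real n)\<^sup>2 * (\<Sum>x\<in>grid d (n * H). \<Sum>i<d. slope_energy d (n * H) H f i x)"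
proof -
  let ?N = "n * H"
  have coarse: "\<epsilon>\<^sup>2 / 8 * real n ^ d
      \<le> (real n)\<^sup>2 * (\<Sum>k\<in>grid d n. \<Sum>i<d. slope_energy d ?N H f i (subgrid_point d H o' k))"
    if o': "o' \<in> grid d H" for o'
  proof -
    define p where "p k = grid_point d ?N (subgrid_point d H o' k)" for k
    obtain G where G: "\<forall>x\<in>grid d n. \<forall>y\<in>grid d n. (\<forall>i<d. x i \<le> y i) \<longrightarrow> G x \<le> G y"
      and FG: "(\<Sum>x\<in>grid d n. (f (p x) - G x)\<^sup>2)
        \<le> 2 * (real n)\<^sup>2 * (\<Sum>i<d. grid_energy d n (\<lambda>k. f (p k)) i)"
      using grid_directed_poincare[OF n(1), of d "\<lambda>k. f (p k)"] by blast
    have sub: "subgrid_point d H o' k \<in> grid d ?N" if "k \<in> grid d n" for k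
      using that o' by (intro subgrid_point_grid)
    have "\<epsilon>\<^sup>2 \<le> (dist_mono d f)\<^sup>2" using \<epsilon> by (intro power_mono) auto
    also have "\<dots> \<le> 2 * (\<Sum>k\<in>grid d n. (f (p k) - G k)\<^sup>2) / real n ^ d + 2 * M\<^sup>2 * d / (real n)\<^sup>2"
    proof (rule dist_mono_le_grid[OF f n(1)])
      fix k assume k: "k \<in> grid d n"
      show "p k \<in> cube d" unfolding p_def by (intro grid_point_cube gridD[OF sub[OF k]])
      fix i assume i: "i < d"
      have "o' i < H" using o' i by (rule gridD)
      then have "n * p k i = k i + real (o' i) / H"
        using i n H by (simp add: p_def grid_point_def subgrid_point_def field_simps)
      then show "real (k i) \<le> n * p k i \<and> n * p k i \<le> real (k i) + 1"
        using \<open>o' i < H\<close> by (simp add: divide_le_eq_1)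
    qed (use M G in auto)
    also have "2 * M\<^sup>2 * d / (real n)\<^sup>2 \<le> \<epsilon>\<^sup>2 / 2" using n by (simp add: field_simps)
    finally have "\<epsilon>\<^sup>2 \<le> 2 * ((\<Sum>k\<in>grid d n. (f (p k) - G k)\<^sup>2) / real n ^ d) + \<epsilon>\<^sup>2 / 2" by simp
    then have "\<epsilon>\<^sup>2 / 4 \<le> (\<Sum>k\<in>grid d n. (f (p k) - G k)\<^sup>2) / real n ^ d" by linarith
    then have "\<epsilon>\<^sup>2 / 4 * real n ^ d \<le> (\<Sum>k\<in>grid d n. (f (p k) - G k)\<^sup>2)"
      using n by (simp add: field_simps)
    also note FG
    finally have "\<epsilon>\<^sup>2 / 8 * real n ^ d \<le> (real n)\<^sup>2 * (\<Sum>i<d. grid_energy d n (\<lambda>k. f (p k)) i)" by simp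
    also have "(\<Sum>i<d. grid_energy d n (\<lambda>k. f (p k)) i)
        = (\<Sum>i<d. \<Sum>k\<in>grid d n. slope_energy d ?N H f i (subgrid_point d H o' k))"
      unfolding grid_energy_def
    proof (intro sum.cong refl)
      fix i k assume "i \<in> {..<d}" and k: "k \<in> grid d n"
      then have i: "i < d" by simp
      have "subgrid_point d H o' (k(i := Suc (k i)))
          = (subgrid_point d H o' k)(i := subgrid_point d H o' k i + H)"
        using i by (auto simp: subgrid_point_def fun_eq_iff)
      moreover have "subgrid_point d H o' k i + H < ?N \<longleftrightarrow> Suc (k i) < n"
      proof
        assume "Suc (k i) < n"
        then show "subgrid_point d H o' k i + H < ?N"
          using subgrid_less[of "Suc (k i)" n "o' i" H] gridD[OF o' i] i
          by (simp add: subgrid_point_def)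
      next
        assume "subgrid_point d H o' k i + H < ?N"
        then have "H * Suc (k i) < H * n" using i by (simp add: subgrid_point_def mult.commute)
        then show "Suc (k i) < n" by (simp only: mult_less_cancel1)
      qed
      ultimately show "(if Suc (k i) < n then (max 0 (f (p k) - f (p (k(i := Suc (k i))))))\<^sup>2 else 0)
          = slope_energy d ?N H f i (subgrid_point d H o' k)"
        by (simp add: slope_energy_def p_def)
    qed
    also have "\<dots> = (\<Sum>k\<in>grid d n. \<Sum>i<d. slope_energy d ?N H f i (subgrid_point d H o' k))"
      by (rule sum.swap)
    finally show ?thesis .
  qed
  have "\<epsilon>\<^sup>2 / 8 * real (n * H) ^ d = (\<Sum>o'\<in>grid d H. \<epsilon>\<^sup>2 / 8 * real n ^ d)"
    by (simp add: power_mult_distrib)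
  also have "\<dots> \<le> (\<Sum>o'\<in>grid d H. (real n)\<^sup>2 *
      (\<Sum>k\<in>grid d n. \<Sum>i<d. slope_energy d ?N H f i (subgrid_point d H o' k)))"
    by (intro sum_mono coarse)
  also have "\<dots> = (real n)\<^sup>2 * (\<Sum>x\<in>grid d ?N. \<Sum>i<d. slope_energy d ?N H f i x)"
    by (simp only: sum_distrib_left[symmetric]
        sum_subgrids[OF H, where \<phi> = "\<lambda>x. \<Sum>i<d. slope_energy d ?N H f i x"])
  finally show ?thesis .
qed

section \<open>Lipschitz functions at a random scale\<close>

text \<open>Reflection extends a function on the grid to a function of period \<open>2 * N\<close>, so that sums over
  a period are invariant under shifts.\<close>

definition reflect :: "nat \<Rightarrow> nat \<Rightarrow> nat" where
  "reflect N t = (if t mod (2 * N) < N then t mod (2 * N) else 2 * N - 1 - t mod (2 * N))"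

lemma reflect_less:
  assumes "0 < N"
  shows "reflect N t < N"
proof -
  have "t mod (2 * N) < 2 * N" using assms by simp
  then show ?thesis unfolding reflect_def by (split if_split) linarith
qed

lemma reflect_id: "t < N \<Longrightarrow> reflect N t = t"
  by (simp add: reflect_def)

lemma reflect_cong: "s mod (2 * N) = t mod (2 * N) \<Longrightarrow> reflect N s = reflect N t"
  by (simp add: reflect_def)

lemma reflect_Suc: "0 < N \<Longrightarrow> \<bar>real (reflect N (Suc t)) - real (reflect N t)\<bar> \<le> 1"
  by (auto simp: reflect_def mod_Suc of_nat_diff)

lemma reflect_step:
  assumes "0 < N" "v \<in> {0, 1, 2 * N - 1}"
  shows "\<bar>real (reflect N (t + v)) - real (reflect N t)\<bar> \<le> 1"
proof (cases "v = 2 * N - 1")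
  case True
  \<comment> \<open>Up to a full period, \<open>2 * N - 1\<close> is a step back by one.\<close>
  have "Suc (t + v) = t + 2 * N" using True assms by simp
  then have "Suc (t + v) mod (2 * N) = t mod (2 * N)" by (simp only: mod_add_self2)
  then have "reflect N (Suc (t + v)) = reflect N t" by (rule reflect_cong)
  then show ?thesis using reflect_Suc[OF assms(1), of "t + v"] by simp
qed (use assms reflect_Suc[OF assms(1), of t] in auto)

definition periodic :: "nat \<Rightarrow> nat \<Rightarrow> ((nat \<Rightarrow> nat) \<Rightarrow> real) \<Rightarrow> bool" where
  "periodic d L F \<longleftrightarrow> (\<forall>x y. (\<forall>i<d. x i mod L = y i mod L) \<longrightarrow> F x = F y)"

lemma periodicI: "(\<And>x y. (\<And>i. i < d \<Longrightarrow> x i mod L = y i mod L) \<Longrightarrow> F x = F y) \<Longrightarrow> periodic d L F"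
  unfolding periodic_def by blast

lemma periodicD: "periodic d L F \<Longrightarrow> (\<And>i. i < d \<Longrightarrow> x i mod L = y i mod L) \<Longrightarrow> F x = F y"
  by (simp add: periodic_def)

lemma periodic_shift: "periodic d L F \<Longrightarrow> periodic d L (\<lambda>x. F (\<lambda>i. x i + w i))"
  by (rule periodicI, erule periodicD) (rule mod_add_cong, assumption, rule refl)

lemma sum_periodic_shift:
  assumes "periodic d L F" "0 < L"
  shows "(\<Sum>x\<in>grid d L. F (\<lambda>i. x i + w i)) = (\<Sum>x\<in>grid d L. F x)"
proof (rule sum.reindex_bij_witness[of _ "\<lambda>y. \<lambda>i\<in>{..<d}. (y i + (L - w i mod L)) mod L"
      "\<lambda>x. \<lambda>i\<in>{..<d}. (x i + w i) mod L"], goal_cases)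
  have cancel: "((t + (L - u mod L)) mod L + u) mod L = t mod L"
    "((t + u) mod L + (L - u mod L)) mod L = t mod L" for t u
  proof -
    have *: "(s + (L - u mod L) + u) mod L = s mod L" for s
    proof -
      have "(s + (L - u mod L) + u) mod L = (s + (L - u mod L) + u mod L) mod L"
        by (rule mod_add_right_eq[symmetric])
      also have "s + (L - u mod L) + u mod L = s + L"
        using mod_less_divisor[OF assms(2), of u] by linarith
      finally show ?thesis by simp
    qed
    have "((t + (L - u mod L)) mod L + u) mod L = (t + (L - u mod L) + u) mod L"
      by (rule mod_add_left_eq)
    then show "((t + (L - u mod L)) mod L + u) mod L = t mod L" unfolding * .
    have "((t + u) mod L + (L - u mod L)) mod L = (t + u + (L - u mod L)) mod L"
      by (rule mod_add_left_eq)
    also have "t + u + (L - u mod L) = t + (L - u mod L) + u" by simp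
    finally show "((t + u) mod L + (L - u mod L)) mod L = t mod L" unfolding * .
  qed
  {
    case (1 x)
    have *: "(\<lambda>i\<in>{..<d}. ((\<lambda>i\<in>{..<d}. (x i + w i) mod L) i + (L - w i mod L)) mod L) i = x i" for i
    proof (cases "i < d")
      case True
      then show ?thesis
        by (simp only: restrict_apply lessThan_iff if_True cancel(2) mod_less[OF gridD[OF 1]])
    next
      case False
      then show ?thesis using PiE_arb[OF 1[unfolded grid_def], of i] by simp
    qed
    show ?case by (rule ext) (rule *)
  next
    case (2 x)
    then show ?case using assms(2) by (simp add: grid_def)
  next
    case (3 x)
    have *: "(\<lambda>i\<in>{..<d}. ((\<lambda>i\<in>{..<d}. (x i + (L - w i mod L)) mod L) i + w i) mod L) i = x i" for i
    proof (cases "i < d")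
      case True
      then show ?thesis
        by (simp only: restrict_apply lessThan_iff if_True cancel(1) mod_less[OF gridD[OF 3]])
    next
      case False
      then show ?thesis using PiE_arb[OF 3[unfolded grid_def], of i] by simp
    qed
    show ?case by (rule ext) (rule *)
  next
    case (4 x)
    then show ?case using assms(2) by (simp add: grid_def)
  next
    case (5 x)
    then show ?case by (intro periodicD[OF assms(1)]) simp
  }
qed

section \<open>Second differences across dyadic scales\<close>

definition step_energy :: "nat \<Rightarrow> nat \<Rightarrow> ((nat \<Rightarrow> nat) \<Rightarrow> real) \<Rightarrow> (nat \<Rightarrow> nat) \<Rightarrow> real" where
  "step_energy d L F v = (\<Sum>x\<in>grid d L. (F (\<lambda>i. x i + v i) - F x)\<^sup>2)"

definition second_difference :: "((nat \<Rightarrow> nat) \<Rightarrow> real) \<Rightarrow> (nat \<Rightarrow> nat) \<Rightarrow> (nat \<Rightarrow> nat) \<Rightarrow> real" where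
  "second_difference F v x = F (\<lambda>i. x i + 2 * v i) - 2 * F (\<lambda>i. x i + v i) + F x"

lemma periodic_second_difference:
  assumes "periodic d L F"
  shows "periodic d L (second_difference F v)"
proof (rule periodicI)
  fix x y :: "nat \<Rightarrow> nat" assume *: "\<And>i. i < d \<Longrightarrow> x i mod L = y i mod L"
  show "second_difference F v x = second_difference F v y"
    unfolding second_difference_def
    using periodicD[OF assms, of x y, OF *] periodicD[OF periodic_shift[OF assms, of v], of x y, OF *]
      periodicD[OF periodic_shift[OF assms, of "\<lambda>i. 2 * v i"], of x y, OF *] by simp
qed

text \<open>This is the parallelogram law for two consecutive increments, whose sum is the increment
  of the doubled step and whose difference is the second difference. Shift invariance makes the
  energies of the two increments equal.\<close>

lemma sum_second_difference:
  assumes F: "periodic d L F" and L: "0 < L"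
  shows "(\<Sum>x\<in>grid d L. (second_difference F v x)\<^sup>2)
           = 4 * step_energy d L F v - step_energy d L F (\<lambda>i. 2 * v i)"
proof -
  define a where "a x = F (\<lambda>i. x i + v i) - F x" for x
  have per: "periodic d L (\<lambda>x. (a x)\<^sup>2)"
  proof (rule periodicI)
    fix x y :: "nat \<Rightarrow> nat" assume *: "\<And>i. i < d \<Longrightarrow> x i mod L = y i mod L"
    show "(a x)\<^sup>2 = (a y)\<^sup>2"
      unfolding a_def using periodicD[OF F, of x y, OF *] periodicD[OF periodic_shift[OF F, of v], of x y, OF *] by simp
  qed
  have "(\<Sum>x\<in>grid d L. (second_difference F v x)\<^sup>2)
      = (\<Sum>x\<in>grid d L. 2 * (a x)\<^sup>2 + 2 * (a (\<lambda>i. x i + v i))\<^sup>2 - (F (\<lambda>i. x i + 2 * v i) - F x)\<^sup>2)"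
  proof (intro sum.cong refl)
    fix x
    have *: "(p - 2 * q + r)\<^sup>2 = 2 * (q - r)\<^sup>2 + 2 * (p - q)\<^sup>2 - (p - r)\<^sup>2" for p q r :: real
      by (simp add: power2_eq_square algebra_simps)
    have "a (\<lambda>i. x i + v i) = F (\<lambda>i. x i + 2 * v i) - F (\<lambda>i. x i + v i)"
      by (simp add: a_def mult_2 add.assoc)
    then show "(second_difference F v x)\<^sup>2
        = 2 * (a x)\<^sup>2 + 2 * (a (\<lambda>i. x i + v i))\<^sup>2 - (F (\<lambda>i. x i + 2 * v i) - F x)\<^sup>2"
      unfolding second_difference_def * by (simp add: a_def)
  qed
  also have "\<dots> = 2 * (\<Sum>x\<in>grid d L. (a x)\<^sup>2) + 2 * (\<Sum>x\<in>grid d L. (a (\<lambda>i. x i + v i))\<^sup>2)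
      - step_energy d L F (\<lambda>i. 2 * v i)"
    by (simp add: sum.distrib sum_subtractf sum_distrib_left step_energy_def)
  also have "(\<Sum>x\<in>grid d L. (a (\<lambda>i. x i + v i))\<^sup>2) = (\<Sum>x\<in>grid d L. (a x)\<^sup>2)"
    by (rule sum_periodic_shift[OF per L])
  finally show ?thesis by (simp add: step_energy_def a_def)
qed

text \<open>Division by \<open>4 ^ Suc j\<close> makes the preceding identity telescope in
  \<open>j\<close>, so the bound does not depend on the number of scales.\<close>

lemma sum_scales_second_difference:
  assumes "periodic d L F" "0 < L"
  shows "(\<Sum>j<K. (\<Sum>x\<in>grid d L. (second_difference F (\<lambda>i. 2 ^ j * v i) x)\<^sup>2) / 4 ^ Suc j)
           \<le> step_energy d L F v"
proof -
  have "(\<Sum>j<K. (\<Sum>x\<in>grid d L. (second_difference F (\<lambda>i. 2 ^ j * v i) x)\<^sup>2) / 4 ^ Suc j)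
      = step_energy d L F v - step_energy d L F (\<lambda>i. 2 ^ K * v i) / 4 ^ K"
    by (induction K) (simp_all add: sum_second_difference[OF assms] mult.assoc field_simps)
  moreover have "0 \<le> step_energy d L F (\<lambda>i. 2 ^ K * v i)"
    unfolding step_energy_def by (intro sum_nonneg) auto
  ultimately show ?thesis by simp
qed

definition reflected :: "nat \<Rightarrow> nat \<Rightarrow> ((nat \<Rightarrow> real) \<Rightarrow> real) \<Rightarrow> (nat \<Rightarrow> nat) \<Rightarrow> real" where
  "reflected d N f x = f (grid_point d N (\<lambda>i. reflect N (x i)))"

lemma grid_point_cong: "(\<And>i. i < d \<Longrightarrow> x i = y i) \<Longrightarrow> grid_point d N x = grid_point d N y"
  by (auto simp: grid_point_def intro!: restrict_ext)

lemma periodic_reflected: "periodic d (2 * N) (reflected d N f)"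
  unfolding periodic_def reflected_def
  by (auto intro!: arg_cong[where f = f] grid_point_cong reflect_cong)

lemma reflected_eq: "(\<And>i. i < d \<Longrightarrow> x i < N) \<Longrightarrow> reflected d N f x = f (grid_point d N x)"
  unfolding reflected_def by (intro arg_cong[where f = f] grid_point_cong) (simp add: reflect_id)

lemma step_energy_reflected:
  assumes f: "lipschitz_cube d M f" and N: "0 < N" and M: "0 \<le> M"
    and v: "\<And>i. i < d \<Longrightarrow> v i \<in> {0, 1, 2 * N - 1}"
  shows "(real N)\<^sup>2 * step_energy d (2 * N) (reflected d N f) v \<le> real (2 * N) ^ d * (M\<^sup>2 * d)"
proof -
  have "(reflected d N f (\<lambda>i. x i + v i) - reflected d N f x)\<^sup>2 \<le> M\<^sup>2 * d / (real N)\<^sup>2" for x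
  proof -
    let ?p = "grid_point d N (\<lambda>i. reflect N (x i + v i))" and ?q = "grid_point d N (\<lambda>i. reflect N (x i))"
    have "\<bar>?p i - ?q i\<bar> \<le> 1 / N" if "i < d" for i
      using reflect_step[OF N v[OF that], of "x i"] N that
      by (simp add: grid_point_def diff_divide_distrib[symmetric] abs_divide divide_right_mono)
    then have "edist d ?p ?q \<le> 1 / N * sqrt d" by (intro edist_le) auto
    moreover have "\<bar>f ?p - f ?q\<bar> \<le> M * edist d ?p ?q"
      using f N by (auto simp: lipschitz_cube_def intro!: grid_point_cube reflect_less)
    ultimately have "\<bar>f ?p - f ?q\<bar> \<le> M * (1 / N * sqrt d)"
      using M by (meson mult_left_mono order_trans)
    then have "(f ?p - f ?q)\<^sup>2 \<le> (M * (1 / N * sqrt d))\<^sup>2"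
      using M by (subst abs_le_square_iff[symmetric]) simp
    also have "\<dots> = M\<^sup>2 * d / (real N)\<^sup>2" by (simp add: power_mult_distrib power_divide)
    finally show ?thesis by (simp add: reflected_def)
  qed
  then have "step_energy d (2 * N) (reflected d N f) v \<le> (\<Sum>x\<in>grid d (2 * N). M\<^sup>2 * d / (real N)\<^sup>2)"
    unfolding step_energy_def by (intro sum_mono)
  then show ?thesis using N by (simp add: field_simps)
qed

section \<open>Deviation from affinity on sets of coordinates\<close>

definition push :: "nat \<Rightarrow> nat set \<Rightarrow> (nat \<Rightarrow> nat) \<Rightarrow> nat \<Rightarrow> nat" where
  "push H S x i = (if i \<in> S then x i + H else x i)"

definition affinity_defect ::
  "((nat \<Rightarrow> nat) \<Rightarrow> real) \<Rightarrow> nat \<Rightarrow> nat set \<Rightarrow> (nat \<Rightarrow> nat) \<Rightarrow> real" where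
  "affinity_defect F H S x = F (push H S x) - F x - (\<Sum>i\<in>S. F (push H {i} x) - F x)"

text \<open>Both pairs of opposite corners of the parallelogram spanned by \<open>H 1\<^sub>T\<close> and \<open>H e\<^sub>i\<close> have the
  same midpoint, so its mixed difference is a difference of two second differences along its
  diagonals. Modulo \<open>2 * N\<close>, the entry \<open>2 * N - 1\<close> plays the role of \<open>-1\<close>.\<close>

lemma mixed_difference:
  assumes F: "periodic d (2 * N) F" and N: "0 < N" and i: "i \<notin> T"
  shows "F (push (2 * h) (insert i T) x) - F (push (2 * h) T x) - F (push (2 * h) {i} x) + F x
    = second_difference F (\<lambda>k. h * of_bool (k \<in> insert i T)) x
      - second_difference F (\<lambda>k. h * (if k = i then 2 * N - 1 else of_bool (k \<in> T))) (push (2 * h) {i} x)"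
proof -
  let ?w = "\<lambda>k. h * (if k = i then 2 * N - 1 else of_bool (k \<in> T))" and ?y = "push (2 * h) {i} x"
  have "F (\<lambda>k. x k + 2 * (h * of_bool (k \<in> insert i T))) = F (push (2 * h) (insert i T) x)"
    by (intro arg_cong[where f = F]) (auto simp: push_def)
  moreover have "F (\<lambda>k. ?y k + 2 * ?w k) = F (push (2 * h) T x)"
  proof (rule periodicD[OF F])
    fix k
    have "2 * h + 2 * (h * (2 * N - 1)) = (2 * h) * (2 * N)"
      using N by (cases N) (auto simp: algebra_simps)
    then have "(x i + 2 * h + 2 * (h * (2 * N - 1))) mod (2 * N) = x i mod (2 * N)"
      by (metis add.assoc mod_mult_self1)
    then show "(?y k + 2 * ?w k) mod (2 * N) = push (2 * h) T x k mod (2 * N)"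
      using i by (simp add: push_def)
  qed
  moreover have "F (\<lambda>k. ?y k + ?w k) = F (\<lambda>k. x k + h * of_bool (k \<in> insert i T))"
  proof (rule periodicD[OF F])
    fix k
    have "2 * h + h * (2 * N - 1) = h + h * (2 * N)"
      using N by (cases N) (auto simp: algebra_simps)
    then have "(x i + 2 * h + h * (2 * N - 1)) mod (2 * N) = (x i + h) mod (2 * N)"
      by (metis add.assoc mod_mult_self1)
    then show "(?y k + ?w k) mod (2 * N) = (x k + h * of_bool (k \<in> insert i T)) mod (2 * N)"
      using i by (simp add: push_def)
  qed
  ultimately show ?thesis by (simp add: second_difference_def)
qed

text \<open>One quantity that controls the defects of all sets of coordinates at \<open>x\<close>
  simultaneously: it collects every second difference that can occur in
  \<open>mixed_difference\<close>. The exponential number of terms only increases the number of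
  scales needed later.\<close>

definition roughness :: "nat \<Rightarrow> nat \<Rightarrow> ((nat \<Rightarrow> nat) \<Rightarrow> real) \<Rightarrow> nat \<Rightarrow> (nat \<Rightarrow> nat) \<Rightarrow> real" where
  "roughness d N F h x = (\<Sum>T\<in>Pow {..<d}. \<Sum>i<d.
      (second_difference F (\<lambda>k. h * of_bool (k \<in> insert i T)) x)\<^sup>2
      + (second_difference F (\<lambda>k. h * (if k = i then 2 * N - 1 else of_bool (k \<in> T)))
          (push (2 * h) {i} x))\<^sup>2)"

text \<open>Adding a coordinate to the set changes the defect by one mixed difference, that is, by
  two second differences of size at most \<open>t\<close> each.\<close>

lemma affinity_defect_le:
  assumes F: "periodic d (2 * N) F" and N: "0 < N" and t: "0 \<le> t" "roughness d N F h x \<le> t\<^sup>2"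
    and S: "S \<subseteq> {..<d}"
  shows "\<bar>affinity_defect F (2 * h) S x\<bar> \<le> 2 * t * card S"
proof -
  have "finite S" using S by (rule finite_subset) simp
  then show ?thesis using S
  proof (induction S)
    case empty
    have "push (2 * h) {} x = x" by (auto simp: push_def)
    then show ?case by (simp add: affinity_defect_def)
  next
    case (insert i T)
    let ?A = "second_difference F (\<lambda>k. h * of_bool (k \<in> insert i T)) x"
    let ?B = "second_difference F (\<lambda>k. h * (if k = i then 2 * N - 1 else of_bool (k \<in> T)))
          (push (2 * h) {i} x)"
    have "?A\<^sup>2 + ?B\<^sup>2 \<le> (\<Sum>i<d. (second_difference F (\<lambda>k. h * of_bool (k \<in> insert i T)) x)\<^sup>2
        + (second_difference F (\<lambda>k. h * (if k = i then 2 * N - 1 else of_bool (k \<in> T)))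
          (push (2 * h) {i} x))\<^sup>2)"
      using insert.prems by (intro member_le_sum[of i "{..<d}"]) auto
    also have "\<dots> \<le> roughness d N F h x"
      unfolding roughness_def using insert.prems
      by (intro member_le_sum[of T "Pow {..<d}"] sum_nonneg) auto
    finally have *: "?A\<^sup>2 + ?B\<^sup>2 \<le> t\<^sup>2" using t by simp
    have "?A\<^sup>2 \<le> t\<^sup>2" "?B\<^sup>2 \<le> t\<^sup>2"
      using * zero_le_power2[of ?A] zero_le_power2[of ?B] by linarith+
    then have "\<bar>?A\<bar> \<le> t" "\<bar>?B\<bar> \<le> t" using t by (simp_all add: abs_le_square_iff[symmetric])
    moreover have "affinity_defect F (2 * h) (insert i T) x = affinity_defect F (2 * h) T x + (?A - ?B)"
      using mixed_difference[OF F N insert.hyps(2), of h x] insert.hyps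
      by (simp add: affinity_defect_def)
    moreover have "\<bar>affinity_defect F (2 * h) T x\<bar> \<le> 2 * t * card T" using insert by simp
    ultimately have "\<bar>affinity_defect F (2 * h) (insert i T) x\<bar> \<le> 2 * t * card T + 2 * t" by linarith
    then show ?case using insert.hyps by (simp add: algebra_simps)
  qed
qed

text \<open>For a fixed direction \<open>v\<close>, the weighted second differences at all scales
  add up to at most the energy at the finest scale. There are \<open>2 ^ d * d * 2\<close> such
  families, half of them based at a pushed point, which a shift undoes.\<close>

lemma sum_roughness:
  assumes f: "lipschitz_cube d M f" and N: "0 < N" and M: "0 \<le> M"
  shows "(\<Sum>j<K. \<Sum>x\<in>grid d (2 * N). (real N / 2 ^ Suc j)\<^sup>2 * roughness d N (reflected d N f) (2 ^ j) x)
    \<le> 2 ^ d * real d * 2 * (real (2 * N) ^ d * (M\<^sup>2 * d))"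
proof -
  let ?F = "reflected d N f" and ?D = second_difference
  let ?u = "\<lambda>T i k. of_bool (k \<in> insert i T)" and ?w = "\<lambda>T i k. if k = i then 2 * N - 1 else of_bool (k \<in> T)"
  have per: "periodic d (2 * N) ?F" and L: "0 < 2 * N" using N by (simp_all add: periodic_reflected)
  have scales: "(\<Sum>j<K. \<Sum>x\<in>grid d (2 * N). (real N / 2 ^ Suc j)\<^sup>2 * (?D ?F (\<lambda>k. 2 ^ j * v k) x)\<^sup>2)
      \<le> real (2 * N) ^ d * (M\<^sup>2 * d)" if v: "\<And>i. i < d \<Longrightarrow> v i \<in> {0, 1, 2 * N - 1}" for v
  proof -
    have "(\<Sum>j<K. \<Sum>x\<in>grid d (2 * N). (real N / 2 ^ Suc j)\<^sup>2 * (?D ?F (\<lambda>k. 2 ^ j * v k) x)\<^sup>2)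
        = (real N)\<^sup>2 * (\<Sum>j<K. (\<Sum>x\<in>grid d (2 * N). (?D ?F (\<lambda>k. 2 ^ j * v k) x)\<^sup>2) / 4 ^ Suc j)"
    proof -
      have four: "(2 ^ Suc j)\<^sup>2 = (4 ^ Suc j :: real)" for j
        by (simp only: power_mult[symmetric] mult.commute[of "Suc j"]) (simp only: power_mult, simp)
      show ?thesis
        unfolding power_divide four sum_distrib_left sum_divide_distrib by (simp add: mult_ac)
    qed
    also have "\<dots> \<le> (real N)\<^sup>2 * step_energy d (2 * N) ?F v"
      by (intro mult_left_mono sum_scales_second_difference per L) auto
    also have "\<dots> \<le> real (2 * N) ^ d * (M\<^sup>2 * d)" by (rule step_energy_reflected[OF f N M v])
    finally show ?thesis .
  qed
  have shift: "(\<Sum>x\<in>grid d (2 * N). (?D ?F v (push H {i} x))\<^sup>2) = (\<Sum>x\<in>grid d (2 * N). (?D ?F v x)\<^sup>2)" for v H i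
  proof -
    have "push H {i} x = (\<lambda>k. x k + H * of_bool (k = i))" for x by (auto simp: push_def)
    moreover have "periodic d (2 * N) (\<lambda>x. (?D ?F v x)\<^sup>2)"
    proof (rule periodicI)
      fix x y :: "nat \<Rightarrow> nat" assume *: "\<And>i. i < d \<Longrightarrow> x i mod (2 * N) = y i mod (2 * N)"
      show "(?D ?F v x)\<^sup>2 = (?D ?F v y)\<^sup>2"
        using periodicD[OF periodic_second_difference[OF per, of v], of x y, OF *] by simp
    qed
    then have "(\<Sum>x\<in>grid d (2 * N). (?D ?F v (\<lambda>k. x k + H * of_bool (k = i)))\<^sup>2)
        = (\<Sum>x\<in>grid d (2 * N). (?D ?F v x)\<^sup>2)"
      by (rule sum_periodic_shift[OF _ L])
    ultimately show ?thesis by simp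
  qed
  have "(\<Sum>j<K. \<Sum>x\<in>grid d (2 * N). (real N / 2 ^ Suc j)\<^sup>2 * roughness d N ?F (2 ^ j) x)
    = (\<Sum>j<K. \<Sum>x\<in>grid d (2 * N). \<Sum>T\<in>Pow {..<d}. \<Sum>i<d.
        (real N / 2 ^ Suc j)\<^sup>2 * (?D ?F (\<lambda>k. 2 ^ j * ?u T i k) x)\<^sup>2
        + (real N / 2 ^ Suc j)\<^sup>2 * (?D ?F (\<lambda>k. 2 ^ j * ?w T i k) (push (2 * 2 ^ j) {i} x))\<^sup>2)"
    unfolding roughness_def sum_distrib_left distrib_left ..
  also have "\<dots> = (\<Sum>T\<in>Pow {..<d}. \<Sum>i<d. \<Sum>j<K. \<Sum>x\<in>grid d (2 * N).
        (real N / 2 ^ Suc j)\<^sup>2 * (?D ?F (\<lambda>k. 2 ^ j * ?u T i k) x)\<^sup>2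
        + (real N / 2 ^ Suc j)\<^sup>2 * (?D ?F (\<lambda>k. 2 ^ j * ?w T i k) (push (2 * 2 ^ j) {i} x))\<^sup>2)"
    by (simp only: sum.swap[of _ "Pow {..<d}"] sum.swap[of _ "{..<d}" "{..<K}"] sum.swap[of _ "{..<d}" "grid d (2 * N)"])
  also have "\<dots> \<le> (\<Sum>T\<in>Pow {..<d}. \<Sum>i<d. real (2 * N) ^ d * (M\<^sup>2 * d) + real (2 * N) ^ d * (M\<^sup>2 * d))"
  proof (intro sum_mono)
    fix T i assume "T \<in> Pow {..<d}" "i \<in> {..<d}"
    have "(\<Sum>j<K. \<Sum>x\<in>grid d (2 * N).
        (real N / 2 ^ Suc j)\<^sup>2 * (?D ?F (\<lambda>k. 2 ^ j * ?u T i k) x)\<^sup>2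
        + (real N / 2 ^ Suc j)\<^sup>2 * (?D ?F (\<lambda>k. 2 ^ j * ?w T i k) (push (2 * 2 ^ j) {i} x))\<^sup>2)
      = (\<Sum>j<K. \<Sum>x\<in>grid d (2 * N). (real N / 2 ^ Suc j)\<^sup>2 * (?D ?F (\<lambda>k. 2 ^ j * ?u T i k) x)\<^sup>2)
       + (\<Sum>j<K. \<Sum>x\<in>grid d (2 * N). (real N / 2 ^ Suc j)\<^sup>2 * (?D ?F (\<lambda>k. 2 ^ j * ?w T i k) x)\<^sup>2)"
      by (simp only: sum.distrib sum_distrib_left[symmetric] shift)
    also have "\<dots> \<le> real (2 * N) ^ d * (M\<^sup>2 * d) + real (2 * N) ^ d * (M\<^sup>2 * d)"
      by (intro add_mono scales) auto
    finally show "(\<Sum>j<K. \<Sum>x\<in>grid d (2 * N).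
        (real N / 2 ^ Suc j)\<^sup>2 * (?D ?F (\<lambda>k. 2 ^ j * ?u T i k) x)\<^sup>2
        + (real N / 2 ^ Suc j)\<^sup>2 * (?D ?F (\<lambda>k. 2 ^ j * ?w T i k) (push (2 * 2 ^ j) {i} x))\<^sup>2)
      \<le> real (2 * N) ^ d * (M\<^sup>2 * d) + real (2 * N) ^ d * (M\<^sup>2 * d)" .
  qed
  also have "\<dots> = 2 ^ d * real d * 2 * (real (2 * N) ^ d * (M\<^sup>2 * d))" by (simp add: card_Pow)
  finally show ?thesis .
qed

definition nearly_affine ::
  "nat \<Rightarrow> nat \<Rightarrow> ((nat \<Rightarrow> real) \<Rightarrow> real) \<Rightarrow> real \<Rightarrow> nat \<Rightarrow> (nat \<Rightarrow> nat) \<Rightarrow> bool" where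
  "nearly_affine d N f \<tau> H x \<longleftrightarrow> (\<forall>S\<subseteq>{..<d}.
     \<bar>real N / real H * affinity_defect (\<lambda>x. f (grid_point d N x)) H S x\<bar> \<le> \<tau>)"

text \<open>At such points no push by \<open>H\<close> meets the reflection, so the periodic
  extension agrees with \<open>f\<close> there.\<close>

definition admits_step :: "nat \<Rightarrow> nat \<Rightarrow> nat \<Rightarrow> (nat \<Rightarrow> nat) \<Rightarrow> bool" where
  "admits_step d N H x \<longleftrightarrow> (\<forall>i<d. x i + H < N)"

lemma nearly_affineI:
  assumes N: "0 < N" and t: "0 \<le> t" "(real N / 2 ^ Suc j)\<^sup>2 * roughness d N (reflected d N f) (2 ^ j) x \<le> t\<^sup>2"
    and x: "admits_step d N (2 ^ Suc j) x"
  shows "nearly_affine d N f (2 * t * d) (2 ^ Suc j) x"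
  unfolding nearly_affine_def
proof (intro allI impI)
  fix S assume S: "S \<subseteq> {..<d}"
  let ?F = "reflected d N f" and ?c = "real N / 2 ^ Suc j"
  have c: "0 < ?c" using N by simp
  have "roughness d N ?F (2 ^ j) x \<le> (t / ?c)\<^sup>2"
  proof -
    have "R \<le> (t / c)\<^sup>2" if "0 < c" "c\<^sup>2 * R \<le> t\<^sup>2" for c R :: real
      using that by (simp add: power_divide field_simps)
    from this[OF c t(2)] show ?thesis .
  qed
  then have "\<bar>affinity_defect ?F (2 * 2 ^ j) S x\<bar> \<le> 2 * (t / ?c) * card S"
    using t(1) c by (intro affinity_defect_le[OF periodic_reflected N _ _ S]) auto
  also have "\<dots> \<le> 2 * (t / ?c) * d"
    using card_mono[OF _ S] t(1) c by (intro mult_left_mono) auto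
  finally have "?c * \<bar>affinity_defect ?F (2 ^ Suc j) S x\<bar> \<le> 2 * t * d"
    using c by (simp add: field_simps)
  moreover have "?F (push (2 ^ Suc j) T x) = f (grid_point d N (push (2 ^ Suc j) T x))" for T
    using x by (intro reflected_eq) (auto simp: admits_step_def push_def intro: add_lessD1)
  moreover have "?F x = f (grid_point d N x)"
    using x by (intro reflected_eq) (auto simp: admits_step_def intro: add_lessD1)
  ultimately show "\<bar>real N / real (2 ^ Suc j) * affinity_defect (\<lambda>x. f (grid_point d N x)) (2 ^ Suc j) S x\<bar> \<le> 2 * t * d"
    using c by (simp add: affinity_defect_def abs_mult)
qed

text \<open>The total roughness over all scales is bounded independently of \<open>K\<close>, so its
  average over the scales is small for large \<open>K\<close>. The bound must be uniform in
  \<open>N\<close>, because the grid is chosen only after \<open>K\<close> and has to be divisible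
  by all the steps.\<close>

theorem nearly_affine_at_random_scale:
  assumes \<tau>: "0 < \<tau>" and \<eta>: "0 < \<eta>" and M: "0 \<le> M"
  shows "\<exists>K>0. \<forall>N>0. \<forall>f. lipschitz_cube d M f \<longrightarrow>
    (\<Sum>j<K. real (card {x \<in> grid d N. admits_step d N (2 ^ Suc j) x \<and> \<not> nearly_affine d N f \<tau> (2 ^ Suc j) x}))
      \<le> \<eta> * K * real N ^ d"
proof -
  \<comment> \<open>Up to \<open>d\<close> coordinates, each with an error of \<open>2 * t\<close>,
    must stay within \<open>\<tau>\<close>; \<open>d + 1\<close> avoids a division by 0.\<close>
  define t where "t = \<tau> / (2 * (d + 1))"
  have t: "0 < t" "2 * t * d \<le> \<tau>" using \<tau> by (simp_all add: t_def field_simps)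
  \<comment> \<open>The first factor \<open>2 ^ d\<close> counts sets of coordinates, the second one
    is the ratio of the sizes of the reflected and the original grid.\<close>
  define C where "C = 2 ^ d * real d * 2 * (2 ^ d * (M\<^sup>2 * d)) / t\<^sup>2"
  obtain K :: nat where K: "C / \<eta> < K" using reals_Archimedean2 by blast
  have "0 \<le> C / \<eta>" using \<eta> by (simp add: C_def)
  with K have "0 < K" by (cases K) auto
  moreover have "(\<Sum>j<K. real (card {x \<in> grid d N. admits_step d N (2 ^ Suc j) x \<and> \<not> nearly_affine d N f \<tau> (2 ^ Suc j) x}))
      \<le> \<eta> * K * real N ^ d" if N: "0 < N" and f: "lipschitz_cube d M f" for N f
  proof -
    let ?R = "\<lambda>j x. (real N / 2 ^ Suc j)\<^sup>2 * roughness d N (reflected d N f) (2 ^ j) x"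
    have nonneg: "0 \<le> ?R j x" for j x
      unfolding roughness_def by (intro mult_nonneg_nonneg sum_nonneg add_nonneg_nonneg) auto
    have "real (card {x \<in> grid d N. admits_step d N (2 ^ Suc j) x \<and> \<not> nearly_affine d N f \<tau> (2 ^ Suc j) x})
        \<le> (\<Sum>x\<in>grid d (2 * N). ?R j x / t\<^sup>2)" for j
    proof -
      let ?B = "{x \<in> grid d N. admits_step d N (2 ^ Suc j) x \<and> \<not> nearly_affine d N f \<tau> (2 ^ Suc j) x}"
      \<comment> \<open>Markov's inequality: a bad point contributes at least 1 to the normalized
        roughness.\<close>
      have "1 \<le> ?R j x / t\<^sup>2" if "x \<in> ?B" for x
      proof -
        have "\<not> nearly_affine d N f (2 * t * d) (2 ^ Suc j) x"
          using that t(2) unfolding nearly_affine_def by (auto intro: order_trans)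
        then have "t\<^sup>2 < ?R j x"
          using nearly_affineI[OF N, of t j d f x] that t(1) by (intro not_le_imp_less notI) simp
        then show ?thesis using t(1) by simp
      qed
      then have "real (card ?B) \<le> (\<Sum>x\<in>?B. ?R j x / t\<^sup>2)"
        using sum_mono[of ?B "\<lambda>_. 1" "\<lambda>x. ?R j x / t\<^sup>2"] by simp
      also have "\<dots> \<le> (\<Sum>x\<in>grid d (2 * N). ?R j x / t\<^sup>2)"
      proof (rule sum_mono2)
        show "?B \<subseteq> grid d (2 * N)" by (force simp: grid_def PiE_iff)
      qed (use nonneg t in auto)
      finally show ?thesis .
    qed
    then have "(\<Sum>j<K. real (card {x \<in> grid d N. admits_step d N (2 ^ Suc j) x \<and> \<not> nearly_affine d N f \<tau> (2 ^ Suc j) x}))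
        \<le> (\<Sum>j<K. \<Sum>x\<in>grid d (2 * N). ?R j x / t\<^sup>2)" by (intro sum_mono)
    also have "\<dots> = (\<Sum>j<K. \<Sum>x\<in>grid d (2 * N). ?R j x) / t\<^sup>2" by (simp only: sum_divide_distrib)
    also have "\<dots> \<le> 2 ^ d * real d * 2 * (real (2 * N) ^ d * (M\<^sup>2 * d)) / t\<^sup>2"
      using sum_roughness[OF f N M, of K] by (intro divide_right_mono zero_le_power2)
    also have "\<dots> = C * real N ^ d" by (simp add: C_def power_mult_distrib)
    also have "\<dots> \<le> \<eta> * K * real N ^ d"
      using K \<eta> by (intro mult_right_mono) (auto simp: field_simps)
    finally show ?thesis .
  qed
  ultimately show ?thesis by blast
qed

section \<open>Detecting a violation with a random set of coordinates\<close>

definition random_subset :: "nat \<Rightarrow> real \<Rightarrow> nat set pmf" where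
  "random_subset d r = map_pmf (\<lambda>c. {i. i < d \<and> c i}) (Pi_pmf {..<d} False (\<lambda>_. bernoulli_pmf r))"

lemma finite_random_subset: "finite (set_pmf (random_subset d r))"
  by (rule finite_subset[of _ "Pow {..<d}"]) (auto simp: random_subset_def)

lemma random_subset_subset: "S \<in> set_pmf (random_subset d r) \<Longrightarrow> S \<subseteq> {..<d}"
  by (auto simp: random_subset_def)

lemma prob_random_subset:
  assumes "0 \<le> r" "r \<le> 1" "J \<subseteq> {..<d}"
  shows "measure_pmf.prob (random_subset d r) {S. J \<subseteq> S} = r ^ card J"
proof -
  let ?P = "Pi_pmf {..<d} False (\<lambda>_. bernoulli_pmf r)"
  let ?B = "\<lambda>i. if i \<in> J then {True} else UNIV"
  have "measure_pmf.prob (random_subset d r) {S. J \<subseteq> S} = measure_pmf.prob ?P (Pi {..<d} ?B)"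
    unfolding random_subset_def measure_map_pmf
    using assms(3) by (intro arg_cong[where f = "measure_pmf.prob ?P"]) (auto simp: Pi_def)
  also have "\<dots> = (\<Prod>i<d. measure_pmf.prob (bernoulli_pmf r) (?B i))"
    by (rule measure_Pi_pmf_Pi) simp
  also have "\<dots> = (\<Prod>i<d. if i \<in> J then r else 1)"
    using assms(1,2) by (intro prod.cong) (auto simp: measure_pmf_single)
  also have "\<dots> = r ^ card J" using assms(3) by (simp add: prod.If_cases Int_absorb1)
  finally show ?thesis .
qed

text \<open>A second moment bound: if \<open>z\<close> elements of \<open>Q\<close> are hit and the hit weight is \<open>w\<close>, then
  \<open>z * (2 - z - w / t)\<close> is at most 1, and is positive only if \<open>z > 0\<close> and \<open>w < t\<close>.\<close>

lemma hit_probability: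
  fixes r t :: real and p :: "nat \<Rightarrow> real"
  assumes r: "0 \<le> r" "r \<le> 1" and Q: "Q \<subseteq> {..<d}" and t: "0 < t"
    and p: "\<And>k. 0 \<le> p k" "\<And>k. k \<in> Q \<Longrightarrow> p k = 0"
    and rQ: "r * card Q \<le> 1 / 4" and rp: "r * (\<Sum>k<d. p k) \<le> t / 4"
  shows "card Q * r / 2
    \<le> measure_pmf.prob (random_subset d r) {S. S \<inter> Q \<noteq> {} \<and> (\<Sum>k<d. p k * of_bool (k \<in> S)) < t}"
proof -
  let ?M = "random_subset d r"
  let ?E = "{S. S \<inter> Q \<noteq> {} \<and> (\<Sum>k<d. p k * of_bool (k \<in> S)) < t}"
  \<comment> \<open>The diagonal \<open>X i i\<close> is the indicator of a single coordinate, so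
    first and second moments are treated together.\<close>
  define X :: "nat \<Rightarrow> nat \<Rightarrow> nat set \<Rightarrow> real" where "X i k = indicator {S. {i, k} \<subseteq> S}" for i k
  have fin: "finite Q" using Q by (rule finite_subset) simp
  have int: "integrable (measure_pmf ?M) h" for h :: "nat set \<Rightarrow> real"
    by (intro integrable_measure_pmf_finite finite_random_subset)
  have EX: "measure_pmf.expectation ?M (X i k) = r ^ card {i, k}" if "i < d" "k < d" for i k
  proof -
    have "{i, k} \<subseteq> {..<d}" using that by simp
    then show ?thesis
      unfolding X_def using prob_random_subset[OF r, of "{i, k}" d] by (simp del: insert_subset)
  qed
  define W where "W S = 2 * (\<Sum>i\<in>Q. X i i S) - (\<Sum>i\<in>Q. \<Sum>k\<in>Q. X i k S)
      - (\<Sum>i\<in>Q. \<Sum>k<d. p k * X i k S) / t" for S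
  have W_le: "W S \<le> indicator ?E S" for S
  proof -
    define z where "z = card (Q \<inter> S)"
    define w where "w = (\<Sum>k<d. p k * of_bool (k \<in> S))"
    have X_mult: "X i k S = of_bool (i \<in> S) * of_bool (k \<in> S)" for i k
      by (simp add: X_def indicator_def)
    have z: "(\<Sum>i\<in>Q. of_bool (i \<in> S)) = real z"
      using fin by (simp add: z_def of_bool_def sum.If_cases)
    have W: "W S = 2 * real z - real z * z - z * w / t"
    proof -
      have "(\<Sum>i\<in>Q. \<Sum>k\<in>Q. X i k S) = real z * z"
        unfolding X_mult by (simp add: sum_product[symmetric] z)
      moreover have "(\<Sum>i\<in>Q. \<Sum>k<d. p k * X i k S) = z * w"
        unfolding X_mult w_def z[symmetric] sum_product by (simp add: mult_ac)
      moreover have "(\<Sum>i\<in>Q. X i i S) = z"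
        unfolding X_mult z[symmetric] by (intro sum.cong) auto
      ultimately show ?thesis by (simp add: W_def)
    qed
    have w: "0 \<le> w" unfolding w_def using p by (intro sum_nonneg) auto
    have z1: "2 * real z - real z * z \<le> 1"
      using zero_le_power2[of "real z - 1"] by (simp add: power2_eq_square algebra_simps)
    have z2: "2 * real z - real z * z \<le> z" by (cases z) (auto simp: algebra_simps)
    have zw: "z \<le> z * w / t" if "t \<le> w"
      using mult_left_mono[OF that, of "real z"] t by (simp add: field_simps)
    have zw0: "0 \<le> z * w / t" using t w by simp
    have "W S \<le> 1" using W z1 zw0 by linarith
    moreover have "W S \<le> 0" if "t \<le> w" using W z2 zw[OF that] by linarith
    moreover have "W S \<le> 0" if "z = 0" using W that by simp
    moreover have "S \<in> ?E \<longleftrightarrow> z \<noteq> 0 \<and> w < t"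
      using fin by (auto simp: z_def w_def Int_commute)
    ultimately show ?thesis by (cases "S \<in> ?E") (auto simp: not_less simp del: mem_Collect_eq)
  qed
  have "card Q * r / 2 \<le> card Q * r * (1 - r * card Q - r * (\<Sum>k<d. p k) / t)"
  proof -
    have "r * (\<Sum>k<d. p k) / t \<le> 1 / 4" using rp t by (simp add: field_simps)
    then have "1 / 2 \<le> 1 - r * card Q - r * (\<Sum>k<d. p k) / t" using rQ by linarith
    then have "card Q * r * (1 / 2) \<le> card Q * r * (1 - r * card Q - r * (\<Sum>k<d. p k) / t)"
      using r by (intro mult_left_mono) auto
    then show ?thesis by simp
  qed
  also have "\<dots> = 2 * (card Q * r) - (card Q * r + card Q * card Q * r\<^sup>2)
      - card Q * (\<Sum>k<d. p k * r\<^sup>2) / t"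
    unfolding sum_distrib_right[symmetric] using t by (simp add: field_simps power2_eq_square)
  also have "\<dots> \<le> 2 * (\<Sum>i\<in>Q. r ^ card {i, i}) - (\<Sum>i\<in>Q. \<Sum>k\<in>Q. r ^ card {i, k})
      - (\<Sum>i\<in>Q. \<Sum>k<d. p k * r ^ card {i, k}) / t"
  proof -
    have "(\<Sum>i\<in>Q. \<Sum>k\<in>Q. r ^ card {i, k}) \<le> (\<Sum>i\<in>Q. \<Sum>k\<in>Q. of_bool (i = k) * r + r\<^sup>2)"
      using r by (intro sum_mono) (auto simp: card_insert_if power2_eq_square)
    also have "\<dots> = card Q * r + card Q * card Q * r\<^sup>2"
      using fin by (simp add: sum.distrib of_bool_def if_distrib[where f = "\<lambda>x. x * r"] distrib_left mult.assoc cong: if_cong)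
    finally have "(\<Sum>i\<in>Q. \<Sum>k\<in>Q. r ^ card {i, k}) \<le> card Q * r + card Q * card Q * r\<^sup>2" .
    \<comment> \<open>The weight vanishes on \<open>Q\<close>, so only pairs of distinct coordinates
      remain, each drawn with probability \<open>r\<^sup>2\<close>.\<close>
    moreover have "(\<Sum>i\<in>Q. \<Sum>k<d. p k * r ^ card {i, k}) = (\<Sum>i\<in>Q. \<Sum>k<d. p k * r\<^sup>2)"
      using p(2) by (intro sum.cong refl) (auto simp: card_insert_if power2_eq_square)
    ultimately show ?thesis by (simp add: mult_ac)
  qed
  also have "\<dots> = 2 * (\<Sum>i\<in>Q. measure_pmf.expectation ?M (X i i))
      - (\<Sum>i\<in>Q. \<Sum>k\<in>Q. measure_pmf.expectation ?M (X i k))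
      - (\<Sum>i\<in>Q. \<Sum>k<d. p k * measure_pmf.expectation ?M (X i k)) / t"
    using Q by (intro arg_cong2[where f = "(-)"] arg_cong2[where f = "(*)"] arg_cong2[where f = "(/)"] sum.cong refl)
      (subst EX; force)+
  also have "\<dots> = measure_pmf.expectation ?M W"
    unfolding W_def by (simp add: int)
  also have "\<dots> \<le> measure_pmf.expectation ?M (indicator ?E)"
    by (intro integral_mono int W_le)
  also have "\<dots> = measure_pmf.prob ?M ?E" by simp
  finally show ?thesis .
qed

section \<open>Slopes at a nearly affine point\<close>

lemma push_lipschitz:
  assumes f: "lipschitz_cube d M f" and N: "0 < N" and x: "admits_step d N H x" and S: "S \<subseteq> {..<d}"
  shows "\<bar>f (grid_point d N (push H S x)) - f (grid_point d N x)\<bar> \<le> M * (real H / real N * sqrt (card S))"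
proof -
  let ?p = "grid_point d N (push H S x)" and ?q = "grid_point d N x"
  have "?p \<in> cube d" "?q \<in> cube d"
    using x by (auto intro!: grid_point_cube simp: admits_step_def push_def intro: add_lessD1)
  then have "\<bar>f ?p - f ?q\<bar> \<le> M * edist d ?p ?q" using f by (simp add: lipschitz_cube_def)
  also have "(\<Sum>i<d. (?p i - ?q i)\<^sup>2) = (\<Sum>i<d. if i \<in> S then (real H / real N)\<^sup>2 else 0)"
    using N by (intro sum.cong) (auto simp: grid_point_def push_def field_simps)
  then have "edist d ?p ?q = real H / real N * sqrt (card S)"
    using S by (simp add: edist_def L2_set_def sum.If_cases Int_absorb1 real_sqrt_mult)
  finally show ?thesis .
qed

definition slope :: "nat \<Rightarrow> nat \<Rightarrow> ((nat \<Rightarrow> real) \<Rightarrow> real) \<Rightarrow> nat \<Rightarrow> (nat \<Rightarrow> nat) \<Rightarrow> nat \<Rightarrow> real" where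
  "slope d N f H x i = real N / real H * (f (grid_point d N (push H {i} x)) - f (grid_point d N x))"

lemma abs_slope_le:
  assumes "lipschitz_cube d M f" "0 < N" "0 < H" "admits_step d N H x" "i < d"
  shows "\<bar>slope d N f H x i\<bar> \<le> M"
proof -
  have "real N / real H * \<bar>f (grid_point d N (push H {i} x)) - f (grid_point d N x)\<bar> \<le> M"
    using push_lipschitz[OF assms(1,2,4), of "{i}"] assms(2,3,5) by (simp add: field_simps)
  then show ?thesis by (simp add: slope_def abs_mult)
qed

lemma nearly_affineD:
  assumes "nearly_affine d N f \<tau> H x" "S \<subseteq> {..<d}"
  shows "\<bar>real N / real H * (f (grid_point d N (push H S x)) - f (grid_point d N x))
           - (\<Sum>i\<in>S. slope d N f H x i)\<bar> \<le> \<tau>"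
proof -
  have "real N / real H * affinity_defect (\<lambda>x. f (grid_point d N x)) H S x
      = real N / real H * (f (grid_point d N (push H S x)) - f (grid_point d N x)) - (\<Sum>i\<in>S. slope d N f H x i)"
    unfolding affinity_defect_def slope_def sum_distrib_left[symmetric] by (rule right_diff_distrib)
  then show ?thesis using assms unfolding nearly_affine_def by metis
qed

text \<open>The sum of the slopes is nearly the rate of change along the indicator vector of
  \<open>S\<close>, whose length is the square root of \<open>card S\<close>. This is much better
  than the bound \<open>M * card S\<close> that the single slopes give.\<close>

lemma sum_slope_le:
  assumes f: "lipschitz_cube d M f" and N: "0 < N" and H: "0 < H" and x: "admits_step d N H x"
    and aff: "nearly_affine d N f \<tau> H x" and S: "S \<subseteq> {..<d}"
  shows "\<bar>\<Sum>i\<in>S. slope d N f H x i\<bar> \<le> M * sqrt (card S) + \<tau>"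
proof -
  let ?D = "f (grid_point d N (push H S x)) - f (grid_point d N x)"
  have "real N / real H * \<bar>?D\<bar> \<le> M * sqrt (card S)"
    using push_lipschitz[OF f N x S] N H by (simp add: field_simps)
  then have "\<bar>real N / real H * ?D\<bar> \<le> M * sqrt (card S)" using N H by (simp add: abs_mult)
  moreover have "\<bar>s\<bar> \<le> m + t" if "\<bar>e\<bar> \<le> m" "\<bar>e - s\<bar> \<le> t" for e s m t :: real
    using that by linarith
  ultimately show ?thesis using nearly_affineD[OF aff S] by blast
qed

definition steep :: "nat \<Rightarrow> nat \<Rightarrow> ((nat \<Rightarrow> real) \<Rightarrow> real) \<Rightarrow> nat \<Rightarrow> (nat \<Rightarrow> nat) \<Rightarrow> real \<Rightarrow> nat set" where
  "steep d N f H x \<theta> = {i. i < d \<and> slope d N f H x i \<le> - \<theta>}"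

text \<open>The slopes of \<open>s\<close> steep coordinates add up to at most
  \<open>- s * M / 2 ^ a\<close>, while \<open>sum_slope_le\<close> allows only
  \<open>M * sqrt s\<close> up to a small error. This limits \<open>s\<close> independently of
  \<open>d\<close>.\<close>

lemma card_steep_le:
  assumes f: "lipschitz_cube d M f" and N: "0 < N" and H: "0 < H" and x: "admits_step d N H x"
    and aff: "nearly_affine d N f \<tau> H x" and M: "0 < M" and \<tau>: "2 * \<tau> * 2 ^ a \<le> M"
  shows "real (card (steep d N f H x (M / 2 ^ a))) \<le> 4 * 4 ^ a"
proof -
  let ?Q = "steep d N f H x (M / 2 ^ a)"
  let ?s = "real (card ?Q)"
  have Q: "?Q \<subseteq> {..<d}" by (auto simp: steep_def)
  show ?thesis
  proof (cases "card ?Q = 0")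
    case False
    then have s: "1 \<le> ?s" by linarith
    have "?s * (M / 2 ^ a) \<le> (\<Sum>i\<in>?Q. - slope d N f H x i)"
      by (rule sum_bounded_below) (auto simp: steep_def)
    also have "\<dots> \<le> M * sqrt ?s + \<tau>"
      using sum_slope_le[OF f N H x aff Q] by (simp add: sum_negf)
    also have "\<tau> \<le> M / 2 ^ a / 2" using \<tau> by (simp add: field_simps)
    also have "\<dots> \<le> ?s * (M / 2 ^ a) / 2" using s M by (simp add: field_simps)
    finally have "M * ?s \<le> M * (2 * 2 ^ a * sqrt ?s)" by (simp add: field_simps)
    then have "sqrt ?s * sqrt ?s \<le> (2 * 2 ^ a) * sqrt ?s" using M by simp
    then have "sqrt ?s \<le> 2 * 2 ^ a" by (rule mult_right_le_imp_le) (use s in simp)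
    then have "(sqrt ?s)\<^sup>2 \<le> (2 * 2 ^ a)\<^sup>2" by (intro power_mono) auto
    moreover have "(2 * 2 ^ a)\<^sup>2 = (4 * 4 ^ a :: real)"
      by (simp add: power_mult_distrib power_even_eq[symmetric] power_mult)
    ultimately show ?thesis by simp
  qed simp
qed

lemma level_reject:
  assumes f: "lipschitz_cube d M f" and N: "0 < N" and H: "0 < H" and x: "admits_step d N H x"
    and aff: "nearly_affine d N f \<tau> H x" and M: "0 < M" and \<tau>: "0 < \<tau>" "4 * \<tau> * 2 ^ a \<le> M"
    and d: "0 < d" and l: "sqrt d \<le> 2 ^ l" "2 ^ l \<le> 2 * sqrt d"
  shows "real (card (steep d N f H x (M / 2 ^ a))) / (64 * sqrt d * 4 ^ a)
    \<le> measure_pmf.prob (random_subset d (1 / 2 ^ (a + l + 4)))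
        {S. f (grid_point d N (push H S x)) < f (grid_point d N x)}"
proof -
  let ?g = "slope d N f H x" and ?Q = "steep d N f H x (M / 2 ^ a)"
  \<comment> \<open>At rate \<open>?r\<close>, a set of \<open>?cap\<close> coordinates is hit 1/4
    times on average, the most that \<open>hit_probability\<close> allows. A larger set of steep
    coordinates is replaced by a subset \<open>Q'\<close> of this size.\<close>
  let ?s = "card ?Q" and ?cap = "2 ^ (a + l + 2) :: nat"
  let ?r = "1 / 2 ^ (a + l + 4) :: real"
  define \<theta> where "\<theta> = M / 2 ^ a"
  have \<theta>: "0 < \<theta>" "4 * \<tau> \<le> \<theta>" "\<theta> \<le> M"
    using M \<tau> by (simp_all add: \<theta>_def field_simps)
  obtain Q' where Q': "Q' \<subseteq> ?Q" "card Q' = min ?s ?cap"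
    using obtain_subset_with_card_n[of "min ?s ?cap" ?Q] by auto
  have Qd: "Q' \<subseteq> {..<d}" using Q'(1) by (auto simp: steep_def)
  define p where "p k = (if k < d then max 0 (?g k) else 0)" for k
  have "(\<Sum>k<d. p k) = (\<Sum>k\<in>{k. k < d \<and> 0 < ?g k}. ?g k)"
    by (rule sum.mono_neutral_cong_right) (auto simp: p_def max_def)
  also have "\<dots> \<le> M * sqrt (card {k. k < d \<and> 0 < ?g k}) + \<tau>"
    using abs_ge_self by (rule order_trans) (rule sum_slope_le[OF f N H x aff], auto)
  also have "\<dots> \<le> M * sqrt d + M * sqrt d"
  proof (intro add_mono mult_left_mono real_sqrt_le_mono)
    show "real (card {k. k < d \<and> 0 < ?g k}) \<le> d"
      using card_mono[of "{..<d}" "{k. k < d \<and> 0 < ?g k}"] by auto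
    have "\<tau> \<le> M" using \<theta> \<tau> by linarith
    also have "\<dots> \<le> M * sqrt d" using M d by simp
    finally show "\<tau> \<le> M * sqrt d" .
  qed (use M in auto)
  finally have P: "(\<Sum>k<d. p k) \<le> 2 * M * 2 ^ l" using l(1) M by (simp add: order_trans)
  \<comment> \<open>The rate is chosen for this bound: the positive slopes may use up half of the
    threshold \<open>\<theta>\<close>, and their expected sum in the random set is a quarter of
    that.\<close>
  have "?r * (\<Sum>k<d. p k) \<le> ?r * (2 * M * 2 ^ l)" using P by (intro mult_left_mono) auto
  also have "\<dots> = (\<theta> / 2) / 4" by (simp add: \<theta>_def power_add)
  finally have rp: "?r * (\<Sum>k<d. p k) \<le> (\<theta> / 2) / 4" .
  have "real (card Q') \<le> real ?cap" by (simp only: Q'(2) of_nat_le_iff min.cobounded2)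
  then have "?r * card Q' \<le> ?r * ?cap" by (intro mult_left_mono) auto
  also have "\<dots> = 1 / 4" by (simp add: power_add)
  finally have rQ: "?r * card Q' \<le> 1 / 4" .
  let ?E = "{S. S \<inter> Q' \<noteq> {} \<and> (\<Sum>k<d. p k * of_bool (k \<in> S)) < \<theta> / 2}"
  have "card Q' * ?r / 2 \<le> measure_pmf.prob (random_subset d ?r) ?E"
  proof (rule hit_probability[OF _ _ Qd])
    fix k assume "k \<in> Q'"
    then have "?g k \<le> - \<theta>" using Q'(1) by (auto simp: steep_def \<theta>_def)
    then show "p k = 0" using \<theta>(1) by (simp add: p_def)
  next
    have "(1::real) \<le> 2 ^ (a + l + 4)" by (rule one_le_power) simp
    then show "?r \<le> 1" by simp
  qed (use rp rQ \<theta> in \<open>auto simp: p_def\<close>)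
  also have "\<dots> \<le> measure_pmf.prob (random_subset d ?r)
        {S. f (grid_point d N (push H S x)) < f (grid_point d N x)}"
  proof (rule measure_pmf.finite_measure_mono_AE)
    show "AE S in measure_pmf (random_subset d ?r). S \<in> ?E \<longrightarrow>
        S \<in> {S. f (grid_point d N (push H S x)) < f (grid_point d N x)}"
      unfolding AE_measure_pmf_iff
    proof (intro ballI impI)
      fix S assume "S \<in> set_pmf (random_subset d ?r)" and S: "S \<in> ?E"
      then have Sd: "S \<subseteq> {..<d}" by (simp add: random_subset_subset)
      then have fin: "finite S" by (rule finite_subset) simp
      obtain k where k: "k \<in> S" "k \<in> Q'" using S by auto
      have "?g k \<le> - \<theta>" using k Q'(1) by (auto simp: steep_def \<theta>_def)
      moreover have "(\<Sum>i\<in>S - {k}. ?g i) \<le> (\<Sum>i\<in>S - {k}. p i)"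
        using Sd by (intro sum_mono) (auto simp: p_def)
      moreover have "(\<Sum>i\<in>S - {k}. p i) \<le> (\<Sum>i\<in>S. p i)"
        using fin by (intro sum_mono2) (auto simp: p_def)
      moreover have "(\<Sum>i\<in>S. p i) = (\<Sum>i<d. p i * of_bool (i \<in> S))"
        using Sd by (intro sum.mono_neutral_cong_left) auto
      \<comment> \<open>A steep coordinate contributes at most \<open>- \<theta>\<close>, the
        positive slopes less than \<open>\<theta> / 2\<close>. The error of affinity, at most
        \<open>\<theta> / 4\<close>, cannot make up for the difference.\<close>
      ultimately have "(\<Sum>i\<in>S. ?g i) < - \<theta> / 2"
        using S fin k(1) by (simp add: sum.remove[of S k])
      then have "real N / real H * (f (grid_point d N (push H S x)) - f (grid_point d N x)) < 0"
        using nearly_affineD[OF aff Sd] \<theta> \<tau> by linarith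
      then show "S \<in> {S. f (grid_point d N (push H S x)) < f (grid_point d N x)}"
        using N H by (simp add: mult_less_0_iff divide_less_0_iff)
    qed
  qed simp
  finally have "card Q' * ?r / 2 \<le> measure_pmf.prob (random_subset d ?r)
        {S. f (grid_point d N (push H S x)) < f (grid_point d N x)}" .
  moreover have "real ?s / (64 * sqrt d * 4 ^ a) \<le> card Q' * ?r / 2"
  proof -
    have "1 / (64 * sqrt d) \<le> 1 / (32 * 2 ^ l)"
      using l d by (intro divide_left_mono) auto
    then have "real ?s / 4 ^ a * (1 / (64 * sqrt d)) \<le> real ?s / 4 ^ a * (1 / (32 * 2 ^ l))"
      by (intro mult_left_mono) auto
    then have "real ?s / (64 * sqrt d * 4 ^ a) \<le> ?s / 4 ^ a / (32 * 2 ^ l)" by (simp add: mult_ac)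
    also have "\<dots> \<le> card Q' * ?r / 2"
    proof (cases "?s \<le> ?cap")
      case True
      \<comment> \<open>The weaker factor \<open>4 ^ a\<close> is the weight of level
        \<open>a\<close> in a sum of squares.\<close>
      have "(2::real) ^ a \<le> 4 ^ a" by (intro power_mono) auto
      then have "real ?s / 4 ^ a / (32 * 2 ^ l) \<le> real ?s / 2 ^ a / (32 * 2 ^ l)"
        by (intro divide_right_mono divide_left_mono) auto
      also have "\<dots> = card Q' * ?r / 2" using True Q'(2) by (simp add: power_add min_def)
      finally show ?thesis .
    next
      case False
      \<comment> \<open>With more than \<open>?cap\<close> steep coordinates the right side is 1/8,
        and \<open>card_steep_le\<close> shows that the left side is no larger.\<close>
      have "2 * \<tau> * 2 ^ a \<le> M" using \<tau> by (smt (verit) mult_right_mono zero_le_power)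
      then have "real ?s / 4 ^ a \<le> 4"
        using card_steep_le[OF f N H x aff M] by (simp add: field_simps)
      moreover have "(1::real) \<le> 2 ^ l" by simp
      ultimately have "real ?s / 4 ^ a / (32 * 2 ^ l) \<le> 4 / 32" by (intro frac_le) auto
      also have "\<dots> = ?cap * ?r / 2" by (simp add: power_add)
      also have "\<dots> = card Q' * ?r / 2" using False Q'(2) by (simp add: min_def)
      finally show ?thesis .
    qed
    finally show ?thesis .
  qed
  ultimately show ?thesis by linarith
qed

section \<open>Dyadic levels of the slope energy\<close>

lemma square_le_dyadic_levels:
  fixes q M :: real
  assumes "0 \<le> q" "q \<le> M"
  shows "q\<^sup>2 \<le> 4 * M\<^sup>2 * (\<Sum>a\<le>A. of_bool (M / 2 ^ a \<le> q) / 4 ^ a) + (M / 2 ^ A)\<^sup>2"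
proof (cases "M / 2 ^ A \<le> q")
  case False
  then have "q\<^sup>2 \<le> (M / 2 ^ A)\<^sup>2" using assms by (intro power_mono) auto
  then show ?thesis by (smt (verit) mult_nonneg_nonneg of_bool_def sum_nonneg zero_le_divide_iff zero_le_power zero_le_power2)
next
  case True
  \<comment> \<open>At the first level that \<open>q\<close> reaches, \<open>M / 2 ^ a\<close>
    agrees with \<open>q\<close> up to a factor of 2, so this term alone dominates the
    square.\<close>
  define a where "a = (LEAST a. M / 2 ^ a \<le> q)"
  have a: "M / 2 ^ a \<le> q" "a \<le> A" unfolding a_def using True by (rule LeastI Least_le)+
  have "q \<le> 2 * (M / 2 ^ a)"
  proof (cases a)
    case (Suc b)
    then have "\<not> M / 2 ^ b \<le> q" using not_less_Least[of b "\<lambda>a. M / 2 ^ a \<le> q"] by (simp add: a_def)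
    then show ?thesis using Suc by simp
  qed (use assms in auto)
  then have "q\<^sup>2 \<le> (2 * (M / 2 ^ a))\<^sup>2" using assms by (intro power_mono)
  also have "\<dots> = 4 * M\<^sup>2 * (of_bool (M / 2 ^ a \<le> q) / 4 ^ a)"
    using a(1) by (simp add: power_mult_distrib power_divide power_even_eq[symmetric] power_mult)
  also have "\<dots> \<le> 4 * M\<^sup>2 * (\<Sum>a\<le>A. of_bool (M / 2 ^ a \<le> q) / 4 ^ a)"
    using a(2) by (intro mult_left_mono member_le_sum[of a]) auto
  finally show ?thesis by (smt (verit) zero_le_power2)
qed

lemma slope_energy_le:
  assumes f: "lipschitz_cube d M f" and N: "0 < N" and H: "0 < H" and M: "0 \<le> M" and i: "i < d"
    and x: "x \<in> grid d N"
  shows "(real N / real H)\<^sup>2 * slope_energy d N H f i x \<le> M\<^sup>2"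
proof (cases "x i + H < N")
  case True
  let ?p = "grid_point d N (x(i := x i + H))" and ?q = "grid_point d N x"
  have "?p \<in> cube d" "?q \<in> cube d"
    using True gridD[OF x] by (auto intro!: grid_point_cube)
  then have "\<bar>f ?q - f ?p\<bar> \<le> M * edist d ?q ?p" using f by (simp add: lipschitz_cube_def)
  also have "(\<Sum>k<d. (?q k - ?p k)\<^sup>2) = (\<Sum>k<d. if k = i then (real H / real N)\<^sup>2 else 0)"
    using N by (intro sum.cong) (auto simp: grid_point_def field_simps)
  then have "edist d ?q ?p = real H / real N"
    using i by (simp add: edist_def L2_set_def)
  finally have "\<bar>f ?q - f ?p\<bar> \<le> M * (real H / real N)" .
  moreover have "max 0 (f ?q - f ?p) \<le> \<bar>f ?q - f ?p\<bar>" by (rule max.boundedI) simp_all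
  ultimately have "max 0 (f ?q - f ?p) \<le> M * (real H / real N)" by (rule order_trans[rotated])
  moreover have "(real N / real H) * m \<le> M" if "m \<le> M * (real H / real N)" for m
    using that N H by (simp add: field_simps)
  ultimately have "(real N / real H) * max 0 (f ?q - f ?p) \<le> M" by blast
  then have "((real N / real H) * max 0 (f ?q - f ?p))\<^sup>2 \<le> M\<^sup>2" by (intro power_mono) auto
  then show ?thesis using True by (simp only: slope_energy_def power_mult_distrib if_True)
qed (simp add: slope_energy_def)

lemma slope_energy_levels:
  assumes f: "lipschitz_cube d M f" and N: "0 < N" and H: "0 < H" and x: "admits_step d N H x"
    and M: "0 < M"
  shows "(real N / real H)\<^sup>2 * (\<Sum>i<d. slope_energy d N H f i x)
    \<le> 4 * M\<^sup>2 * (\<Sum>a\<le>A. card (steep d N f H x (M / 2 ^ a)) / 4 ^ a) + d * (M / 2 ^ A)\<^sup>2"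
proof -
  let ?q = "\<lambda>i. max 0 (- slope d N f H x i)"
  have "(real N / real H)\<^sup>2 * (\<Sum>i<d. slope_energy d N H f i x) = (\<Sum>i<d. (?q i)\<^sup>2)"
    unfolding sum_distrib_left
  proof (intro sum.cong refl)
    fix i assume "i \<in> {..<d}"
    have "push H {i} x = x(i := x i + H)" by (auto simp: push_def)
    then have neg: "- slope d N f H x i
        = real N / real H * (f (grid_point d N x) - f (grid_point d N (x(i := x i + H))))"
      by (simp add: slope_def algebra_simps)
    have max_mult: "max 0 (c * r) = c * max 0 r" if "0 \<le> c" for c r :: real
      using that by (auto simp: max_def zero_le_mult_iff mult_le_0_iff)
    have "0 \<le> real N / real H" by simp
    then have "?q i
        = real N / real H * max 0 (f (grid_point d N x) - f (grid_point d N (x(i := x i + H))))"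
      unfolding neg by (rule max_mult)
    then show "(real N / real H)\<^sup>2 * slope_energy d N H f i x = (?q i)\<^sup>2"
      using x \<open>i \<in> {..<d}\<close> by (simp only: power_mult_distrib) (simp add: slope_energy_def admits_step_def)
  qed
  also have "\<dots> \<le> (\<Sum>i<d. 4 * M\<^sup>2 * (\<Sum>a\<le>A. of_bool (M / 2 ^ a \<le> ?q i) / 4 ^ a) + (M / 2 ^ A)\<^sup>2)"
    using abs_slope_le[OF f N H x] M by (intro sum_mono square_le_dyadic_levels) (force simp: abs_le_iff)+
  also have "\<dots> = 4 * M\<^sup>2 * (\<Sum>i<d. \<Sum>a\<le>A. of_bool (M / 2 ^ a \<le> ?q i) / 4 ^ a) + d * (M / 2 ^ A)\<^sup>2"
    by (simp add: sum.distrib sum_distrib_left)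
  also have "(\<Sum>i<d. \<Sum>a\<le>A. of_bool (M / 2 ^ a \<le> ?q i) / 4 ^ a) = (\<Sum>a\<le>A. \<Sum>i<d. of_bool (M / 2 ^ a \<le> ?q i) / (4 ^ a :: real))"
    by (rule sum.swap)
  also have "\<dots> = (\<Sum>a\<le>A. card {i. i < d \<and> M / 2 ^ a \<le> ?q i} / 4 ^ a)"
    by (intro sum.cong refl) (simp add: sum_divide_distrib[symmetric] of_bool_def sum.If_cases Int_def)
  finally have "(real N / real H)\<^sup>2 * (\<Sum>i<d. slope_energy d N H f i x)
    \<le> 4 * M\<^sup>2 * (\<Sum>a\<le>A. card {i. i < d \<and> M / 2 ^ a \<le> ?q i} / 4 ^ a) + d * (M / 2 ^ A)\<^sup>2" .
  also have "\<dots> \<le> 4 * M\<^sup>2 * (\<Sum>a\<le>A. card (steep d N f H x (M / 2 ^ a)) / 4 ^ a) + d * (M / 2 ^ A)\<^sup>2"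
  proof (intro add_right_mono mult_left_mono sum_mono divide_right_mono)
    fix a
    have "0 < M / 2 ^ a" using M by simp
    then have "{i. i < d \<and> M / 2 ^ a \<le> ?q i} \<subseteq> steep d N f H x (M / 2 ^ a)"
      by (auto simp: steep_def max_def split: if_splits)
    then show "real (card {i. i < d \<and> M / 2 ^ a \<le> ?q i}) \<le> real (card (steep d N f H x (M / 2 ^ a)))"
      by (intro of_nat_mono card_mono) (auto simp: steep_def)
  qed auto
  finally show ?thesis .
qed

text \<open>A union bound over the coordinates: one of them must lie in the last \<open>H\<close> of
  the \<open>n * H\<close> layers, a fraction \<open>1 / n\<close> of the grid.\<close>

lemma card_not_admits_step:
  assumes "0 < H"
  shows "n * card {x \<in> grid d (n * H). \<not> admits_step d (n * H) H x} \<le> d * (n * H) ^ d"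
proof -
  let ?N = "n * H"
  let ?B = "\<lambda>i. {x \<in> grid d ?N. ?N \<le> x i + H}"
  have line: "n * real (card (?B i)) \<le> real ?N ^ d" if i: "i < d" for i
  proof (cases "n = 0")
    case False
    have "?N * real (card (?B i)) = ?N * (\<Sum>x\<in>grid d ?N. of_bool (?N \<le> x i + H))"
      by (simp add: of_bool_def sum.If_cases Int_def)
    also have "\<dots> = (\<Sum>x\<in>grid d ?N. \<Sum>k<?N. of_bool (?N \<le> k + H))"
      using sum_lines[OF i, of "\<lambda>x. of_bool (?N \<le> x i + H)" ?N] by simp
    also have "\<dots> = real ?N ^ d * real (card {k. k < ?N \<and> ?N \<le> k + H})"
      by (simp add: of_bool_def sum.If_cases Int_def)
    also have "\<dots> \<le> real ?N ^ d * H"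
    proof (intro mult_left_mono of_nat_mono)
      have "{k. k < ?N \<and> ?N \<le> k + H} \<subseteq> {?N - H..<?N}" by auto
      then have "card {k. k < ?N \<and> ?N \<le> k + H} \<le> card {?N - H..<?N}" by (rule card_mono[rotated]) simp
      then show "card {k. k < ?N \<and> ?N \<le> k + H} \<le> H" by simp
    qed auto
    finally have "H * (n * real (card (?B i))) \<le> H * real ?N ^ d" by (simp add: mult_ac)
    then show ?thesis using assms by simp
  qed simp
  have "card {x \<in> grid d ?N. \<not> admits_step d ?N H x} \<le> card (\<Union>i<d. ?B i)"
    by (intro card_mono) (auto simp: admits_step_def not_less)
  also have "\<dots> \<le> (\<Sum>i<d. card (?B i))" by (rule card_UN_le) simp
  finally have "n * real (card {x \<in> grid d ?N. \<not> admits_step d ?N H x}) \<le> n * (\<Sum>i<d. real (card (?B i)))"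
    by (intro mult_left_mono) (simp_all flip: of_nat_sum)
  also have "\<dots> \<le> (\<Sum>i<d. real ?N ^ d)"
    unfolding sum_distrib_left using line by (intro sum_mono) auto
  finally show ?thesis by (simp flip: of_nat_mult of_nat_power)
qed

section \<open>The distribution of the compared pairs\<close>

lemma measure_bind_pmf_of_set:
  assumes "finite Z" "Z \<noteq> {}"
  shows "measure_pmf.prob (bind_pmf (pmf_of_set Z) h) R = (\<Sum>z\<in>Z. measure_pmf.prob (h z) R) / card Z"
proof -
  have "ennreal (measure_pmf.prob (bind_pmf (pmf_of_set Z) h) R)
      = (\<integral>\<^sup>+z. ennreal (measure_pmf.prob (h z) R) \<partial>pmf_of_set Z)"
    by (simp flip: measure_pmf.emeasure_eq_measure)
  also have "\<dots> = ennreal ((\<Sum>z\<in>Z. measure_pmf.prob (h z) R) / card Z)"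
    using assms
    by (simp add: nn_integral_pmf_of_set sum_nonneg divide_ennreal card_gt_0_iff
        ennreal_of_nat_eq_real_of_nat)
  finally show ?thesis by (simp add: sum_nonneg)
qed

text \<open>Where the step might leave the grid, the point is compared with itself, which never
  leads to rejection.\<close>

definition sample_pair ::
  "nat \<Rightarrow> nat \<Rightarrow> nat \<Rightarrow> nat \<times> (nat \<Rightarrow> nat) \<times> nat \<Rightarrow> ((nat \<Rightarrow> real) \<times> (nat \<Rightarrow> real)) pmf" where
  "sample_pair d N l = (\<lambda>(j, x, a). map_pmf
     (\<lambda>S. (grid_point d N x,
           grid_point d N (if admits_step d N (2 ^ Suc j) x then push (2 ^ Suc j) S x else x)))
     (random_subset d (1 / 2 ^ (a + l + 4))))"

lemma sample_pair_legal:
  assumes "x \<in> grid d N" "(u, v) \<in> set_pmf (sample_pair d N l (j, x, a))"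
  shows "u \<in> cube d \<and> v \<in> cube d \<and> u \<le> v"
proof -
  obtain S where u: "u = grid_point d N x"
    and v: "v = grid_point d N (if admits_step d N (2 ^ Suc j) x then push (2 ^ Suc j) S x else x)"
    using assms(2) by (auto simp: sample_pair_def)
  define y where "y = (if admits_step d N (2 ^ Suc j) x then push (2 ^ Suc j) S x else x)"
  have "y i < N" if "i < d" for i
    using that gridD[OF assms(1) that] by (auto simp: y_def admits_step_def push_def intro: add_lessD1)
  moreover have "x i \<le> y i" for i by (auto simp: y_def push_def)
  ultimately show ?thesis
    unfolding u v y_def[symmetric]
    by (intro conjI grid_point_cube gridD[OF assms(1)])
      (auto intro!: divide_right_mono simp: le_fun_def grid_point_def)
qed

text \<open>The average normalized energy is at least \<open>\<epsilon>^2 / 8\<close>. Slopes below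
  the last level account for at most \<open>\<epsilon>^2 / 32\<close>, and so do boundary and rough
  points together, by the choice of \<open>\<eta>\<close>. The remaining
  \<open>\<epsilon>^2 / 16\<close> comes from the levels at good points. Bounding the levels by
  rejection probabilities gives the first claim; bounding them by \<open>card_steep_le\<close> gives
  the second, a limit on \<epsilon> whenever a far function exists.\<close>

lemma sample_pair_reject:
  fixes A :: nat and M \<epsilon> :: real
  assumes f: "lipschitz_cube d M f" and d: "0 < d" and M: "0 < M" and \<epsilon>: "0 < \<epsilon>" "\<epsilon> \<le> dist_mono d f"
    and A: "32 * real d * M\<^sup>2 \<le> \<epsilon>\<^sup>2 * 4 ^ A" and l: "sqrt d \<le> 2 ^ l" "2 ^ l \<le> 2 * sqrt d"
    and \<tau>_def: "\<tau> = M / 2 ^ (A + 2)" and \<eta>_def: "\<eta> = \<epsilon>\<^sup>2 / (64 * real d * M\<^sup>2)"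
    and K: "0 < K" and N_def: "N = n * 2 ^ K"
    and affine: "(\<Sum>j<K. real (card {x \<in> grid d N. admits_step d N (2 ^ Suc j) x \<and> \<not> nearly_affine d N f \<tau> (2 ^ Suc j) x}))
      \<le> \<eta> * K * real N ^ d"
    and n: "0 < n" "4 * real d * M\<^sup>2 \<le> (real n)\<^sup>2 * \<epsilon>\<^sup>2" "d \<le> \<eta> * n"
  shows "\<epsilon>\<^sup>2 / (4096 * sqrt d * M\<^sup>2 * (A + 1))
      \<le> measure_pmf.prob (bind_pmf (pmf_of_set ({..<K} \<times> grid d N \<times> {..A})) (sample_pair d N l)) {(u, v). f v < f u}"
    and "\<epsilon>\<^sup>2 \<le> 256 * M\<^sup>2 * (A + 1)"
proof -
  define H where "H j = (2 :: nat) ^ Suc j" for j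
  have H: "0 < H j" for j by (simp add: H_def)
  have N: "0 < N" using n by (simp add: N_def)
  define good where "good j x \<longleftrightarrow> admits_step d N (H j) x \<and> nearly_affine d N f \<tau> (H j) x" for j x
  define E where "E j x = (real N / real (H j))\<^sup>2 * (\<Sum>i<d. slope_energy d N (H j) f i x)" for j x
  define B where "B j x = (if good j x then \<Sum>a\<le>A. card (steep d N f (H j) x (M / 2 ^ a)) / 4 ^ a else 0)" for j x
  define R where "R j x a = measure_pmf.prob (sample_pair d N l (j, x, a)) {(u, v). f v < f u}" for j x a
  have \<tau>: "0 < \<tau>" "4 * \<tau> * 2 ^ a \<le> M" if "a \<le> A" for a
  proof -
    show "0 < \<tau>" using M by (simp add: \<tau>_def)
    have "(2::real) ^ a \<le> 2 ^ A" using that by (intro power_increasing) auto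
    then have "4 * \<tau> * 2 ^ a \<le> 4 * \<tau> * 2 ^ A" using M by (intro mult_left_mono) (auto simp: \<tau>_def)
    then show "4 * \<tau> * 2 ^ a \<le> M" using M by (simp add: \<tau>_def power_add)
  qed
  have B_le: "B j x \<le> 4 * (real A + 1)" for j x
  proof (cases "good j x")
    case True
    have "real (card (steep d N f (H j) x (M / 2 ^ a))) / 4 ^ a \<le> 4" if "a \<le> A" for a
    proof -
      have "2 * \<tau> * 2 ^ a \<le> 4 * \<tau> * 2 ^ a" using \<tau>(1)[OF that] by (intro mult_right_mono) auto
      then have "2 * \<tau> * 2 ^ a \<le> M" using \<tau>(2)[OF that] by linarith
      then have "real (card (steep d N f (H j) x (M / 2 ^ a))) \<le> 4 * 4 ^ a"
        using True by (intro card_steep_le[OF f N H _ _ M]) (auto simp: good_def)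
      then show ?thesis by (simp add: field_simps)
    qed
    then have "B j x \<le> (\<Sum>a\<le>A. 4)" using True unfolding B_def by (simp only: if_True) (intro sum_mono, auto)
    then show ?thesis by simp
  qed (simp add: B_def)
  have B_reject: "B j x \<le> 64 * sqrt d * (\<Sum>a\<le>A. R j x a)" if x: "x \<in> grid d N" for j x
  proof (cases "good j x")
    case True
    have "card (steep d N f (H j) x (M / 2 ^ a)) / 4 ^ a \<le> 64 * sqrt d * R j x a" if "a \<le> A" for a
    proof -
      have "real (card (steep d N f (H j) x (M / 2 ^ a))) / (64 * sqrt d * 4 ^ a) \<le>
          measure_pmf.prob (random_subset d (1 / 2 ^ (a + l + 4)))
            {S. f (grid_point d N (push (H j) S x)) < f (grid_point d N x)}"
        using True that \<tau> d l by (intro level_reject[OF f N H _ _ M]) (auto simp: good_def)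
      also have "\<dots> = R j x a"
        using True by (simp add: R_def sample_pair_def good_def H_def vimage_def)
      finally show ?thesis using d by (simp add: field_simps)
    qed
    then have "B j x \<le> (\<Sum>a\<le>A. 64 * sqrt d * R j x a)"
      using True unfolding B_def by (simp only: if_True) (intro sum_mono, auto)
    then show ?thesis by (simp add: sum_distrib_left)
  next
    case False
    have "0 \<le> (\<Sum>a\<le>A. R j x a)" by (intro sum_nonneg) (simp add: R_def)
    then show ?thesis using False by (simp add: B_def)
  qed
  have E_le: "E j x \<le> 4 * M\<^sup>2 * B j x + \<epsilon>\<^sup>2 / 32 + d * M\<^sup>2 *
      (of_bool (\<not> admits_step d N (H j) x) + of_bool (admits_step d N (H j) x \<and> \<not> nearly_affine d N f \<tau> (H j) x))"
    if x: "x \<in> grid d N" for j x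
  proof (cases "good j x")
    case True
    have "E j x \<le> 4 * M\<^sup>2 * (\<Sum>a\<le>A. card (steep d N f (H j) x (M / 2 ^ a)) / 4 ^ a) + d * (M / 2 ^ A)\<^sup>2"
      unfolding E_def using True by (intro slope_energy_levels[OF f N H _ M]) (auto simp: good_def)
    also have "d * (M / 2 ^ A)\<^sup>2 \<le> \<epsilon>\<^sup>2 / 32"
    proof -
      have "(2 ^ A)\<^sup>2 = (4 ^ A :: real)" by (simp add: power2_eq_square flip: power_mult_distrib)
      then show ?thesis using A by (simp add: power_divide field_simps)
    qed
    finally show ?thesis using True by (simp add: good_def B_def)
  next
    case False
    have "E j x = (\<Sum>i<d. (real N / real (H j))\<^sup>2 * slope_energy d N (H j) f i x)"
      by (simp add: E_def sum_distrib_left)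
    also have "\<dots> \<le> (\<Sum>i<d. M\<^sup>2)"
      using M by (intro sum_mono slope_energy_le[OF f N H _ _ x]) auto
    finally have "E j x \<le> d * M\<^sup>2" by simp
    moreover have "of_bool (\<not> admits_step d N (H j) x)
        + of_bool (admits_step d N (H j) x \<and> \<not> nearly_affine d N f \<tau> (H j) x) = (1::real)"
      using False by (auto simp: good_def)
    moreover have "B j x = 0" "0 \<le> \<epsilon>\<^sup>2 / 32" using False by (simp_all add: B_def)
    ultimately show ?thesis by (simp only: mult_zero_right mult_1_right)
  qed
  have E_ge: "\<epsilon>\<^sup>2 / 8 * real N ^ d \<le> (\<Sum>x\<in>grid d N. E j x)"
    and boundary: "real (card {x \<in> grid d N. \<not> admits_step d N (H j) x}) \<le> \<eta> * real N ^ d" if j: "j < K" for j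
  proof -
    \<comment> \<open>One grid serves all scales: seen from scale \<open>j\<close>, it consists of
      translates of a coarse grid with \<open>m \<ge> n\<close> points per side.\<close>
    define m where "m = n * 2 ^ (K - Suc j)"
    have "2 ^ (K - Suc j) * H j = 2 ^ K"
      unfolding H_def using j by (subst power_add[symmetric]) simp
    then have NmH: "N = m * H j" by (simp add: N_def m_def mult.assoc)
    have nm: "n \<le> m" "0 < m" using n by (simp_all add: m_def)
    have "(real n)\<^sup>2 * \<epsilon>\<^sup>2 \<le> (real m)\<^sup>2 * \<epsilon>\<^sup>2" using nm by (intro mult_right_mono power_mono) auto
    then have "4 * real d * M\<^sup>2 \<le> (real m)\<^sup>2 * \<epsilon>\<^sup>2" using n by linarith
    from directed_poincare[OF f M \<epsilon> nm(2) this H[of j]]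
    have "\<epsilon>\<^sup>2 / 8 * real N ^ d \<le> (real m)\<^sup>2 * (\<Sum>x\<in>grid d N. \<Sum>i<d. slope_energy d N (H j) f i x)"
      unfolding NmH .
    moreover have "real N / real (H j) = m" using H[of j] by (simp add: NmH)
    ultimately show "\<epsilon>\<^sup>2 / 8 * real N ^ d \<le> (\<Sum>x\<in>grid d N. E j x)"
      by (simp add: E_def sum_distrib_left)
    let ?c = "card {x \<in> grid d N. \<not> admits_step d N (H j) x}"
    have "n * ?c \<le> m * ?c" using nm by simp
    also have "\<dots> \<le> d * N ^ d" using card_not_admits_step[OF H[of j], of m d] by (simp add: NmH)
    finally have "real n * ?c \<le> d * real N ^ d" by (simp flip: of_nat_mult of_nat_power)
    also have "\<dots> \<le> \<eta> * n * real N ^ d" using n by (intro mult_right_mono) auto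
    finally have "real n * ?c \<le> real n * (\<eta> * real N ^ d)" by (simp add: mult_ac)
    then show "?c \<le> \<eta> * real N ^ d" using n by simp
  qed
  let ?B = "\<Sum>j<K. \<Sum>x\<in>grid d N. B j x"
  let ?V = "K * real N ^ d"
  have V: "0 < ?V" using K N by simp
  have "\<epsilon>\<^sup>2 / 8 * ?V = (\<Sum>j<K. \<epsilon>\<^sup>2 / 8 * real N ^ d)" by simp
  also have "\<dots> \<le> (\<Sum>j<K. \<Sum>x\<in>grid d N. E j x)" by (intro sum_mono E_ge) simp
  also have "\<dots> \<le> (\<Sum>j<K. \<Sum>x\<in>grid d N. 4 * M\<^sup>2 * B j x + \<epsilon>\<^sup>2 / 32 + d * M\<^sup>2 *
      (of_bool (\<not> admits_step d N (H j) x) + of_bool (admits_step d N (H j) x \<and> \<not> nearly_affine d N f \<tau> (H j) x)))"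
    by (intro sum_mono E_le)
  also have "\<dots> = 4 * M\<^sup>2 * ?B + \<epsilon>\<^sup>2 / 32 * ?V + d * M\<^sup>2 *
      ((\<Sum>j<K. real (card {x \<in> grid d N. \<not> admits_step d N (H j) x}))
       + (\<Sum>j<K. real (card {x \<in> grid d N. admits_step d N (H j) x \<and> \<not> nearly_affine d N f \<tau> (H j) x})))"
  proof -
    have "(\<Sum>x\<in>grid d N. of_bool (P x)) = real (card {x \<in> grid d N. P x})" for P
      by (simp add: of_bool_def sum.If_cases Int_def)
    then show ?thesis by (simp add: sum.distrib sum_distrib_left[symmetric])
  qed
  also have "\<dots> \<le> 4 * M\<^sup>2 * ?B + \<epsilon>\<^sup>2 / 32 * ?V + d * M\<^sup>2 * ((\<Sum>j<K. \<eta> * real N ^ d) + \<eta> * K * real N ^ d)"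
    using affine boundary unfolding H_def by (intro add_left_mono mult_left_mono add_mono sum_mono) auto
  also have "d * M\<^sup>2 * ((\<Sum>j<K. \<eta> * real N ^ d) + \<eta> * K * real N ^ d) = \<epsilon>\<^sup>2 / 32 * ?V"
    using M d by (simp add: \<eta>_def field_simps)
  finally have main: "\<epsilon>\<^sup>2 / 16 * ?V \<le> 4 * M\<^sup>2 * ?B" by linarith
  have "?B \<le> (\<Sum>j<K. \<Sum>x\<in>grid d N. 4 * (real A + 1))" using B_le by (intro sum_mono) auto
  then have "4 * M\<^sup>2 * ?B \<le> 4 * M\<^sup>2 * (4 * (real A + 1) * ?V)" by (intro mult_left_mono) (auto simp: mult_ac)
  also have "\<dots> = (16 * M\<^sup>2 * (A + 1)) * ?V" by simp
  finally have "\<epsilon>\<^sup>2 / 16 * ?V \<le> (16 * M\<^sup>2 * (A + 1)) * ?V" using main by linarith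
  then have "\<epsilon>\<^sup>2 / 16 \<le> 16 * M\<^sup>2 * (A + 1)" using V by (rule mult_right_le_imp_le)
  then show "\<epsilon>\<^sup>2 \<le> 256 * M\<^sup>2 * (A + 1)" by simp
  let ?Z = "{..<K} \<times> grid d N \<times> {..A}"
  let ?R = "\<Sum>j<K. \<Sum>x\<in>grid d N. \<Sum>a\<le>A. R j x a"
  have "?B \<le> (\<Sum>j<K. \<Sum>x\<in>grid d N. 64 * sqrt d * (\<Sum>a\<le>A. R j x a))" by (intro sum_mono B_reject)
  also have "\<dots> = 64 * sqrt d * ?R" by (simp add: sum_distrib_left)
  finally have "4 * M\<^sup>2 * ?B \<le> 4 * M\<^sup>2 * (64 * sqrt d * ?R)" by (intro mult_left_mono) auto
  with main have "\<epsilon>\<^sup>2 * ?V \<le> 4096 * sqrt d * M\<^sup>2 * ?R" by simp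
  moreover have "e / (c * b) \<le> r / (v * b)" if "e * v \<le> c * r" "0 < c" "0 < b" "0 < v" for e c b r v :: real
    using that by (simp add: divide_simps mult_ac)
  ultimately have "\<epsilon>\<^sup>2 / (4096 * sqrt d * M\<^sup>2 * (A + 1)) \<le> ?R / (?V * (A + 1))"
    using V d M by simp
  also have "\<dots> = measure_pmf.prob (bind_pmf (pmf_of_set ?Z) (sample_pair d N l)) {(u, v). f v < f u}"
  proof (subst measure_bind_pmf_of_set)
    have "0 \<in> {..<K}" using K by simp
    moreover have "(\<lambda>i\<in>{..<d}. 0) \<in> grid d N" using N by (simp add: grid_def)
    ultimately show "?Z \<noteq> {}" by blast
    have "(\<Sum>z\<in>?Z. measure_pmf.prob (sample_pair d N l z) {(u, v). f v < f u}) = ?R"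
      unfolding R_def by (simp add: sum.cartesian_product)
    then show "?R / (?V * (A + 1)) = (\<Sum>z\<in>?Z. measure_pmf.prob (sample_pair d N l z) {(u, v). f v < f u}) / real (card ?Z)"
      by (simp add: card_cartesian_product algebra_simps)
  qed auto
  finally show "\<epsilon>\<^sup>2 / (4096 * sqrt d * M\<^sup>2 * (A + 1))
      \<le> measure_pmf.prob (bind_pmf (pmf_of_set ?Z) (sample_pair d N l)) {(u, v). f v < f u}" .
qed

text \<open>The order of quantifiers matters: a single distribution, determined by \<open>d\<close>,
  \<open>M\<close>, \<epsilon> and \<open>A\<close>, works for all far functions. This is what makes
  the tester nonadaptive.\<close>

lemma pair_tester:
  fixes A :: nat and M \<epsilon> :: real
  assumes d: "0 < d" and M: "0 < M" and \<epsilon>: "0 < \<epsilon>" and A: "32 * real d * M\<^sup>2 \<le> \<epsilon>\<^sup>2 * 4 ^ A"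
  shows "\<exists>p :: ((nat \<Rightarrow> real) \<times> (nat \<Rightarrow> real)) pmf.
    (\<forall>(u, v)\<in>set_pmf p. u \<in> cube d \<and> v \<in> cube d \<and> u \<le> v) \<and>
    (\<forall>f. lipschitz_cube d M f \<and> \<epsilon> \<le> dist_mono d f \<longrightarrow>
       \<epsilon>\<^sup>2 / (4096 * sqrt d * M\<^sup>2 * (A + 1)) \<le> measure_pmf.prob p {(u, v). f v < f u} \<and>
       \<epsilon>\<^sup>2 \<le> 256 * M\<^sup>2 * (A + 1))"
proof -
  define \<tau> where "\<tau> = M / 2 ^ (A + 2)"
  define \<eta> where "\<eta> = \<epsilon>\<^sup>2 / (64 * real d * M\<^sup>2)"
  have \<tau>: "0 < \<tau>" and \<eta>: "0 < \<eta>" using M d \<epsilon> by (simp_all add: \<tau>_def \<eta>_def)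
  obtain K where K: "0 < K" and affine: "\<forall>N>0. \<forall>f. lipschitz_cube d M f \<longrightarrow>
    (\<Sum>j<K. real (card {x \<in> grid d N. admits_step d N (2 ^ Suc j) x \<and> \<not> nearly_affine d N f \<tau> (2 ^ Suc j) x}))
      \<le> \<eta> * K * real N ^ d"
    using nearly_affine_at_random_scale[OF \<tau> \<eta>, of M d] M by auto
  define l where "l = (LEAST l. sqrt d \<le> 2 ^ l)"
  have "\<exists>l. sqrt d \<le> 2 ^ l" using real_arch_pow[of 2 "sqrt d"] by (auto intro: less_imp_le)
  then have l1: "sqrt d \<le> 2 ^ l" unfolding l_def by (rule LeastI_ex)
  have l2: "2 ^ l \<le> 2 * sqrt d"
  proof (cases l)
    case 0
    have "1 \<le> sqrt d" using d by simp
    then have "1 \<le> 2 * sqrt d" by linarith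
    then show ?thesis using 0 by simp
  next
    case (Suc k)
    then have "\<not> sqrt d \<le> 2 ^ k" using not_less_Least[of k "\<lambda>l. sqrt d \<le> 2 ^ l"] by (simp add: l_def)
    then show ?thesis using Suc by simp
  qed
  \<comment> \<open>The three bounds make the grid nonempty, the boundary small at every scale, and
    the discretization error at most \<open>\<epsilon>^2 / 2\<close>.\<close>
  obtain n :: nat where n: "max 1 (max (d / \<eta>) (2 * sqrt d * M / \<epsilon>)) < n"
    using reals_Archimedean2 by blast
  have n0: "0 < n" and "2 * sqrt d * M \<le> n * \<epsilon>" and n2: "d \<le> \<eta> * n"
    using n \<epsilon> \<eta> by (auto simp: field_simps)
  then have "(2 * sqrt d * M)\<^sup>2 \<le> (n * \<epsilon>)\<^sup>2" using M by (intro power_mono) auto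
  then have n1: "4 * real d * M\<^sup>2 \<le> (real n)\<^sup>2 * \<epsilon>\<^sup>2" by (simp add: power_mult_distrib)
  define N where "N = n * 2 ^ K"
  have N: "0 < N" using n0 by (simp add: N_def)
  let ?Z = "{..<K} \<times> grid d N \<times> {..A}"
  let ?p = "bind_pmf (pmf_of_set ?Z) (sample_pair d N l)"
  have "(\<lambda>i\<in>{..<d}. 0) \<in> grid d N" using N by (simp add: grid_def)
  then have Z: "?Z \<noteq> {}" "finite ?Z" using K by auto
  have "u \<in> cube d \<and> v \<in> cube d \<and> u \<le> v" if "(u, v) \<in> set_pmf ?p" for u v
    using that Z by (auto dest!: sample_pair_legal[rotated])
  moreover have "\<epsilon>\<^sup>2 / (4096 * sqrt d * M\<^sup>2 * (A + 1)) \<le> measure_pmf.prob ?p {(u, v). f v < f u} \<and>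
       \<epsilon>\<^sup>2 \<le> 256 * M\<^sup>2 * (A + 1)" if "lipschitz_cube d M f" "\<epsilon> \<le> dist_mono d f" for f
    using affine N that
    by (intro conjI sample_pair_reject[OF that(1) d M \<epsilon> that(2) A l1 l2 \<tau>_def \<eta>_def K N_def _ n0 n1 n2]) auto
  ultimately show ?thesis by (intro exI[of _ ?p]) auto
qed

section \<open>The tester\<close>

text \<open>The support of \<open>p\<close> is countable, so that a seed can store the code of each sampled pair
  as a real number.\<close>

lemma boosted_tester:
  fixes p :: "((nat \<Rightarrow> real) \<times> (nat \<Rightarrow> real)) pmf"
  assumes legal: "\<And>u v. (u, v) \<in> set_pmf p \<Longrightarrow> u \<in> cube d \<and> v \<in> cube d \<and> u \<le> v"
    and reject: "\<And>f. lipschitz_cube d M f \<Longrightarrow> \<epsilon> \<le> dist_mono d f \<Longrightarrow>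
      measure_pmf.prob p {(u, v). f u \<le> f v} ^ q \<le> 1 / 3"
  shows "\<exists>T :: (nat \<Rightarrow> real) algorithm. L2_monotonicity_tester d M \<epsilon> (2 * q) T \<and>
    nonadaptive (2 * q) T \<and> one_sided_error d M (2 * q) T"
proof -
  define code where "code z = real (to_nat_on (set_pmf p) z)" for z
  \<comment> \<open>Legality of the queries is demanded for every seed, even outside the support. A
    real number that is no code is therefore decoded to some fixed pair of the support.\<close>
  define decode where "decode r = (if r \<in> code ` set_pmf p then inv_into (set_pmf p) code r
    else SOME z. z \<in> set_pmf p)" for r
  have inj: "inj_on code (set_pmf p)"
    using inj_on_to_nat_on[OF countable_set_pmf[of p]] by (auto simp: inj_on_def code_def)
  have decode_in: "decode r \<in> set_pmf p" for r
    using some_in_eq[of "set_pmf p"] set_pmf_not_empty[of p]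
    by (auto simp: decode_def inv_into_f_f[OF inj])
  have decode_code: "decode (code z) = z" if "z \<in> set_pmf p" for z
    using that by (simp add: decode_def inv_into_f_f[OF inj])
  define \<Omega> where "\<Omega> = Pi_pmf {..<q} 0 (\<lambda>_. map_pmf code p)"
  \<comment> \<open>Queries \<open>2 * k\<close> and \<open>2 * k + 1\<close> ask for the lower and
    the upper point of pair \<open>k\<close>.\<close>
  define point where "point \<omega> i = (if even i then fst else snd) (decode (\<omega> (i div 2)))" for \<omega> and i :: nat
  define T where "T = \<lparr>seeds = measure_pmf \<Omega>, next_query = \<lambda>\<omega> h. Value (point \<omega> (length h)),
    accepts = \<lambda>\<omega> h. \<forall>k<q. the (h ! (2 * k)) \<le> the (h ! (2 * k + 1))\<rparr>"
  have point_cube: "point \<omega> i \<in> cube d" for \<omega> i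
    using legal[of "fst (decode (\<omega> (i div 2)))" "snd (decode (\<omega> (i div 2)))"] decode_in
    by (auto simp: point_def)
  have answers: "answers T d f \<omega> m = map (\<lambda>i. Some (f (point \<omega> i))) [0..<m]" for f \<omega> m
    by (induction m) (auto simp: T_def)
  have accept: "accept_event T d f (2 * q)
      = {\<omega>. \<forall>k<q. f (fst (decode (\<omega> k))) \<le> f (snd (decode (\<omega> k)))}" for f
  proof -
    have "accepts T \<omega> (answers T d f \<omega> (2 * q))
        \<longleftrightarrow> (\<forall>k<q. f (fst (decode (\<omega> k))) \<le> f (snd (decode (\<omega> k))))" for \<omega>
      unfolding answers by (simp add: T_def point_def)
    then show ?thesis by (simp add: accept_event_def T_def)
  qed
  have mono: "accept_event T d f (2 * q) = UNIV" if "mono_on (cube d) f" for f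
  proof -
    have "f (fst z) \<le> f (snd z)" if "z \<in> set_pmf p" for z
      using legal[of "fst z" "snd z"] that \<open>mono_on (cube d) f\<close> by (auto simp: mono_on_def)
    then show ?thesis unfolding accept using decode_in by auto
  qed
  have prob: "measure_pmf.prob \<Omega> (accept_event T d f (2 * q)) = measure_pmf.prob p {(u, v). f u \<le> f v} ^ q" for f
  proof -
    have "measure_pmf.prob \<Omega> (accept_event T d f (2 * q))
        = measure_pmf.prob \<Omega> (Pi {..<q} (\<lambda>_. {r. f (fst (decode r)) \<le> f (snd (decode r))}))"
      unfolding accept by (intro arg_cong[where f = "measure_pmf.prob \<Omega>"]) auto
    also have "\<dots> = measure_pmf.prob (map_pmf code p) {r. f (fst (decode r)) \<le> f (snd (decode r))} ^ q"
      unfolding \<Omega>_def by (subst measure_Pi_pmf_Pi) auto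
    also have "measure_pmf.prob (map_pmf code p) {r. f (fst (decode r)) \<le> f (snd (decode r))}
        = measure_pmf.prob p {(u, v). f u \<le> f v}"
      unfolding measure_map_pmf
      by (intro measure_pmf.finite_measure_eq_AE) (auto simp: AE_measure_pmf_iff decode_code)
    finally show ?thesis .
  qed
  have "L2_monotonicity_tester d M \<epsilon> (2 * q) T"
    unfolding L2_monotonicity_tester_def
  proof (intro conjI allI impI ballI)
    show "prob_space (seeds T)" by (simp add: T_def measure_pmf.prob_space_axioms)
    show "legal_query d (next_query T \<omega> h)" for \<omega> h by (simp add: T_def point_cube)
  next
    fix f assume f: "lipschitz_cube d M f"
    \<comment> \<open>The seeds form a discrete measure, for which every set is measurable.\<close>
    show "accept_event T d f (2 * q) \<in> sets (seeds T)" by (simp add: T_def)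
    show "2 / 3 \<le> measure (seeds T) (accept_event T d f (2 * q))" if "mono_on (cube d) f"
      using mono[OF that] by (simp add: T_def)
    show "2 / 3 \<le> measure (seeds T) (reject_event T d f (2 * q))" if "\<epsilon> \<le> dist_mono d f"
    proof -
      have "measure (seeds T) (reject_event T d f (2 * q)) = 1 - measure_pmf.prob \<Omega> (accept_event T d f (2 * q))"
        using measure_pmf.prob_compl[of "accept_event T d f (2 * q)" \<Omega>]
        by (simp add: reject_event_def T_def)
      then show ?thesis using reject[OF f that] by (simp add: prob)
    qed
  qed
  moreover have "nonadaptive (2 * q) T" by (simp add: nonadaptive_def T_def)
  moreover have "one_sided_error d M (2 * q) T"
    using mono by (simp add: one_sided_error_def T_def)
  ultimately show ?thesis by blast
qed

text \<open>Here \<open>D\<close> is \<open>sqrt d\<close> and \<open>y\<close> is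
  \<open>M / \<epsilon>\<close>. For \<open>y \<ge> 1\<close> the argument of the logarithm is at
  most a constant times the square of \<open>F = D * y^2\<close>. For \<open>y < 1\<close> it may be
  far larger than any power of \<open>F\<close>, unless the second hypothesis is used: it keeps
  \<open>y\<close> from being too small in terms of \<open>D\<close>.\<close>

lemma level_count_bound:
  fixes D y B :: real
  assumes D: "1 \<le> D" and y: "0 < y" and B: "B \<le> log 2 (4 * (1 + 32 * D\<^sup>2 * y\<^sup>2))" "1 \<le> 256 * y\<^sup>2 * B"
  shows "B \<le> 120 * ln (2 + D * y\<^sup>2)"
proof -
  define F where "F = D * y\<^sup>2"
  have F: "0 < F" using D y by (simp add: F_def)
  have "4 * (1 + 32 * D\<^sup>2 * y\<^sup>2) \<le> (2 + F) ^ 60"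
  proof (cases "1 \<le> y")
    case True
    have y2: "1 \<le> y\<^sup>2" using True by (simp add: one_le_power)
    have F1: "1 \<le> F" using mult_mono[OF D y2] D by (simp add: F_def)
    have "D\<^sup>2 * y\<^sup>2 * 1 \<le> D\<^sup>2 * y\<^sup>2 * y\<^sup>2" using y2 by (intro mult_left_mono) auto
    also have "\<dots> = F\<^sup>2" by (simp add: F_def power2_eq_square mult_ac)
    finally have *: "D\<^sup>2 * y\<^sup>2 \<le> F\<^sup>2" by simp
    have "1 \<le> F\<^sup>2" using F1 by (simp add: one_le_power)
    with * have "4 * (1 + 32 * D\<^sup>2 * y\<^sup>2) \<le> 2 ^ 8 * F\<^sup>2" by simp
    also have "\<dots> \<le> (2 + F) ^ 8 * (2 + F)\<^sup>2" using F by (intro mult_mono power_mono) auto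
    also have "\<dots> = (2 + F) ^ 10" by (simp flip: power_add)
    also have "\<dots> \<le> (2 + F) ^ 60" using F by (intro power_increasing) auto
    finally show ?thesis .
  next
    case False
    have y2: "y\<^sup>2 \<le> 1" using False y by (simp add: power_le_one)
    have "D\<^sup>2 * y\<^sup>2 \<le> D\<^sup>2 * 1" using y2 by (intro mult_left_mono) auto
    moreover have D2: "1 \<le> D\<^sup>2" using D by (simp add: one_le_power)
    ultimately have X: "4 * (1 + 32 * D\<^sup>2 * y\<^sup>2) \<le> 2 ^ 8 * D\<^sup>2" by simp
    have ln2: "1 / 2 \<le> ln (2 :: real)" using ln2_ge_two_thirds by simp
    have sD: "1 \<le> sqrt D" using D by simp
    have "log 2 (sqrt D) = ln (sqrt D) / ln 2" by (simp add: log_def)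
    also have "\<dots> \<le> sqrt D / (1 / 2)"
      using ln_le_minus_one[of "sqrt D"] sD ln2 D by (intro frac_le) auto
    finally have logD: "log 2 (sqrt D) \<le> 2 * sqrt D" by simp
    \<comment> \<open>It suffices to bound \<open>B\<close> by a power of \<open>D\<close> with
      exponent below 1. With \<open>B \<le> 16 * sqrt D\<close>, the second hypothesis yields
      \<open>sqrt D \<le> 2 ^ 12 * F\<close>, so \<open>D\<close> is polynomially bounded in
      \<open>F\<close>.\<close>
    have "B \<le> log 2 (2 ^ 8 * D\<^sup>2)"
      using B(1) X D y by (intro order_trans[OF B(1)]) (simp add: add_pos_nonneg)
    also have "\<dots> = log 2 (2 ^ 8 * sqrt D ^ 4)"
    proof -
      have "sqrt D ^ 4 = (sqrt D ^ 2) ^ 2" by (simp only: power_mult[symmetric]) simp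
      then show ?thesis using D by simp
    qed
    also have "\<dots> = log 2 (2 ^ 8) + log 2 (sqrt D ^ 4)" using D by (intro log_mult_pos) auto
    also have "\<dots> = 8 + 4 * log 2 (sqrt D)"
      using D log_pow_cancel[of 2 8] log_nat_power[of "sqrt D" 2 4] by simp
    also have "\<dots> \<le> 16 * sqrt D" using logD sD by linarith
    finally have "B \<le> 16 * sqrt D" .
    then have "256 * y\<^sup>2 * B \<le> 256 * y\<^sup>2 * (16 * sqrt D)" by (intro mult_left_mono) auto
    with B(2) have "1 \<le> 256 * y\<^sup>2 * (16 * sqrt D)" by linarith
    then have "1 \<le> 2 ^ 12 * y\<^sup>2 * sqrt D" by simp
    then have "1 * sqrt D \<le> 2 ^ 12 * y\<^sup>2 * sqrt D * sqrt D" using D by (intro mult_right_mono) auto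
    also have "\<dots> = 2 ^ 12 * F" using D by (simp add: F_def mult.assoc)
    finally have "sqrt D \<le> 2 ^ 12 * F" by simp
    also have "\<dots> \<le> (2 + F) ^ 12 * (2 + F)" using F by (intro mult_mono power_mono) auto
    also have "\<dots> = (2 + F) ^ 13" using power_add[of "2 + F" 12 1] by simp
    finally have "sqrt D ^ 4 \<le> ((2 + F) ^ 13) ^ 4" using D by (intro power_mono) auto
    moreover have "sqrt D ^ 4 = D\<^sup>2"
    proof -
      have "sqrt D ^ 4 = (sqrt D ^ 2) ^ 2" by (simp only: power_mult[symmetric]) simp
      then show ?thesis using D by simp
    qed
    ultimately have "D\<^sup>2 \<le> (2 + F) ^ 52" by (simp flip: power_mult)
    moreover have "(2::real) ^ 8 \<le> (2 + F) ^ 8" using F by (intro power_mono) auto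
    ultimately have "2 ^ 8 * D\<^sup>2 \<le> (2 + F) ^ 8 * (2 + F) ^ 52" using F by (intro mult_mono) auto
    also have "\<dots> = (2 + F) ^ 60" by (simp flip: power_add)
    finally show ?thesis using X by linarith
  qed
  then have "B \<le> log 2 ((2 + F) ^ 60)"
    using F by (intro order_trans[OF B(1)]) (simp add: add_pos_nonneg)
  also have "\<dots> = 60 * (ln (2 + F) / ln 2)" 
    using F log_nat_power[of "2 + F" 2 60] by (simp add: log_def)
  also have "\<dots> \<le> 60 * (ln (2 + F) / (1 / 2))"
    using ln2_ge_two_thirds F by (intro mult_left_mono divide_left_mono) auto
  finally show ?thesis by (simp add: F_def)
qed

text \<open>Enough levels for the slopes below the last one to have square norm at most
  \<open>\<epsilon>^2 / 32\<close> over all \<open>d\<close> coordinates. The summand 1 keeps the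
  logarithm nonnegative.\<close>

definition levels :: "nat \<Rightarrow> real \<Rightarrow> real \<Rightarrow> nat" where
  "levels d M \<epsilon> = nat \<lceil>log 2 (1 + 32 * real d * M\<^sup>2 / \<epsilon>\<^sup>2)\<rceil>"

text \<open>No query is asked in the first case, where no \<open>M\<close>-Lipschitz function is \<open>\<epsilon>\<close>-far from monotone.\<close>

definition repetitions :: "nat \<Rightarrow> real \<Rightarrow> real \<Rightarrow> nat" where
  "repetitions d M \<epsilon> = (if d = 0 \<or> 256 * M\<^sup>2 * (levels d M \<epsilon> + 1) < \<epsilon>\<^sup>2 then 0
     else nat \<lceil>8192 * sqrt d * M\<^sup>2 * (levels d M \<epsilon> + 1) / \<epsilon>\<^sup>2\<rceil>)"

lemma levels_bounds:
  assumes "0 < \<epsilon>"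
  shows "32 * real d * M\<^sup>2 \<le> \<epsilon>\<^sup>2 * 4 ^ levels d M \<epsilon>"
    and "real (levels d M \<epsilon> + 1) \<le> log 2 (4 * (1 + 32 * real d * M\<^sup>2 / \<epsilon>\<^sup>2))"
proof -
  define X where "X = 1 + 32 * real d * M\<^sup>2 / \<epsilon>\<^sup>2"
  have X: "1 \<le> X" by (simp add: X_def)
  then have log: "0 \<le> log 2 X" by simp
  then have lev: "log 2 X \<le> levels d M \<epsilon>" "real (levels d M \<epsilon>) \<le> log 2 X + 1"
    unfolding levels_def X_def[symmetric] by linarith+
  have "32 * real d * M\<^sup>2 / \<epsilon>\<^sup>2 \<le> X" by (simp add: X_def)
  also have "\<dots> = 2 powr log 2 X" using X by simp
  also have "\<dots> \<le> 2 powr levels d M \<epsilon>" using lev by (intro powr_mono) auto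
  also have "\<dots> = 2 ^ levels d M \<epsilon>" by (simp add: powr_realpow)
  also have "\<dots> \<le> 4 ^ levels d M \<epsilon>" by (intro power_mono) auto
  finally show "32 * real d * M\<^sup>2 \<le> \<epsilon>\<^sup>2 * 4 ^ levels d M \<epsilon>" using assms by (simp add: field_simps)
  have "log 2 (4 * X) = log 2 4 + log 2 X" using X by (intro log_mult_pos) auto
  moreover have "log 2 (4::real) = 2" using log_pow_cancel[of 2 2] by simp
  ultimately show "real (levels d M \<epsilon> + 1) \<le> log 2 (4 * (1 + 32 * real d * M\<^sup>2 / \<epsilon>\<^sup>2))"
    using lev unfolding X_def[symmetric] by simp
qed

lemma tester_exists:
  fixes M \<epsilon> :: real
  assumes M: "0 < M" and \<epsilon>: "0 < \<epsilon>"
  shows "\<exists>T :: (nat \<Rightarrow> real) algorithm. L2_monotonicity_tester d M \<epsilon> (2 * repetitions d M \<epsilon>) T \<and>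
    nonadaptive (2 * repetitions d M \<epsilon>) T \<and> one_sided_error d M (2 * repetitions d M \<epsilon>) T"
proof (cases "d = 0")
  case True
  let ?x = "\<lambda>i\<in>{..<d}. 0 :: real"
  have "\<not> \<epsilon> \<le> dist_mono d f" if "lipschitz_cube d M f" for f
  proof
    assume "\<epsilon> \<le> dist_mono d f"
    \<comment> \<open>Without coordinates the energy is an empty sum, so no function is far from
      monotone and the tester with no repetitions is correct.\<close>
    from directed_poincare[OF that M \<epsilon> this, of 1 1] True have "\<epsilon>\<^sup>2 \<le> 0" by simp
    then show False using \<epsilon> by simp
  qed
  then show ?thesis
    by (intro boosted_tester[of "return_pmf (?x, ?x)"]) (auto simp: cube_def)
next
  case False
  then have d: "0 < d" by simp
  let ?A = "levels d M \<epsilon>" and ?q = "repetitions d M \<epsilon>"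
  define \<delta> where "\<delta> = \<epsilon>\<^sup>2 / (4096 * sqrt d * M\<^sup>2 * (?A + 1))"
  obtain p :: "((nat \<Rightarrow> real) \<times> (nat \<Rightarrow> real)) pmf"
    where legal: "\<forall>(u, v)\<in>set_pmf p. u \<in> cube d \<and> v \<in> cube d \<and> u \<le> v"
    and far: "\<forall>f. lipschitz_cube d M f \<and> \<epsilon> \<le> dist_mono d f \<longrightarrow>
       \<delta> \<le> measure_pmf.prob p {(u, v). f v < f u} \<and> \<epsilon>\<^sup>2 \<le> 256 * M\<^sup>2 * (?A + 1)"
    using pair_tester[OF d M \<epsilon> levels_bounds(1)[OF \<epsilon>]] unfolding \<delta>_def by blast
  show ?thesis
  proof (rule boosted_tester[of p])
    show "u \<in> cube d \<and> v \<in> cube d \<and> u \<le> v" if "(u, v) \<in> set_pmf p" for u v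
      using legal that by auto
  next
    fix f assume "lipschitz_cube d M f" "\<epsilon> \<le> dist_mono d f"
    then have f: "\<delta> \<le> measure_pmf.prob p {(u, v). f v < f u}" "\<epsilon>\<^sup>2 \<le> 256 * M\<^sup>2 * (?A + 1)"
      using far by blast+
    have \<delta>: "0 < \<delta>" using M \<epsilon> d by (simp add: \<delta>_def)
    \<comment> \<open>The constant 8192 is twice 4096, so that the expected number of violations is
      at least 2; this suffices since \<open>exp (- 2) \<le> 1 / 3\<close>.\<close>
    have "2 / \<delta> = 8192 * sqrt d * M\<^sup>2 * (?A + 1) / \<epsilon>\<^sup>2" by (simp add: \<delta>_def)
    then have "2 / \<delta> \<le> ?q" using f(2) d unfolding repetitions_def by (simp add: not_less)
    then have q: "2 \<le> \<delta> * ?q" using \<delta> by (simp add: field_simps)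
    have "UNIV - {(u, v). f v < f u} = {(u, v). f u \<le> f v}" by auto
    then have "measure_pmf.prob p {(u, v). f u \<le> f v} = 1 - measure_pmf.prob p {(u, v). f v < f u}"
      using measure_pmf.prob_compl[of "{(u, v). f v < f u}" p] by simp
    then have "measure_pmf.prob p {(u, v). f u \<le> f v} \<le> 1 - \<delta>" using f(1) by simp
    also have "\<dots> \<le> exp (- \<delta>)" using exp_ge_add_one_self[of "- \<delta>"] by simp
    finally have "measure_pmf.prob p {(u, v). f u \<le> f v} ^ ?q \<le> exp (- \<delta>) ^ ?q"
      by (intro power_mono) auto
    also have "\<dots> = exp (- (\<delta> * ?q))" by (simp flip: exp_of_nat_mult add: mult_ac)
    also have "\<dots> \<le> exp (- 2)" using q by simp
    also have "\<dots> \<le> 1 / 3" using exp_ge_add_one_self[of 2] by (simp add: exp_minus field_simps)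
    finally show "measure_pmf.prob p {(u, v). f u \<le> f v} ^ ?q \<le> 1 / 3" .
  qed
qed

lemma repetitions_bound:
  fixes d :: nat and M \<epsilon> :: real
  assumes M: "0 < M" and \<epsilon>: "0 < \<epsilon>"
  defines "F \<equiv> sqrt (real d) * M\<^sup>2 / \<epsilon>\<^sup>2"
  shows "real (repetitions d M \<epsilon>) \<le> 1100000 * F * ln (2 + F)"
proof (cases "d = 0 \<or> 256 * M\<^sup>2 * (levels d M \<epsilon> + 1) < \<epsilon>\<^sup>2")
  case True
  have "0 \<le> F" by (simp add: F_def)
  then show ?thesis using True by (simp add: repetitions_def)
next
  case False
  let ?B = "real (levels d M \<epsilon> + 1)"
  define y where "y = M / \<epsilon>"
  have y: "0 < y" using M \<epsilon> by (simp add: y_def)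
  have d: "1 \<le> sqrt (real d)" using False by simp
  have F: "F = sqrt (real d) * y\<^sup>2" by (simp add: F_def y_def power_divide)
  have F0: "0 < F" unfolding F using d y by (intro mult_pos_pos) (auto simp: zero_less_power)
  have one: "1 \<le> 256 * y\<^sup>2 * ?B"
    using False \<epsilon> by (simp add: y_def power_divide not_less field_simps)
  have "?B \<le> log 2 (4 * (1 + 32 * (sqrt (real d))\<^sup>2 * y\<^sup>2))"
    using levels_bounds(2)[OF \<epsilon>, of d M] by (simp add: y_def power_divide)
  then have B: "?B \<le> 120 * ln (2 + F)"
    unfolding F using one by (intro level_count_bound d y)
  have "y\<^sup>2 \<le> F" unfolding F using d by (simp add: mult_le_cancel_right1)
  then have "y\<^sup>2 * ?B \<le> F * ?B" by (intro mult_right_mono) auto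
  \<comment> \<open>Rounding up costs at most 1. Since the case without queries is excluded, this is
    absorbed by a multiple of \<open>F * ?B\<close>, even when \<open>F\<close> is small.\<close>
  then have oneF: "1 \<le> 256 * (F * ?B)" using one by linarith
  have "0 \<le> 8192 * (F * ?B)" using F0 by simp
  moreover have "repetitions d M \<epsilon> = nat \<lceil>8192 * (F * ?B)\<rceil>"
    using False by (simp add: repetitions_def F_def mult_ac)
  ultimately have "real (repetitions d M \<epsilon>) \<le> 8192 * (F * ?B) + 1" by linarith
  also have "\<dots> \<le> 8448 * (F * ?B)" using oneF by linarith
  also have "\<dots> \<le> 8448 * (F * (120 * ln (2 + F)))" using B F0 by (intro mult_left_mono) auto
  also have "\<dots> \<le> 1100000 * F * ln (2 + F)" using F0 by simp
  finally show ?thesis .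
qed

theorem theorem1p2:
  "\<exists>(m :: nat \<Rightarrow> real \<Rightarrow> real \<Rightarrow> nat) (T :: nat \<Rightarrow> real \<Rightarrow> real \<Rightarrow> (nat \<Rightarrow> real) algorithm).
     (\<forall>d M \<epsilon>. M > 0 \<and> \<epsilon> > 0 \<longrightarrow>
        L2_monotonicity_tester d M \<epsilon> (m d M \<epsilon>) (T d M \<epsilon>) \<and>
        nonadaptive (m d M \<epsilon>) (T d M \<epsilon>) \<and>
        one_sided_error d M (m d M \<epsilon>) (T d M \<epsilon>)) \<and>
     (\<lambda>(d, M, \<epsilon>). real (m d M \<epsilon>)) \<in>
       soft_O {(d, M, \<epsilon>). M > 0 \<and> \<epsilon> > 0} (\<lambda>(d, M, \<epsilon>). sqrt (real d) * M\<^sup>2 / \<epsilon>\<^sup>2)"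
proof -
  define good where "good d M \<epsilon> T \<longleftrightarrow> L2_monotonicity_tester d M \<epsilon> (2 * repetitions d M \<epsilon>) T \<and>
    nonadaptive (2 * repetitions d M \<epsilon>) T \<and> one_sided_error d M (2 * repetitions d M \<epsilon>) T"
    for d M \<epsilon> and T :: "(nat \<Rightarrow> real) algorithm"
  define T where "T d M \<epsilon> = (SOME T. good d M \<epsilon> T)" for d M \<epsilon>
  have "good d M \<epsilon> (T d M \<epsilon>)" if "0 < M" "0 < \<epsilon>" for d M \<epsilon>
    unfolding T_def by (rule someI_ex) (use tester_exists[OF that, of d] in \<open>simp add: good_def\<close>)
  moreover have "(\<lambda>(d, M, \<epsilon>). real (2 * repetitions d M \<epsilon>)) \<in>
      soft_O {(d, M, \<epsilon>). M > 0 \<and> \<epsilon> > 0} (\<lambda>(d, M, \<epsilon>). sqrt (real d) * M\<^sup>2 / \<epsilon>\<^sup>2)"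
    unfolding soft_O_def
  proof (intro CollectI exI ballI)
    fix z :: "nat \<times> real \<times> real" assume "z \<in> {(d, M, \<epsilon>). M > 0 \<and> \<epsilon> > 0}"
    then obtain d M \<epsilon> where z: "z = (d, M, \<epsilon>)" "0 < M" "0 < \<epsilon>" by auto
    then show "\<bar>case z of (d, M, \<epsilon>) \<Rightarrow> real (2 * repetitions d M \<epsilon>)\<bar>
        \<le> 2200000 * \<bar>case z of (d, M, \<epsilon>) \<Rightarrow> sqrt (real d) * M\<^sup>2 / \<epsilon>\<^sup>2\<bar>
          * ln (2 + \<bar>case z of (d, M, \<epsilon>) \<Rightarrow> sqrt (real d) * M\<^sup>2 / \<epsilon>\<^sup>2\<bar>) ^ 1"
      using repetitions_bound[OF z(2,3), of d] by simp
  qed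
  ultimately show ?thesis
    unfolding good_def by (intro exI[of _ "\<lambda>d M \<epsilon>. 2 * repetitions d M \<epsilon>"] exI[of _ T]) simp
qed

end
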